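(* Let $n\ge1$ and, for $k=1,\dots,n$, let $\pi_k^n$ be the (complex, finite-dimensional) representation of $\mathfrak{S}_n$ with character $\tau_k^n$. Then for every $k=1,\dots,n$ there are isomorphisms of $\mathfrak{S}_n$-modules $$\mathcal{F}_n^*(k-1)\cong\bigoplus_{i=1}^{k}\pi_i^n\qquad\text{and}\qquad \pi_k^n\cong \mathcal{F}_n^*(k-1)/\mathcal{F}_n^*(k-2),$$ where $\mathcal{F}_n^*(-1)=0$.
   Context: $\mathfrak{S}_n$ is the group of permutations of $\{1,\dots,n\}$ and $\ell_n(g)$ is the number of cycles of $g$ (fixed points included). For an integer $k\ge1$ put $\sigma_k^n(g)=k^{\ell_n(g)}$, and for $k=1,\dots,n$ define $\tau_k^n=\sum_{j=0}^{k-1}(-1)^j\binom{n+1}{j}\sigma^n_{k-j}$. It is known that each $\tau_k^n$ is the trace of a finite-dimensional complex representation of $\mathfrak{S}_n$ (unique up to isomorphism). $\mathcal{R}_n=\mathbb{C}[x_1,\dots,x_n]$, on which $\mathfrak{S}_n$ acts by permuting the variables. $I_n$ is the ideal of $\mathcal{R}_n$ generated by the symmetric polynomials without constant term; the coinvariant algebra is $\mathcal{R}_n^*=\mathcal{R}_n/I_n$ with canonical projection $P_n:\mathcal{R}_n\to\mathcal{R}_n^*$, and it inherits an $\mathfrak{S}_n$-action. For a multidegree $p=(p_1,\dots,p_n)$ let $\lambda(p)$ be the partition obtained by arranging the coordinates of $p$ in non-increasing order; partitions are compared lexicographically. For $f=\sum_p b_px^p\in\mathcal{R}_n$, the partition degree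 $\mathrm{pdeg}(f)$ is the minimal partition $\mu$ such that $b_p=0$ whenever $\lambda(p)>\mu$; $\mathrm{pdeg}(f)_1$ denotes its largest part. For $k=0,1,2,\dots$ set $\mathcal{F}_n(k)=\{f\in\mathcal{R}_n:\mathrm{pdeg}(f)_1\le k\}$ (equivalently, the polynomials all of whose monomials have every exponent at most $k$) and $\mathcal{F}_n^*(k)=P_n(\mathcal{F}_n(k))$; these are $\mathfrak{S}_n$-submodules of $\mathcal{R}_n$ and $\mathcal{R}_n^*$ respectively. *)

theory Defs
  imports
    "Jordan_Normal_Form.VS_Connect"
    "HOL-Algebra.Sym_Groups"
    "HOL-Algebra.QuotRing"
    "HOL-Combinatorics.Orbits"
    "HOL-Library.Poly_Mapping"
    "HOL-Library.List_Lexorder"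
begin

hide_const (open) Multiset.mult Polynomial.smult Modules.module Modules.module_hom

section \<open>Complex representations of a group\<close>

abbreviation complex_field :: "complex ring"
  where "complex_field \<equiv> class_ring"

locale group_module =
  G: group G + vectorspace complex_field V
  for G :: "('g, 'm) monoid_scheme" and V :: "(complex, 'v) module"
    and \<rho> :: "'g \<Rightarrow> 'v \<Rightarrow> 'v" +
  assumes act_linear: "g \<in> carrier G \<Longrightarrow> \<rho> g \<in> module_hom complex_field V V"
    and act_one: "x \<in> carrier V \<Longrightarrow> \<rho> \<one>\<^bsub>G\<^esub> x = x"
    and act_mult: "\<lbrakk>g \<in> carrier G; h \<in> carrier G; x \<in> carrier V\<rbrakk>
      \<Longrightarrow> \<rho> (g \<otimes>\<^bsub>G\<^esub> h) x = \<rho> g (\<rho> h x)"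

locale fin_dim_representation = group_module +
  assumes finite_dimensional: "vectorspace.fin_dim complex_field V"

definition group_module_iso ::
  "('g, 'm) monoid_scheme \<Rightarrow> (complex, 'v) module \<Rightarrow> ('g \<Rightarrow> 'v \<Rightarrow> 'v)
    \<Rightarrow> (complex, 'w) module \<Rightarrow> ('g \<Rightarrow> 'w \<Rightarrow> 'w) \<Rightarrow> bool" where
  "group_module_iso G V \<rho> W \<phi> \<longleftrightarrow>
     group_module G V \<rho> \<and> group_module G W \<phi> \<and>
     (\<exists>T \<in> module_hom complex_field V W. bij_betw T (carrier V) (carrier W) \<and>
        (\<forall>g \<in> carrier G. \<forall>x \<in> carrier V. T (\<rho> g x) = \<phi> g (T x)))"

definition coordinates :: "(complex, 'v) module \<Rightarrow> 'v set \<Rightarrow> 'v \<Rightarrow> 'v \<Rightarrow> complex" where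
  "coordinates V B v = (THE a. a \<in> B \<rightarrow>\<^sub>E UNIV \<and> module.lincomb V a B = v)"

text \<open>The trace is the sum of the diagonal coefficients in some finite basis; it is used only for
  endomorphisms of finite-dimensional spaces, where the choice of the basis is irrelevant.\<close>

definition linear_trace :: "(complex, 'v) module \<Rightarrow> ('v \<Rightarrow> 'v) \<Rightarrow> complex" where
  "linear_trace V T =
     (let B = (SOME B. finite B \<and> vectorspace.basis complex_field V B)
      in \<Sum>b\<in>B. coordinates V B (T b) b)"

definition character :: "(complex, 'v) module \<Rightarrow> ('g \<Rightarrow> 'v \<Rightarrow> 'v) \<Rightarrow> 'g \<Rightarrow> complex" where
  "character V \<rho> g = linear_trace V (\<rho> g)"

text \<open>A module record also has ring multiplication fields, which play no role for the vector
  space structure.  The direct sum is over a finite index set, hence equals the product.\<close>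

definition module_sum :: "'i set \<Rightarrow> ('i \<Rightarrow> (complex, 'v) module) \<Rightarrow> (complex, 'i \<Rightarrow> 'v) module" where
  "module_sum I V =
     \<lparr>carrier = (\<Pi>\<^sub>E i\<in>I. carrier (V i)),
      mult = (\<lambda>x y. \<lambda>i\<in>I. x i \<otimes>\<^bsub>V i\<^esub> y i),
      one = (\<lambda>i\<in>I. \<one>\<^bsub>V i\<^esub>),
      zero = (\<lambda>i\<in>I. \<zero>\<^bsub>V i\<^esub>),
      add = (\<lambda>x y. \<lambda>i\<in>I. x i \<oplus>\<^bsub>V i\<^esub> y i),
      smult = (\<lambda>c x. \<lambda>i\<in>I. c \<odot>\<^bsub>V i\<^esub> x i)\<rparr>"

definition action_sum :: "'i set \<Rightarrow> ('i \<Rightarrow> 'g \<Rightarrow> 'v \<Rightarrow> 'v) \<Rightarrow> 'g \<Rightarrow> ('i \<Rightarrow> 'v) \<Rightarrow> 'i \<Rightarrow> 'v" where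
  "action_sum I \<rho> g x = (\<lambda>i\<in>I. \<rho> i g (x i))"

text \<open>Quotients consist of cosets as in \<^const>\<open>FactRing\<close>.  For a coset \<open>X = N + x\<close>, the set
  \<open>N + c \<cdot> X\<close> is the coset of \<open>c \<cdot> x\<close> (adding \<open>N\<close> matters only for \<open>c = 0\<close>), and for an
  invertible \<open>g\<close> stabilising \<open>N\<close>, the image of \<open>X\<close> under \<open>g\<close> is the coset of \<open>g \<cdot> x\<close>.\<close>

definition quotient_module :: "(complex, 'v) module \<Rightarrow> 'v set \<Rightarrow> (complex, 'v set) module" where
  "quotient_module M N =
     ring.extend (M Quot N) (module.fields (\<lambda>c X. N <+>\<^bsub>M\<^esub> ((\<lambda>x. c \<odot>\<^bsub>M\<^esub> x) ` X)))"

definition quotient_action :: "('g \<Rightarrow> 'v \<Rightarrow> 'v) \<Rightarrow> 'g \<Rightarrow> 'v set \<Rightarrow> 'v set" where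
  "quotient_action \<rho> g X = \<rho> g ` X"

section \<open>The class functions\<close>

text \<open>The cycles of a permutation, fixed points included, correspond to its orbits.\<close>

definition num_cycles :: "nat \<Rightarrow> (nat \<Rightarrow> nat) \<Rightarrow> nat" where
  "num_cycles n g = card (orbit g ` {1..n})"

definition sigma_char :: "nat \<Rightarrow> nat \<Rightarrow> (nat \<Rightarrow> nat) \<Rightarrow> complex" where
  "sigma_char n k g = of_nat k ^ num_cycles n g"

definition tau_char :: "nat \<Rightarrow> nat \<Rightarrow> (nat \<Rightarrow> nat) \<Rightarrow> complex" where
  "tau_char n k g = (\<Sum>j = 0..k - 1. (-1) ^ j * of_nat ((n + 1) choose j) * sigma_char n (k - j) g)"

section \<open>The coinvariant algebra and its filtration\<close>

text \<open>A multidegree is a finitely supported function on indices and a polynomial a finitely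
  supported function on multidegrees; the polynomial ring in \<open>x\<^sub>1, \<dots>, x\<^sub>n\<close> consists of the
  polynomials involving only indices in \<open>{1..n}\<close>.\<close>

type_synonym multidegree = "nat \<Rightarrow>\<^sub>0 nat"
type_synonym mpoly = "multidegree \<Rightarrow>\<^sub>0 complex"

definition multidegrees :: "nat \<Rightarrow> multidegree set" where
  "multidegrees n = {p. Poly_Mapping.keys p \<subseteq> {1..n}}"

definition poly_ring :: "nat \<Rightarrow> (complex, mpoly) module" where
  "poly_ring n =
     \<lparr>carrier = {f. Poly_Mapping.keys f \<subseteq> multidegrees n},
      mult = (*), one = 1, zero = 0, add = (+),
      smult = (\<lambda>c f. Poly_Mapping.single 0 c * f)\<rparr>"

text \<open>\<open>g\<close> acts by \<open>x\<^sub>i \<mapsto> x\<^bsub>g i\<^esub>\<close>: the coefficient of \<open>x\<^sup>p\<close> in \<open>g \<cdot> f\<close> is the coefficient of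
  \<open>x\<^bsup>p \<circ> g\<^esup>\<close> in \<open>f\<close>.\<close>

definition perm_action :: "(nat \<Rightarrow> nat) \<Rightarrow> mpoly \<Rightarrow> mpoly" where
  "perm_action g f = Poly_Mapping.map_key (Poly_Mapping.map_key g) f"

definition symmetric_poly :: "nat \<Rightarrow> mpoly \<Rightarrow> bool" where
  "symmetric_poly n f \<longleftrightarrow>
     f \<in> carrier (poly_ring n) \<and> (\<forall>g \<in> carrier (sym_group n). perm_action g f = f)"

definition coinv_ideal :: "nat \<Rightarrow> mpoly set" where
  "coinv_ideal n =
     Idl\<^bsub>poly_ring n\<^esub> {f. symmetric_poly n f \<and> Poly_Mapping.lookup f 0 = 0}"

definition coinv_algebra :: "nat \<Rightarrow> (complex, mpoly set) module" where
  "coinv_algebra n = quotient_module (poly_ring n) (coinv_ideal n)"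

definition coinv_proj :: "nat \<Rightarrow> mpoly \<Rightarrow> mpoly set" where
  "coinv_proj n f = coinv_ideal n +>\<^bsub>poly_ring n\<^esub> f"

definition coinv_action :: "(nat \<Rightarrow> nat) \<Rightarrow> mpoly set \<Rightarrow> mpoly set" where
  "coinv_action = quotient_action perm_action"

text \<open>Partitions with at most \<open>n\<close> parts are non-increasing lists of length \<open>n\<close>, padded by zeros;
  the order on lists is the lexicographic one.\<close>

definition partitions :: "nat \<Rightarrow> nat list set" where
  "partitions n = {\<mu>. length \<mu> = n \<and> sorted_wrt (\<ge>) \<mu>}"

definition partition_of :: "nat \<Rightarrow> multidegree \<Rightarrow> nat list" where
  "partition_of n p = rev (sort (map (Poly_Mapping.lookup p) [1..<n + 1]))"

definition pdeg :: "nat \<Rightarrow> mpoly \<Rightarrow> nat list" where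
  "pdeg n f = (LEAST \<mu>. \<mu> \<in> partitions n \<and>
     (\<forall>p \<in> multidegrees n. partition_of n p > \<mu> \<longrightarrow> Poly_Mapping.lookup f p = 0))"

definition filt :: "nat \<Rightarrow> nat \<Rightarrow> mpoly set" where
  "filt n k = {f \<in> carrier (poly_ring n). hd (pdeg n f) \<le> k}"

text \<open>The index is an integer in order to include the convention that the member of
  index \<open>-1\<close> is the zero subspace.\<close>

definition coinv_filt :: "nat \<Rightarrow> int \<Rightarrow> mpoly set set" where
  "coinv_filt n k =
     (if k < 0 then {\<zero>\<^bsub>coinv_algebra n\<^esub>} else coinv_proj n ` filt n (nat k))"

definition coinv_filt_module :: "nat \<Rightarrow> int \<Rightarrow> (complex, mpoly set) module" where
  "coinv_filt_module n k = (coinv_algebra n)\<lparr>carrier := coinv_filt n k\<rparr>"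

end

theory Submission
  imports Defs "HOL-Computational_Algebra.Formal_Power_Series"
begin

text \<open>
  Sorting the exponents of a monomial and peeling off their layers exhibits it as the leading
  monomial of a unique product \<open>e\<^sup>\<nu> x\<^bsup>a(w)\<^esup>\<close>, where \<open>e\<^sup>\<nu>\<close> is a product of elementary symmetric
  polynomials and \<open>x\<^bsup>a(w)\<^esup>\<close> is the descent monomial of the permutation \<open>w\<close> that does the sorting.
  The largest exponent of that monomial is \<open>\<bar>\<nu>\<bar> + des(w)\<close>, and multiplication by an elementary
  symmetric polynomial raises largest exponents by at most one.  Hence the products with
  \<open>\<bar>\<nu>\<bar> + des(w) \<le> k\<close> form a basis of \<open>F\<^sub>n(k)\<close>, those with \<open>\<nu> \<noteq> 0\<close> span the coinvariant ideal, and
  the descent monomials with \<open>des(w) \<le> k\<close> yield a basis of \<open>F\<^sub>n\<^sup>*(k)\<close>.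

  Since \<open>e\<^sup>\<nu>\<close> is invariant, the diagonal coefficient of a permutation \<open>g\<close> at \<open>e\<^sup>\<nu> x\<^bsup>a(w)\<^esup>\<close> is a number
  \<open>d\<^sub>w(g)\<close> independent of \<open>\<nu>\<close>.  Comparing the trace of \<open>g\<close> on \<open>F\<^sub>n(k)\<close> in this basis with the number
  of monomials fixed by \<open>g\<close> expresses \<open>(k + 1)\<^bsup>l(g)\<^esup>\<close> as the sum over \<open>w\<close> of \<open>d\<^sub>w(g)\<close> times the
  number of \<open>\<nu>\<close> with \<open>\<bar>\<nu>\<bar> \<le> k - des(w)\<close>.  The generating function of these numbers is
  \<open>(1 - X)\<^bsup>-n-1\<^esup>\<close>, so the \<open>d\<^sub>w(g)\<close> with \<open>des(w) = k - 1\<close> add up to \<open>\<tau>\<^sub>k\<^sup>n(g)\<close>.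

  It remains to see that representations with the same character are isomorphic.  Among the
  intertwiners take one of maximal rank, with an equivariant generalized inverse; its kernel and
  cokernel have the same character, and if they were nonzero, the average of a suitable linear map
  between them would be a nonzero intertwiner, raising the rank.
\<close>

text \<open>A monomial order would put the leading monomial of \<open>e\<^sub>j x\<^sup>p\<close> at
  \<open>p\<close> plus a fixed exponent, whereas here it has to depend on how \<open>p\<close> is
  sorted. Hence \<open>rank\<close>: it adds up, over all \<open>s\<close>, the largest total key of
  \<open>s\<close> variables. Being a sum of maxima, it grows under multiplication by a squarefree
  monomial of degree \<open>j\<close> by at most a constant depending on \<open>n\<close> and
  \<open>j\<close> only, and by exactly that constant only when the monomial sits on the
  \<open>j\<close> largest keys. Keys break ties between equal exponents by the index, which makes
  the sorting permutation unique and confines its descents to strict drops of the exponent. The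
  ideal is generated by all symmetric polynomials without constant term, so describing it takes the
  fundamental theorem of symmetric polynomials; the same basis and the same rank prove it.
  Irreducible representations never enter. The comparison of characters rests on the fact that the
  trace of an idempotent complex matrix is a natural number, zero only for the zero matrix. The
  diagonal coefficients are never computed either; only their sums over permutations with equally
  many descents are determined.\<close>

hide_const (open) Multiset.mult Polynomial.smult Modules.module Modules.module_hom

abbreviation "lookup \<equiv> Poly_Mapping.lookup"
abbreviation "keys \<equiv> Poly_Mapping.keys"
abbreviation "single \<equiv> Poly_Mapping.single"

section \<open>Finitely supported matrices\<close>

text \<open>Finite support over an arbitrary index type puts matrices of all sizes, square and
  rectangular, into one ring. Over an infinite index type this ring has no unit, so the role of
  identity matrices is taken by idempotents.\<close>

typedef 'i fmat = "{A :: 'i \<Rightarrow> 'i \<Rightarrow> complex. finite {(i, j). A i j \<noteq> 0}}"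
  morphisms entry Abs_fmat
  by (rule exI[of _ "\<lambda>_ _. 0"]) simp

setup_lifting type_definition_fmat

lemma fmat_eqI: "(\<And>i j. entry A i j = entry B i j) \<Longrightarrow> A = B"
  by transfer auto

definition fsupp :: "'i fmat \<Rightarrow> 'i set" where
  "fsupp A = {i. \<exists>j. entry A i j \<noteq> 0 \<or> entry A j i \<noteq> 0}"

lemma finite_fsupp [simp]: "finite (fsupp A)"
proof -
  have fin: "finite {(i, j). entry A i j \<noteq> 0}"
    using entry[of A] by simp
  have "fsupp A \<subseteq> fst ` {(i, j). entry A i j \<noteq> 0} \<union> snd ` {(i, j). entry A i j \<noteq> 0}"
    unfolding fsupp_def by force
  then show ?thesis
    using fin by (meson finite_Un finite_imageI finite_subset)
qed

lemma entry_eq_0: "i \<notin> fsupp A \<or> j \<notin> fsupp A \<Longrightarrow> entry A i j = 0"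
  unfolding fsupp_def by auto

instantiation fmat :: (type) ring
begin

lift_definition zero_fmat :: "'a fmat" is "\<lambda>_ _. 0" by simp

lift_definition plus_fmat :: "'a fmat \<Rightarrow> 'a fmat \<Rightarrow> 'a fmat" is "\<lambda>A B i j. A i j + B i j"
proof -
  fix A B :: "'a \<Rightarrow> 'a \<Rightarrow> complex"
  assume fin: "finite {(i, j). A i j \<noteq> 0}" "finite {(i, j). B i j \<noteq> 0}"
  show "finite {(i, j). A i j + B i j \<noteq> 0}"
    by (rule finite_subset[OF _ finite_UnI[OF fin]]) auto
qed

lift_definition uminus_fmat :: "'a fmat \<Rightarrow> 'a fmat" is "\<lambda>A i j. - A i j" by simp

lift_definition minus_fmat :: "'a fmat \<Rightarrow> 'a fmat \<Rightarrow> 'a fmat" is "\<lambda>A B i j. A i j - B i j"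
proof -
  fix A B :: "'a \<Rightarrow> 'a \<Rightarrow> complex"
  assume fin: "finite {(i, j). A i j \<noteq> 0}" "finite {(i, j). B i j \<noteq> 0}"
  show "finite {(i, j). A i j - B i j \<noteq> 0}"
    by (rule finite_subset[OF _ finite_UnI[OF fin]]) auto
qed

text \<open>The sum runs over the nonzero columns of \<open>A\<close>, a finite set whatever the
  index type; any finite superset gives the same value.\<close>

lift_definition times_fmat :: "'a fmat \<Rightarrow> 'a fmat \<Rightarrow> 'a fmat" is
  "\<lambda>A B i k. \<Sum>j | \<exists>i. A i j \<noteq> 0. A i j * B j k"
proof -
  fix A B :: "'a \<Rightarrow> 'a \<Rightarrow> complex"
  assume fin: "finite {(i, j). A i j \<noteq> 0}" "finite {(i, j). B i j \<noteq> 0}"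
  have "{(i, k). (\<Sum>j | \<exists>i. A i j \<noteq> 0. A i j * B j k) \<noteq> 0}
      \<subseteq> fst ` {(i, j). A i j \<noteq> 0} \<times> snd ` {(i, j). B i j \<noteq> 0}"
  proof clarify
    fix i k
    assume "(\<Sum>j | \<exists>i. A i j \<noteq> 0. A i j * B j k) \<noteq> 0"
    then obtain j where "A i j * B j k \<noteq> 0"
      using sum.not_neutral_contains_not_neutral by blast
    then show "i \<in> fst ` {(i, j). A i j \<noteq> 0} \<and> k \<in> snd ` {(i, j). B i j \<noteq> 0}"
      by force
  qed
  then show "finite {(i, k). (\<Sum>j | \<exists>i. A i j \<noteq> 0. A i j * B j k) \<noteq> 0}"
    using fin by (meson finite_SigmaI finite_imageI finite_subset)
qed

lemma entry_times_superset:
  assumes "finite S" "fsupp A \<subseteq> S"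
  shows "entry (A * B) i k = (\<Sum>j\<in>S. entry A i j * entry B j k)"
proof -
  have "entry (A * B) i k = (\<Sum>j | \<exists>i. entry A i j \<noteq> 0. entry A i j * entry B j k)"
    by transfer simp
  also have "\<dots> = (\<Sum>j\<in>S. entry A i j * entry B j k)"
  proof (rule sum.mono_neutral_left)
    show "{j. \<exists>i. entry A i j \<noteq> 0} \<subseteq> S"
      using assms(2) unfolding fsupp_def by blast
  qed (use assms in auto)
  finally show ?thesis .
qed

instance
proof
  fix A B C :: "'a fmat"
  show "A + B + C = A + (B + C)" "A + B = B + A" "0 + A = A" "- A + A = 0" "A - B = A + - B"
    by (transfer; auto simp: fun_eq_iff)+
  define S where "S = fsupp A \<union> fsupp B \<union> fsupp C \<union> fsupp (A * B) \<union> fsupp (A + B)"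
  have S: "finite S" "fsupp A \<subseteq> S" "fsupp B \<subseteq> S" "fsupp (A * B) \<subseteq> S" "fsupp (A + B) \<subseteq> S"
    by (auto simp: S_def)
  note E = entry_times_superset[OF S(1)]
  have plus: "entry (X + Y) i j = entry X i j + entry Y i j" for X Y :: "'a fmat" and i j
    by transfer simp
  show "A * B * C = A * (B * C)"
  proof (rule fmat_eqI)
    fix i l
    have "entry (A * B * C) i l = (\<Sum>k\<in>S. \<Sum>j\<in>S. entry A i j * entry B j k * entry C k l)"
      by (simp add: E S sum_distrib_right)
    also have "\<dots> = (\<Sum>j\<in>S. \<Sum>k\<in>S. entry A i j * entry B j k * entry C k l)"
      by (rule sum.swap)
    also have "\<dots> = entry (A * (B * C)) i l"
      by (simp add: E S sum_distrib_left mult.assoc)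
    finally show "entry (A * B * C) i l = entry (A * (B * C)) i l" .
  qed
  show "(A + B) * C = A * C + B * C"
    by (rule fmat_eqI) (simp add: E S plus sum.distrib distrib_right)
  show "A * (B + C) = A * B + A * C"
    by (rule fmat_eqI) (simp add: E S plus sum.distrib distrib_left)
qed

end

lemma entry_plus [simp]: "entry (A + B) i j = entry A i j + entry B i j"
  by transfer simp

lemma entry_minus [simp]: "entry (A - B) i j = entry A i j - entry B i j"
  by transfer simp

lemma entry_zero [simp]: "entry 0 i j = 0"
  by transfer simp

lemma entry_sum [simp]: "entry (\<Sum>x\<in>X. A x) i j = (\<Sum>x\<in>X. entry (A x) i j)"
  by (induction X rule: infinite_finite_induct) auto

lift_definition scale_fmat :: "complex \<Rightarrow> 'i fmat \<Rightarrow> 'i fmat" is "\<lambda>c A i j. c * A i j"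
  by (erule rev_finite_subset) auto

lemma entry_scale [simp]: "entry (scale_fmat c A) i j = c * entry A i j"
  by transfer simp

lift_definition single_fmat :: "'i \<Rightarrow> 'i \<Rightarrow> complex \<Rightarrow> 'i fmat" is
  "\<lambda>a b c i j. if i = a \<and> j = b then c else 0"
proof -
  fix a b :: 'i and c
  show "finite {(i, j). (if i = a \<and> j = b then c else 0) \<noteq> 0}"
    by (rule finite_subset[of _ "{(a, b)}"]) auto
qed

lemma entry_single [simp]: "entry (single_fmat a b c) i j = (if i = a \<and> j = b then c else 0)"
  by transfer simp

lift_definition transpose_fmat :: "'i fmat \<Rightarrow> 'i fmat" is "\<lambda>A i j. A j i"
proof -
  fix A :: "'i \<Rightarrow> 'i \<Rightarrow> complex"
  assume "finite {(i, j). A i j \<noteq> 0}"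
  moreover have "{(i, j). A j i \<noteq> 0} = prod.swap ` {(i, j). A i j \<noteq> 0}"
    by force
  ultimately show "finite {(i, j). A j i \<noteq> 0}" by simp
qed

lemma entry_transpose [simp]: "entry (transpose_fmat A) i j = entry A j i"
  by transfer simp

text \<open>The tensor product. Pairs of indices form a new index type, so the facts on
  representations have to hold uniformly in the index type.\<close>

lift_definition kron :: "'i fmat \<Rightarrow> 'j fmat \<Rightarrow> ('i \<times> 'j) fmat" is
  "\<lambda>A B x y. A (fst x) (fst y) * B (snd x) (snd y)"
proof -
  fix A :: "'i \<Rightarrow> 'i \<Rightarrow> complex" and B :: "'j \<Rightarrow> 'j \<Rightarrow> complex"
  assume fin: "finite {(i, j). A i j \<noteq> 0}" "finite {(i, j). B i j \<noteq> 0}"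
  have "{(x, y). A (fst x) (fst y) * B (snd x) (snd y) \<noteq> 0}
      \<subseteq> (\<lambda>((i, i'), (j, j')). ((i, j), (i', j'))) ` ({(i, j). A i j \<noteq> 0} \<times> {(i, j). B i j \<noteq> 0})"
    by force
  then show "finite {(x, y). A (fst x) (fst y) * B (snd x) (snd y) \<noteq> 0}"
    using fin by (meson finite_SigmaI finite_imageI finite_subset)
qed

lemma entry_kron [simp]: "entry (kron A B) x y = entry A (fst x) (fst y) * entry B (snd x) (snd y)"
  by transfer simp

definition ftrace :: "'i fmat \<Rightarrow> complex" where
  "ftrace A = (\<Sum>i\<in>fsupp A. entry A i i)"

lemma ftrace_superset:
  assumes "finite S" "fsupp A \<subseteq> S"
  shows "ftrace A = (\<Sum>i\<in>S. entry A i i)"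
  unfolding ftrace_def using assms by (intro sum.mono_neutral_left) (auto simp: entry_eq_0)

lemma fsupp_plus: "fsupp (A + B) \<subseteq> fsupp A \<union> fsupp B"
  and fsupp_minus: "fsupp (A - B) \<subseteq> fsupp A \<union> fsupp B"
  unfolding fsupp_def by auto

lemma fsupp_times: "fsupp (A * B) \<subseteq> fsupp A \<union> fsupp B"
proof -
  have "entry (A * B) i j = 0" if "i \<notin> fsupp A" for i j
    using that by (simp add: entry_times_superset[of "fsupp A"] entry_eq_0)
  moreover have "entry (A * B) i j = 0" if "j \<notin> fsupp B" for i j
    using that by (simp add: entry_times_superset[of "fsupp A"] entry_eq_0)
  ultimately show ?thesis
    unfolding fsupp_def[of "A * B"] by fast
qed

lemma ftrace_plus [simp]: "ftrace (A + B) = ftrace A + ftrace B"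
  using fsupp_plus[of A B]
  by (simp add: ftrace_superset[of "fsupp A \<union> fsupp B"] sum.distrib)

lemma ftrace_minus [simp]: "ftrace (A - B) = ftrace A - ftrace B"
  using fsupp_minus[of A B]
  by (simp add: ftrace_superset[of "fsupp A \<union> fsupp B"] sum_subtractf)

lemma ftrace_zero [simp]: "ftrace 0 = 0"
  by (simp add: ftrace_def)

lemma ftrace_sum [simp]: "ftrace (\<Sum>x\<in>X. A x) = (\<Sum>x\<in>X. ftrace (A x))"
  by (induction X rule: infinite_finite_induct) auto

lemma fsupp_scale: "fsupp (scale_fmat c A) \<subseteq> fsupp A"
  unfolding fsupp_def by auto

lemma ftrace_scale [simp]: "ftrace (scale_fmat c A) = c * ftrace A"
  using fsupp_scale[of c A]
  by (simp add: ftrace_superset[of "fsupp A"] sum_distrib_left)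

lemma ftrace_transpose [simp]: "ftrace (transpose_fmat A) = ftrace A"
proof -
  have "fsupp (transpose_fmat A) = fsupp A"
    unfolding fsupp_def by auto
  then show ?thesis
    by (simp add: ftrace_def)
qed

lemma ftrace_kron [simp]: "ftrace (kron A B) = ftrace A * ftrace B"
proof -
  have "fsupp (kron A B) \<subseteq> fsupp A \<times> fsupp B"
    unfolding fsupp_def by auto
  then show ?thesis
    by (simp add: ftrace_superset[of "fsupp A \<times> fsupp B" "kron A B"] ftrace_def[of A] ftrace_def[of B]
        sum_product sum.cartesian_product case_prod_unfold)
qed

lemma ftrace_commute: "ftrace (A * B) = ftrace (B * A)"
proof -
  define S where "S = fsupp A \<union> fsupp B"
  have S: "finite S" "fsupp A \<subseteq> S" "fsupp B \<subseteq> S" "fsupp (A * B) \<subseteq> S" "fsupp (B * A) \<subseteq> S"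
    using fsupp_times[of A B] fsupp_times[of B A] by (auto simp: S_def)
  have "ftrace (A * B) = (\<Sum>i\<in>S. \<Sum>j\<in>S. entry A i j * entry B j i)"
    by (simp add: ftrace_superset[OF S(1)] entry_times_superset[OF S(1)] S)
  also have "\<dots> = (\<Sum>j\<in>S. \<Sum>i\<in>S. entry A i j * entry B j i)"
    by (rule sum.swap)
  also have "\<dots> = ftrace (B * A)"
    by (simp add: ftrace_superset[OF S(1)] entry_times_superset[OF S(1)] S mult.commute)
  finally show ?thesis .
qed

lemma scale_times [simp]: "scale_fmat c A * B = scale_fmat c (A * B)"
proof (rule fmat_eqI)
  fix i j
  show "entry (scale_fmat c A * B) i j = entry (scale_fmat c (A * B)) i j"
    using fsupp_scale[of c A]
    by (simp add: entry_times_superset[of "fsupp A"] sum_distrib_left mult.assoc)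
qed

lemma times_scale [simp]: "A * scale_fmat c B = scale_fmat c (A * B)"
  by (rule fmat_eqI) (simp add: entry_times_superset[of "fsupp A"] sum_distrib_left mult.left_commute)

lemma scale_scale [simp]: "scale_fmat c (scale_fmat d A) = scale_fmat (c * d) A"
  by (rule fmat_eqI) simp

lemma scale_one [simp]: "scale_fmat 1 A = A"
  by (rule fmat_eqI) simp

lemma sum_const_fmat: "(\<Sum>x\<in>X. A) = scale_fmat (of_nat (card X)) A"
  by (rule fmat_eqI) simp

lemma kron_times: "kron A B * kron C D = kron (A * C) (B * D)"
proof (rule fmat_eqI)
  fix x y
  have "fsupp (kron A B) \<subseteq> fsupp A \<times> fsupp B"
    unfolding fsupp_def by auto
  then show "entry (kron A B * kron C D) x y = entry (kron (A * C) (B * D)) x y"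
    by (simp add: entry_times_superset[of "fsupp A \<times> fsupp B" "kron A B"]
        entry_times_superset[of "fsupp A" A] entry_times_superset[of "fsupp B" B]
        sum_product sum.cartesian_product case_prod_unfold mult.commute mult.left_commute)
qed

lemma transpose_times: "transpose_fmat (A * B) = transpose_fmat B * transpose_fmat A"
proof (rule fmat_eqI)
  fix i j
  define S where "S = fsupp A \<union> fsupp (transpose_fmat B)"
  have S: "finite S" "fsupp A \<subseteq> S" "fsupp (transpose_fmat B) \<subseteq> S"
    by (auto simp: S_def)
  show "entry (transpose_fmat (A * B)) i j = entry (transpose_fmat B * transpose_fmat A) i j"
    by (simp add: entry_times_superset[OF S(1)] S mult.commute)
qed

lemma entry_times3:
  assumes "finite S" "fsupp A \<subseteq> S" "fsupp X \<subseteq> S"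
  shows "entry (A * X * B) i j = (\<Sum>k\<in>S. \<Sum>l\<in>S. entry A i k * entry X k l * entry B l j)"
proof -
  have "fsupp (A * X) \<subseteq> S"
    using fsupp_times[of A X] assms by blast
  then have "entry (A * X * B) i j = (\<Sum>l\<in>S. \<Sum>k\<in>S. entry A i k * entry X k l * entry B l j)"
    by (simp add: entry_times_superset[OF assms(1)] assms sum_distrib_right)
  also have "\<dots> = (\<Sum>k\<in>S. \<Sum>l\<in>S. entry A i k * entry X k l * entry B l j)"
    by (rule sum.swap)
  finally show ?thesis .
qed

lemma entry_single_times: "entry (single_fmat a b c * A) i j = (if i = a then c * entry A b j else 0)"
proof -
  have "fsupp (single_fmat a b c) \<subseteq> {a, b}"
    by (rule subsetI, rule ccontr) (auto simp: fsupp_def)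
  then show ?thesis
    by (cases "a = b") (simp_all add: entry_times_superset[of "{a, b}"])
qed

lemma entry_times_single: "entry (A * single_fmat a b c) i j = (if j = b then entry A i a * c else 0)"
proof -
  define S where "S = insert a (fsupp A)"
  have S: "finite S" "fsupp A \<subseteq> S" "a \<in> S"
    by (auto simp: S_def)
  have "entry (A * single_fmat a b c) i j
      = (\<Sum>k\<in>S. if k = a then (if j = b then entry A i a * c else 0) else 0)"
    unfolding entry_times_superset[OF S(1,2)] by (intro sum.cong) auto
  then show ?thesis
    using S by simp
qed

lemma entry_times_single_times: "entry (A * single_fmat k l c * B) i j = entry A i k * c * entry B l j"
proof -
  define S where "S = insert k (fsupp A)"
  have S: "finite S" "fsupp A \<subseteq> S" "k \<in> S"
    by (auto simp: S_def)
  have "entry (A * (single_fmat k l c * B)) i j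
      = (\<Sum>m\<in>S. if m = k then entry A i k * (c * entry B l j) else 0)"
    unfolding entry_times_superset[OF S(1,2)] by (intro sum.cong) (auto simp: entry_single_times)
  then show ?thesis
    using S by (simp add: mult.assoc)
qed

section \<open>Peeling off rank one matrices\<close>

definition frows :: "'i fmat \<Rightarrow> 'i set" where
  "frows A = {i. \<exists>j. entry A i j \<noteq> 0}"

lemma finite_frows [simp]: "finite (frows A)"
  by (rule finite_subset[OF _ finite_fsupp[of A]]) (auto simp: frows_def fsupp_def)

text \<open>Wedderburn's rank reduction. For a pivot \<open>entry A i j\<close>, the matrix
  \<open>u\<close> with the inverse of the pivot at \<open>(j, i)\<close> makes row \<open>i\<close>
  of \<open>A - A * u * A\<close> vanish and creates no new nonzero rows, so the number of nonzero
  rows serves as an induction measure.\<close>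

lemma peel:
  assumes "A \<noteq> 0"
  obtains u where "u * A * u = u" "frows (A - A * u * A) \<subset> frows A" "ftrace (u * A) = 1"
proof -
  obtain i j where ij: "entry A i j \<noteq> 0"
    using assms fmat_eqI[of A 0] by auto
  define u where "u = single_fmat j i (1 / entry A i j)"
  have uAu: "u * A * u = u"
    by (rule fmat_eqI) (use ij in \<open>simp add: u_def entry_times_single entry_single_times\<close>)
  have E: "entry (A - A * u * A) k l = entry A k l - entry A k j / entry A i j * entry A i l" for k l
    by (simp add: u_def entry_times_single_times)
  have "i \<notin> frows (A - A * u * A)"
    using ij unfolding frows_def mem_Collect_eq E by simp
  moreover have "frows (A - A * u * A) \<subseteq> frows A"
  proof
    fix k assume "k \<in> frows (A - A * u * A)"
    then obtain l where "entry A k l - entry A k j / entry A i j * entry A i l \<noteq> 0"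
      unfolding frows_def mem_Collect_eq E by blast
    then have "entry A k l \<noteq> 0 \<or> entry A k j \<noteq> 0"
      by auto
    then show "k \<in> frows A"
      unfolding frows_def by blast
  qed
  moreover have "i \<in> frows A"
    using ij by (force simp: frows_def)
  ultimately have "frows (A - A * u * A) \<subset> frows A" by blast
  moreover have "ftrace (u * A) = 1"
  proof -
    define S where "S = insert j (fsupp (u * A))"
    have S: "finite S" "fsupp (u * A) \<subseteq> S" "j \<in> S"
      by (auto simp: S_def)
    have "ftrace (u * A) = (\<Sum>k\<in>S. if k = j then 1 else 0)"
      unfolding ftrace_superset[OF S(1,2)] using ij
      by (intro sum.cong) (auto simp: u_def entry_single_times)
    then show ?thesis
      using S by simp
  qed
  ultimately show ?thesis
    using uAu that by blast
qed

lemma ex_generalized_inverse: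
  fixes A :: "'i fmat"
  shows "\<exists>Z. A * Z * A = A"
proof (induction "card (frows A)" arbitrary: A rule: less_induct)
  case less
  show ?case
  proof (cases "A = 0")
    case False
    then obtain u where u: "u * A * u = u" "frows (A - A * u * A) \<subset> frows A"
      using peel by metis
    then obtain Z where Z: "(A - A * u * A) * Z * (A - A * u * A) = A - A * u * A"
      using less psubset_card_mono[OF finite_frows] by metis
    \<comment> \<open>The witness is \<open>u + (1 - uA) Z (1 - Au)\<close>, multiplied out because
      there is no unit. Both \<open>A (1 - uA)\<close> and \<open>(1 - Au) A\<close> are the peeled
      matrix.\<close>
    have "A * (u + Z - u * A * Z - Z * A * u + u * A * Z * A * u) * A
        = A * u * A + (A - A * u * A) * Z * (A - A * u * A)"
      by (simp add: algebra_simps)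
    also have "\<dots> = A"
      by (simp add: Z)
    finally show ?thesis by blast
  qed simp
qed

text \<open>The trace of an idempotent is its rank: peeling keeps idempotency and lowers the trace
  by one. Characteristic zero enters here, since a positive number of peelings yields a nonzero
  trace.\<close>

lemma ftrace_idempotent:
  fixes E :: "'i fmat"
  assumes "E * E = E"
  shows "\<exists>r. ftrace E = of_nat r \<and> (r = 0 \<longrightarrow> E = 0)"
  using assms
proof (induction "card (frows E)" arbitrary: E rule: less_induct)
  case less
  show ?case
  proof (cases "E = 0")
    case False
    then obtain u where u: "u * E * u = u" "frows (E - E * u * E) \<subset> frows E" "ftrace (u * E) = 1"
      using peel by metis
    define F where "F = E - E * u * E"
    have EX: "E * (E * X) = E * X" "u * (E * (u * X)) = u * X" for X
      using less.prems u(1) by (simp_all flip: mult.assoc)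
    have "F * F = F"
      by (simp add: F_def algebra_simps EX less.prems)
    then obtain r where r: "ftrace F = of_nat r"
      using less u(2) psubset_card_mono[OF finite_frows] unfolding F_def by metis
    have "ftrace (E * u * E) = ftrace (u * E * E)"
      by (metis ftrace_commute mult.assoc)
    also have "\<dots> = 1"
      using less.prems u(3) by (simp add: mult.assoc)
    finally have "ftrace E = of_nat (Suc r)"
      using r by (simp add: F_def algebra_simps)
    then show ?thesis by blast
  qed (auto intro: exI[of _ 0])
qed

section \<open>Matrix representations are determined by their traces\<close>

text \<open>\<open>D \<one>\<close> is idempotent: it projects onto the space carrying the
  representation and stands in for the unit matrix. Its trace is the dimension.\<close>

locale matrix_rep = group G for G :: "('g, 'm) monoid_scheme" (structure) +
  fixes D :: "'g \<Rightarrow> 'i fmat"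
  assumes finite_group: "finite (carrier G)"
    and hom: "g \<in> carrier G \<Longrightarrow> h \<in> carrier G \<Longrightarrow> D (g \<otimes> h) = D g * D h"
begin

lemma card_nonzero: "of_nat (card (carrier G)) \<noteq> (0 :: complex)"
  using finite_group one_closed by (auto simp: card_eq_0_iff)

lemma sum_shift: "h \<in> carrier G \<Longrightarrow> (\<Sum>g\<in>carrier G. f (h \<otimes> g)) = (\<Sum>g\<in>carrier G. f g)"
  by (rule sum.reindex_bij_betw) (rule bij_betw_byWitness[of _ "\<lambda>g. inv h \<otimes> g"], auto simp flip: m_assoc)

text \<open>The Reynolds operator. Its trace, an average of traces of group elements, is the
  dimension of the space of invariants because it is idempotent.\<close>

definition invariant_part :: "'i fmat" where
  "invariant_part = scale_fmat (1 / of_nat (card (carrier G))) (\<Sum>g\<in>carrier G. D g)"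

lemma invariant_part_idempotent: "invariant_part * invariant_part = invariant_part"
proof -
  have "D h * (\<Sum>g\<in>carrier G. D g) = (\<Sum>g\<in>carrier G. D g)" if "h \<in> carrier G" for h
    using sum_shift[OF that, of D] that by (simp add: sum_distrib_left flip: hom)
  then have "(\<Sum>h\<in>carrier G. D h) * (\<Sum>g\<in>carrier G. D g)
      = scale_fmat (of_nat (card (carrier G))) (\<Sum>g\<in>carrier G. D g)"
    by (simp add: sum_distrib_right sum_const_fmat)
  then show ?thesis
    using card_nonzero by (simp add: invariant_part_def)
qed

text \<open>The sum below is, up to the factor \<open>card G\<close>, the trace of the projection onto the
  invariants of \<open>D \<otimes> D\<^sup>*\<close>, and the unit \<open>D \<one>\<close> is such an invariant.\<close>

lemma sum_trace_nonzero:
  assumes "D \<one> \<noteq> 0"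
  shows "(\<Sum>g\<in>carrier G. ftrace (D g) * ftrace (D (inv g))) \<noteq> 0"
proof
  assume zero: "(\<Sum>g\<in>carrier G. ftrace (D g) * ftrace (D (inv g))) = 0"
  \<comment> \<open>The tensor product with the dual. Transposition and inversion both reverse
    products, so together they preserve them, and the traces of \<open>K\<close> are the summands
    under consideration.\<close>
  interpret K: matrix_rep G "\<lambda>g. kron (D g) (transpose_fmat (D (inv g)))"
    by unfold_locales
      (simp_all add: finite_group hom kron_times inv_mult_group flip: transpose_times)
  have "ftrace K.invariant_part = 0"
    using zero by (simp add: K.invariant_part_def)
  then have "K.invariant_part = 0"
    using ftrace_idempotent[OF K.invariant_part_idempotent] by auto
  then have "entry K.invariant_part (i, j) (k, l) = 0" for i j k l
    by simp
  then have coeff: "(\<Sum>g\<in>carrier G. entry (D g) i k * entry (D (inv g)) l j) = 0" for i j k l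
    using card_nonzero by (simp add: K.invariant_part_def)
  define S where "S = fsupp (D \<one>) \<union> (\<Union>g\<in>carrier G. fsupp (D g))"
  have S: "finite S" "fsupp (D \<one>) \<subseteq> S" "\<And>g. g \<in> carrier G \<Longrightarrow> fsupp (D g) \<subseteq> S"
    using finite_group by (auto simp: S_def)
  \<comment> \<open>The vanishing coefficients say that summing \<open>D g * X * D (inv g)\<close>
    over the group kills every \<open>X\<close>. The choice \<open>X = D \<one>\<close> contradicts
    this, because each summand is then \<open>D \<one>\<close> itself.\<close>
  have "entry (\<Sum>g\<in>carrier G. D g * D \<one> * D (inv g)) i j = 0" for i j
  proof -
    have "entry (\<Sum>g\<in>carrier G. D g * D \<one> * D (inv g)) i j
        = (\<Sum>g\<in>carrier G. \<Sum>k\<in>S. \<Sum>l\<in>S. entry (D \<one>) k l * (entry (D g) i k * entry (D (inv g)) l j))"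
      unfolding entry_sum by (intro sum.cong refl, subst entry_times3[OF S(1)]) (simp_all add: S mult_ac)
    also have "\<dots> = (\<Sum>k\<in>S. \<Sum>g\<in>carrier G. \<Sum>l\<in>S. entry (D \<one>) k l * (entry (D g) i k * entry (D (inv g)) l j))"
      by (rule sum.swap)
    also have "\<dots> = (\<Sum>k\<in>S. \<Sum>l\<in>S. \<Sum>g\<in>carrier G. entry (D \<one>) k l * (entry (D g) i k * entry (D (inv g)) l j))"
      by (intro sum.cong refl sum.swap)
    also have "\<dots> = 0"
      by (simp add: coeff flip: sum_distrib_left)
    finally show ?thesis .
  qed
  then have "(\<Sum>g\<in>carrier G. D g * D \<one> * D (inv g)) = 0"
    by (intro fmat_eqI) simp
  moreover have "(\<Sum>g\<in>carrier G. D g * D \<one> * D (inv g)) = scale_fmat (of_nat (card (carrier G))) (D \<one>)"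
    by (simp add: sum_const_fmat flip: hom)
  ultimately have "scale_fmat (1 / of_nat (card (carrier G))) (scale_fmat (of_nat (card (carrier G))) (D \<one>)) = scale_fmat (1 / of_nat (card (carrier G))) 0"
    by metis
  moreover have "scale_fmat c 0 = 0" for c and z :: "'i fmat"
    by (rule fmat_eqI) simp
  ultimately have "D \<one> = 0"
    using card_nonzero by simp
  then show False
    using assms by blast
qed

end

locale matrix_rep_pair = D: matrix_rep G D + F: matrix_rep G F
  for G :: "('g, 'm) monoid_scheme" (structure) and D F :: "'g \<Rightarrow> 'i fmat"
begin

text \<open>The second condition makes \<open>T\<close> vanish outside the space of
  \<open>D\<close>; commutation at \<open>\<one>\<close> then yields \<open>F \<one> * T = T\<close>
  as well.\<close>

definition intertwiner :: "'i fmat \<Rightarrow> bool" where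
  "intertwiner T \<longleftrightarrow> (\<forall>g\<in>carrier G. F g * T = T * D g) \<and> T * D \<one> = T"

text \<open>A nonzero intertwiner \<open>Y\<close> exists by pairing the two characters; averaging a generalized
  inverse of \<open>Y\<close> makes it an intertwiner in the other direction.\<close>

lemma ex_intertwiner:
  assumes "D \<one> \<noteq> 0" and trace: "\<And>g. g \<in> carrier G \<Longrightarrow> ftrace (D g) = ftrace (F g)"
  shows "\<exists>Y Z. intertwiner Y \<and> matrix_rep_pair.intertwiner G F D Z \<and>
     Y * Z * Y = Y \<and> Z * Y * Z = Z \<and> Y \<noteq> 0"
proof -
  interpret FD: matrix_rep_pair G F D ..
  have "\<exists>X. (\<Sum>g\<in>carrier G. F g * X * D (inv g)) \<noteq> 0"
  proof (rule ccontr)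
    assume neg: "\<nexists>X. (\<Sum>g\<in>carrier G. F g * X * D (inv g)) \<noteq> 0"
    \<comment> \<open>Testing on the matrix unit at \<open>(i, j)\<close> isolates a product of
      diagonal entries. Summed over \<open>i\<close> and \<open>j\<close>, these products give the
      pairing of characters, which is nonzero by \<open>sum_trace_nonzero\<close>.\<close>
    have coeff: "(\<Sum>g\<in>carrier G. entry (F g) i i * entry (D (inv g)) j j) = 0" for i j
    proof -
      have "entry (\<Sum>g\<in>carrier G. F g * single_fmat i j 1 * D (inv g)) i j = 0"
        using neg by simp
      then show ?thesis
        by (simp add: entry_times_single_times)
    qed
    define S where "S = (\<Union>g\<in>carrier G. fsupp (D g) \<union> fsupp (F g))"
    have S: "finite S" "\<And>g. g \<in> carrier G \<Longrightarrow> fsupp (D g) \<subseteq> S" "\<And>g. g \<in> carrier G \<Longrightarrow> fsupp (F g) \<subseteq> S"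
      using D.finite_group by (auto simp: S_def)
    have "(\<Sum>g\<in>carrier G. ftrace (D g) * ftrace (D (inv g)))
        = (\<Sum>g\<in>carrier G. \<Sum>i\<in>S. \<Sum>j\<in>S. entry (F g) i i * entry (D (inv g)) j j)"
    proof (rule sum.cong)
      fix g assume g: "g \<in> carrier G"
      then have "ftrace (D g) = (\<Sum>i\<in>S. entry (F g) i i)" "ftrace (D (inv g)) = (\<Sum>j\<in>S. entry (D (inv g)) j j)"
        using S trace ftrace_superset[OF S(1)] by simp_all
      then show "ftrace (D g) * ftrace (D (inv g)) = (\<Sum>i\<in>S. \<Sum>j\<in>S. entry (F g) i i * entry (D (inv g)) j j)"
        by (simp add: sum_product)
    qed simp
    also have "\<dots> = (\<Sum>i\<in>S. \<Sum>g\<in>carrier G. \<Sum>j\<in>S. entry (F g) i i * entry (D (inv g)) j j)"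
      by (rule sum.swap)
    also have "\<dots> = (\<Sum>i\<in>S. \<Sum>j\<in>S. \<Sum>g\<in>carrier G. entry (F g) i i * entry (D (inv g)) j j)"
      by (intro sum.cong refl sum.swap)
    also have "\<dots> = 0"
      by (simp add: coeff)
    finally show False
      using D.sum_trace_nonzero[OF assms(1)] by blast
  qed
  then obtain X where X: "(\<Sum>g\<in>carrier G. F g * X * D (inv g)) \<noteq> 0"
    by blast
  define Y where "Y = (\<Sum>g\<in>carrier G. F g * X * D (inv g))"
  have avg: "F' h * (\<Sum>g\<in>carrier G. F' g * W * D' (inv g)) = (\<Sum>g\<in>carrier G. F' g * W * D' (inv g)) * D' h"
    if "matrix_rep G F'" "matrix_rep G D'" "h \<in> carrier G" for F' D' :: "'g \<Rightarrow> 'i fmat" and W h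
  proof -
    interpret F': matrix_rep G F' by fact
    interpret D': matrix_rep G D' by fact
    have "F' h * (\<Sum>g\<in>carrier G. F' g * W * D' (inv g))
        = (\<Sum>g\<in>carrier G. F' (h \<otimes> g) * W * D' (inv (h \<otimes> g) \<otimes> h))"
      using that(3) unfolding sum_distrib_left
      by (intro sum.cong) (auto simp: F'.hom D.inv_mult_group D.m_assoc mult.assoc)
    also have "\<dots> = (\<Sum>g\<in>carrier G. F' g * W * D' (inv g \<otimes> h))"
      using that(3) by (rule D.sum_shift)
    also have "\<dots> = (\<Sum>g\<in>carrier G. F' g * W * D' (inv g)) * D' h"
      using that(3) unfolding sum_distrib_right
      by (intro sum.cong) (auto simp: D'.hom mult.assoc)
    finally show ?thesis .
  qed
  have "Y * D \<one> = Y"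
    by (simp add: Y_def sum_distrib_right mult.assoc flip: D.hom)
  then have Y: "intertwiner Y"
    using avg[OF F.matrix_rep_axioms D.matrix_rep_axioms, of _ X]
    by (auto simp: intertwiner_def Y_def)
  then have YD: "Y * D g = F g * Y" if "g \<in> carrier G" for g
    using that by (simp add: intertwiner_def)
  obtain Z0 where Z0: "Y * Z0 * Y = Y"
    using ex_generalized_inverse by blast
  \<comment> \<open>Averaging produces an intertwiner in the opposite direction, and since
    \<open>Y\<close> commutes with the action, every single summand is still a generalized inverse
    of \<open>Y\<close>.\<close>
  define Z1 where "Z1 = scale_fmat (1 / of_nat (card (carrier G))) (\<Sum>g\<in>carrier G. D g * Z0 * F (inv g))"
  have DZ1: "D g * Z1 = Z1 * F g" if "g \<in> carrier G" for g
    using avg[OF D.matrix_rep_axioms F.matrix_rep_axioms that] by (simp add: Z1_def)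
  have Z1F: "Z1 * F \<one> = Z1"
    by (simp add: Z1_def sum_distrib_right mult.assoc flip: F.hom)
  have YZ1Y: "Y * Z1 * Y = Y"
  proof -
    have "Y * (D g * Z0 * F (inv g)) * Y = Y" if "g \<in> carrier G" for g
    proof -
      have "Y * (D g * Z0 * F (inv g)) * Y = (Y * D g) * Z0 * (F (inv g) * Y)"
        by (simp add: mult.assoc)
      also have "\<dots> = F g * (Y * Z0 * Y) * D (inv g)"
        using YD[OF that] YD[of "inv g"] that by (simp only: D.inv_closed) (simp add: mult.assoc)
      also have "\<dots> = Y * (D g * D (inv g))"
        using YD[OF that] by (simp add: Z0 flip: mult.assoc)
      also have "\<dots> = Y"
        using that Y by (simp add: intertwiner_def flip: D.hom)
      finally show ?thesis .
    qed
    then have "Y * (\<Sum>g\<in>carrier G. D g * Z0 * F (inv g)) * Y = scale_fmat (of_nat (card (carrier G))) Y"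
      by (simp add: sum_distrib_left sum_distrib_right sum_const_fmat)
    then show ?thesis
      using D.card_nonzero by (simp add: Z1_def)
  qed
  \<comment> \<open>The usual passage to a reflexive generalized inverse: it adds the law
    \<open>Z * Y * Z = Z\<close>.\<close>
  define Z where "Z = Z1 * Y * Z1"
  have "Y * Z * Y = Y" "Z * Y * Z = Z"
  proof -
    have "Y * Z * Y = Y * Z1 * Y * Z1 * Y" "Z * Y * Z = Z1 * (Y * Z1 * Y * Z1 * Y) * Z1"
      by (simp_all add: Z_def mult.assoc)
    then show "Y * Z * Y = Y" "Z * Y * Z = Z"
      by (simp_all add: YZ1Y Z_def)
  qed
  moreover have "FD.intertwiner Z"
    unfolding FD.intertwiner_def
  proof
    show "Z * F \<one> = Z"
      by (simp add: Z_def Z1F mult.assoc)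
    show "\<forall>g\<in>carrier G. D g * Z = Z * F g"
      using DZ1 YD by (metis Z_def mult.assoc)
  qed
  ultimately show ?thesis
    using X Y by (auto simp: Y_def)
qed

theorem equivalent_if_same_traces:
  assumes trace: "\<And>g. g \<in> carrier G \<Longrightarrow> ftrace (D g) = ftrace (F g)"
  shows "\<exists>T S. intertwiner T \<and> S * T = D \<one> \<and> T * S = F \<one> \<and> S * F \<one> = S"
proof -
  interpret FD: matrix_rep_pair G F D ..
  \<comment> \<open>For such a pair \<open>S * T\<close> is idempotent and its trace is the rank of
    \<open>T\<close>. Ranks are thus natural numbers bounded by the dimension \<open>d\<close>, so a
    maximal one exists.\<close>
  define P where "P T S \<longleftrightarrow> intertwiner T \<and> FD.intertwiner S \<and> T * S * T = T \<and> S * T * S = S" for T S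
  define R where "R r \<longleftrightarrow> (\<exists>T S. P T S \<and> ftrace (S * T) = of_nat r)" for r :: nat
  obtain d where d: "ftrace (D \<one>) = of_nat d"
    using ftrace_idempotent[of "D \<one>"] by (auto simp flip: D.hom)
  have DD: "D \<one> * D \<one> = D \<one>" and FF: "F \<one> * F \<one> = F \<one>"
    by (simp_all flip: D.hom F.hom)
  have unit: "D \<one> * S = S" "S * F \<one> = S" "F \<one> * T = T" "T * D \<one> = T" if "P T S" for T S
    using that unfolding P_def intertwiner_def FD.intertwiner_def by (metis D.one_closed)+
  have comm: "F g * T = T * D g" "D g * S = S * F g" if "P T S" "g \<in> carrier G" for T S g
    using that unfolding P_def intertwiner_def FD.intertwiner_def by auto
  have idem: "(D \<one> - S * T) * (D \<one> - S * T) = D \<one> - S * T" "(F \<one> - T * S) * (F \<one> - T * S) = F \<one> - T * S"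
    if "P T S" for T S
  proof -
    have "S * T * (S * T) = S * T" "D \<one> * (S * T) = S * T" "S * T * D \<one> = S * T"
      "T * S * (T * S) = T * S" "F \<one> * (T * S) = T * S" "T * S * F \<one> = T * S"
      using that unit[OF that] by (simp_all add: P_def mult.assoc) (simp_all flip: mult.assoc)
    then show "(D \<one> - S * T) * (D \<one> - S * T) = D \<one> - S * T" "(F \<one> - T * S) * (F \<one> - T * S) = F \<one> - T * S"
      by (simp_all only: left_diff_distrib right_diff_distrib DD FF) simp_all
  qed
  have "P 0 0"
    by (simp add: P_def intertwiner_def FD.intertwiner_def)
  then have "R 0"
    unfolding R_def by (intro exI[of _ 0]) simp
  moreover have "r \<le> d" if "R r" for r
  proof -
    obtain T S where TS: "P T S" "ftrace (S * T) = of_nat r"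
      using \<open>R r\<close> unfolding R_def by blast
    obtain q where "ftrace (D \<one> - S * T) = of_nat q"
      using ftrace_idempotent[OF idem(1)[OF TS(1)]] by blast
    then have "of_nat d = (of_nat (q + r) :: complex)"
      using d TS(2) by (simp add: algebra_simps)
    then show ?thesis
      by (metis le_add2 of_nat_eq_iff)
  qed
  ultimately obtain r where r: "R r" and r_max: "\<And>r'. R r' \<Longrightarrow> r' \<le> r"
    using ex_has_greatest_nat[of R 0 "\<lambda>x. x" "Suc d"] le_imp_less_Suc by metis
  obtain T S where TS: "P T S" "ftrace (S * T) = of_nat r"
    using r unfolding R_def by blast
  \<comment> \<open>\<open>e\<close> projects onto the kernel of \<open>T\<close> inside the space
    of \<open>D\<close>, and \<open>f\<close> onto a complement of the image of \<open>T\<close>.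
    Both commute with the action, so \<open>D g * e\<close> and \<open>F g * f\<close> are
    representations again.\<close>
  define e where "e = D \<one> - S * T"
  define f where "f = F \<one> - T * S"
  note u = unit[OF TS(1)] and c = comm[OF TS(1)]
  have TST: "T * S * T = T" "S * T * S = S"
    using TS(1) by (simp_all add: P_def)
  have ee: "e * e = e" and ff: "f * f = f"
    using idem[OF TS(1)] by (simp_all add: e_def f_def)
  have De: "D g * e = e * D g" if "g \<in> carrier G" for g
  proof -
    have "D g * (S * T) = S * T * D g"
      using c that by (metis mult.assoc)
    moreover have "D g * D \<one> = D \<one> * D g"
      using that by (simp flip: D.hom)
    ultimately show ?thesis
      by (simp add: e_def algebra_simps)
  qed
  have Ff: "F g * f = f * F g" if "g \<in> carrier G" for g
  proof -
    have "F g * (T * S) = T * S * F g"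
      using c that by (metis mult.assoc)
    moreover have "F g * F \<one> = F \<one> * F g"
      using that by (simp flip: F.hom)
    ultimately show ?thesis
      by (simp add: f_def algebra_simps)
  qed
  \<comment> \<open>The part of \<open>D\<close> seen by \<open>S * T\<close> and the part of
    \<open>F\<close> seen by \<open>T * S\<close> have the same character, by cyclicity of the
    trace; hence so do the remaining parts.\<close>
  have tr: "ftrace (D g * e) = ftrace (F g * f)" if "g \<in> carrier G" for g
  proof -
    have "ftrace (D g * (S * T)) = ftrace (T * (D g * S))"
      by (metis ftrace_commute mult.assoc)
    also have "\<dots> = ftrace (F g * (T * S))"
      using c that by (metis mult.assoc)
    moreover have "D g * D \<one> = D g" "F g * F \<one> = F g"
      using that by (simp_all flip: D.hom F.hom)
    ultimately show ?thesis
      using trace[OF that] by (simp add: e_def f_def algebra_simps)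
  qed
  have De1: "D \<one> * e = e" and Ff1: "F \<one> * f = f"
    by (simp_all add: e_def f_def right_diff_distrib DD FF u flip: mult.assoc)
  have "e = 0"
  proof (rule ccontr)
    assume "e \<noteq> 0"
    interpret DF': matrix_rep_pair G "\<lambda>g. D g * e" "\<lambda>g. F g * f"
    proof unfold_locales
      fix g h assume gh: "g \<in> carrier G" "h \<in> carrier G"
      show "D (g \<otimes> h) * e = D g * e * (D h * e)"
        using gh De ee by (simp add: D.hom) (metis mult.assoc)
      show "F (g \<otimes> h) * f = F g * f * (F h * f)"
        using gh Ff ff by (simp add: F.hom) (metis mult.assoc)
    qed (rule D.finite_group)+
    interpret FD': matrix_rep_pair G "\<lambda>g. F g * f" "\<lambda>g. D g * e" ..
    obtain Y Z where YZ: "DF'.intertwiner Y" "FD'.intertwiner Z" "Y * Z * Y = Y" "Z * Y * Z = Z" "Y \<noteq> 0"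
      using DF'.ex_intertwiner[OF _ tr] De1 \<open>e \<noteq> 0\<close> by auto
    have Ye: "Y * e = Y" and Zf: "Z * f = Z"
      using YZ(1,2) De1 Ff1 by (simp_all add: DF'.intertwiner_def FD'.intertwiner_def)
    have fY: "f * Y = Y" and eZ: "e * Z = Z"
      using YZ(1,2) Ye Zf De1 Ff1 D.one_closed
      unfolding DF'.intertwiner_def FD'.intertwiner_def by metis+
    have FY: "F g * Y = Y * D g" if "g \<in> carrier G" for g
    proof -
      have "F g * f * Y = Y * (D g * e)"
        using YZ(1) that unfolding DF'.intertwiner_def by blast
      then show ?thesis
        using De[OF that] fY Ye by (metis mult.assoc)
    qed
    have DZ: "D g * Z = Z * F g" if "g \<in> carrier G" for g
    proof -
      have "D g * e * Z = Z * (F g * f)"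
        using YZ(2) that unfolding FD'.intertwiner_def by blast
      then show ?thesis
        using Ff[OF that] eZ Zf by (metis mult.assoc)
    qed
    have Te: "T * e = 0" and eS: "e * S = 0" and fT: "f * T = 0" and Sf: "S * f = 0"
      using TST u by (simp_all add: e_def f_def left_diff_distrib right_diff_distrib flip: mult.assoc)
    have zero: "T * Z = 0" "Y * S = 0" "S * Y = 0" "Z * T = 0"
      using Te eS fT Sf Ye Zf fY eZ by (metis mult.assoc mult_zero_left mult_zero_right)+
    \<comment> \<open>The mixed products vanish because \<open>Y\<close> and \<open>Z\<close> live
      between the complements cut out by \<open>e\<close> and \<open>f\<close>. The ranks therefore
      add up, which contradicts maximality.\<close>
    have ST': "(S + Z) * (T + Y) = S * T + Z * Y"
      by (simp add: distrib_left distrib_right zero)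
    have "(T + Y) * (S + Z) * (T + Y) = T + Y"
      by (simp add: mult.assoc ST') (simp add: distrib_left distrib_right zero TST YZ(3) flip: mult.assoc)
    moreover have "(S + Z) * (T + Y) * (S + Z) = S + Z"
      by (simp add: ST' distrib_left distrib_right TST YZ(4)) (simp add: zero mult.assoc)
    moreover have "intertwiner (T + Y)"
      using c u FY FY[OF D.one_closed] Ye De1 ee
      unfolding intertwiner_def
      by (simp add: distrib_left distrib_right) (metis De D.one_closed mult.assoc)
    moreover have "FD.intertwiner (S + Z)"
      using c u DZ Zf Ff1
      unfolding FD.intertwiner_def
      by (simp add: distrib_left distrib_right) (metis Ff D.one_closed mult.assoc)
    ultimately have "P (T + Y) (S + Z)"
      by (simp add: P_def)
    moreover have "Z * Y * (Z * Y) = Z * Y" "Z * Y \<noteq> 0"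
      using YZ(3-5) by (metis mult.assoc mult_zero_right)+
    then obtain q where q: "ftrace (Z * Y) = of_nat q" "q \<noteq> 0"
      using ftrace_idempotent by blast
    then have "ftrace ((S + Z) * (T + Y)) = of_nat (r + q)"
      by (simp add: ST' TS(2))
    ultimately have "R (r + q)"
      unfolding R_def by blast
    then show False
      using r_max q(2) by fastforce
  qed
  \<comment> \<open>At \<open>\<one>\<close> the equality of the remaining traces leaves the
    idempotent \<open>f\<close> with trace zero.\<close>
  then have "ftrace (F \<one> * f) = 0"
    using tr[OF D.one_closed] by simp
  then have "f = 0"
    using ftrace_idempotent[OF ff] Ff1 by auto
  show ?thesis
    using \<open>e = 0\<close> \<open>f = 0\<close> TS(1) u by (auto simp: e_def f_def P_def)
qed

end

section \<open>Coordinates of vector spaces\<close>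

text \<open>Coordinates are total functions vanishing off \<open>I\<close>, so a subset of
  \<open>I\<close> literally gives a subspace. Finite support admits infinite bases, such as those
  of the polynomial ring.\<close>

definition coord_space :: "'i set \<Rightarrow> ('i \<Rightarrow> complex) set" where
  "coord_space I = {c. finite {i. c i \<noteq> 0} \<and> {i. c i \<noteq> 0} \<subseteq> I}"

definition unit_coord :: "'i \<Rightarrow> 'i \<Rightarrow> complex" where
  "unit_coord i = (\<lambda>j. if j = i then 1 else 0)"

lemma coord_space_zero [simp]: "(\<lambda>_. 0) \<in> coord_space I"
  by (simp add: coord_space_def)

lemma coord_space_add [simp]:
  assumes "c \<in> coord_space I" "d \<in> coord_space I"
  shows "(\<lambda>i. c i + d i) \<in> coord_space I"
proof -
  have sub: "{i. c i + d i \<noteq> 0} \<subseteq> {i. c i \<noteq> 0} \<union> {i. d i \<noteq> 0}" by auto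
  have "finite {i. c i \<noteq> 0}" "finite {i. d i \<noteq> 0}"
    using assms by (simp_all add: coord_space_def)
  then have "finite {i. c i + d i \<noteq> 0}"
    using sub by (meson finite_UnI finite_subset)
  moreover have "{i. c i + d i \<noteq> 0} \<subseteq> I"
    using sub assms unfolding coord_space_def by blast
  ultimately show ?thesis
    by (simp add: coord_space_def)
qed

lemma coord_space_scale [simp]: "c \<in> coord_space I \<Longrightarrow> (\<lambda>i. a * c i) \<in> coord_space I"
  unfolding coord_space_def by (auto intro: rev_finite_subset)

lemma coord_space_diff [simp]:
  "c \<in> coord_space I \<Longrightarrow> d \<in> coord_space I \<Longrightarrow> (\<lambda>i. c i - d i) \<in> coord_space I"
  using coord_space_add[of c I "\<lambda>i. (-1) * d i"] coord_space_scale[of d I "-1"] by simp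

lemma coord_space_mono: "c \<in> coord_space I \<Longrightarrow> I \<subseteq> J \<Longrightarrow> c \<in> coord_space J"
  unfolding coord_space_def by blast

lemma coord_space_eq_0: "c \<in> coord_space I \<Longrightarrow> i \<notin> I \<Longrightarrow> c i = 0"
  unfolding coord_space_def by blast

lemma unit_coord_in [simp]: "i \<in> I \<Longrightarrow> unit_coord i \<in> coord_space I"
  unfolding coord_space_def unit_coord_def by (auto intro: finite_subset[of _ "{i}"])

lemma coord_space_finite: "finite I \<Longrightarrow> coord_space I = {c. \<forall>i. i \<notin> I \<longrightarrow> c i = 0}"
  unfolding coord_space_def by (auto intro: finite_subset)

lemma coord_space_restrict: "c \<in> coord_space I \<Longrightarrow> (\<lambda>i. if P i then c i else 0) \<in> coord_space {i \<in> I. P i}"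
  unfolding coord_space_def by (auto intro: rev_finite_subset)

lemma linear_functional_expand:
  fixes h :: "('i \<Rightarrow> complex) \<Rightarrow> complex"
  assumes add: "\<And>c d. c \<in> coord_space I \<Longrightarrow> d \<in> coord_space I \<Longrightarrow> h (\<lambda>i. c i + d i) = h c + h d"
    and scale: "\<And>a c. c \<in> coord_space I \<Longrightarrow> h (\<lambda>i. a * c i) = a * h c"
    and S: "finite S" "S \<subseteq> I" and c: "\<And>i. i \<notin> S \<Longrightarrow> c i = 0"
  shows "h c = (\<Sum>i\<in>S. c i * h (unit_coord i))"
  using S c
proof (induction S arbitrary: c rule: finite_induct)
  case empty
  then have "c = (\<lambda>i. 0 * 0)" by auto
  then show ?case
    using scale[OF coord_space_zero, of 0] by simp
next
  case (insert s S)
  define d where "d = c(s := 0)"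
  have "h d = (\<Sum>i\<in>S. d i * h (unit_coord i))"
    using insert.prems by (intro insert.IH) (auto simp: d_def)
  also have "\<dots> = (\<Sum>i\<in>S. c i * h (unit_coord i))"
    using insert.hyps by (intro sum.cong) (auto simp: d_def)
  finally have hd: "h d = (\<Sum>i\<in>S. c i * h (unit_coord i))" .
  have d: "d \<in> coord_space I" and s: "s \<in> I"
    using insert by (auto simp: coord_space_def d_def intro: finite_subset[of _ S])
  have "c = (\<lambda>i. c s * unit_coord s i + d i)"
    by (auto simp: d_def unit_coord_def)
  then have "h c = h (\<lambda>i. c s * unit_coord s i + d i)"
    by (rule arg_cong)
  also have "\<dots> = c s * h (unit_coord s) + h d"
    using d s by (simp add: add scale)
  finally show ?case
    using insert.hyps hd by simp
qed

text \<open>A basis in the form of its coordinate map, over a bare record. The vector space axioms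
  follow by transport along the bijection, which saves checking them for the records of subspaces,
  quotients and sums.\<close>

locale lin_coord =
  fixes V :: "(complex, 'v) module" (structure) and I :: "'i set" and \<Phi> :: "('i \<Rightarrow> complex) \<Rightarrow> 'v"
  assumes bij: "bij_betw \<Phi> (coord_space I) (carrier V)"
    and \<Phi>_add: "c \<in> coord_space I \<Longrightarrow> d \<in> coord_space I \<Longrightarrow> \<Phi> (\<lambda>i. c i + d i) = \<Phi> c \<oplus> \<Phi> d"
    and \<Phi>_scale: "c \<in> coord_space I \<Longrightarrow> \<Phi> (\<lambda>i. a * c i) = a \<odot> \<Phi> c"
    and \<Phi>_zero: "\<Phi> (\<lambda>_. 0) = \<zero>"
begin

definition coord :: "'v \<Rightarrow> 'i \<Rightarrow> complex" where
  "coord = the_inv_into (coord_space I) \<Phi>"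

lemma \<Phi>_closed [simp]: "c \<in> coord_space I \<Longrightarrow> \<Phi> c \<in> carrier V"
  using bij by (auto simp: bij_betw_def)

lemma coord_closed [simp]: "x \<in> carrier V \<Longrightarrow> coord x \<in> coord_space I"
  unfolding coord_def by (metis bij bij_betw_def order_refl the_inv_into_into)

lemma \<Phi>_coord [simp]: "x \<in> carrier V \<Longrightarrow> \<Phi> (coord x) = x"
  unfolding coord_def by (metis bij f_the_inv_into_f_bij_betw)

lemma coord_\<Phi> [simp]: "c \<in> coord_space I \<Longrightarrow> coord (\<Phi> c) = c"
  unfolding coord_def by (metis bij bij_betw_def the_inv_into_f_f)

lemma \<Phi>_inj: "c \<in> coord_space I \<Longrightarrow> d \<in> coord_space I \<Longrightarrow> \<Phi> c = \<Phi> d \<longleftrightarrow> c = d"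
  by (metis coord_\<Phi>)

lemma ex_coord: "x \<in> carrier V \<Longrightarrow> \<exists>c\<in>coord_space I. x = \<Phi> c"
  by (metis \<Phi>_coord coord_closed)

lemma add_closed [simp]: "x \<in> carrier V \<Longrightarrow> y \<in> carrier V \<Longrightarrow> x \<oplus> y \<in> carrier V"
  using \<Phi>_closed[OF coord_space_add[OF coord_closed coord_closed], of x y]
  by (simp add: \<Phi>_add)

lemma smult_closed [simp]: "x \<in> carrier V \<Longrightarrow> a \<odot> x \<in> carrier V"
  using \<Phi>_closed[OF coord_space_scale[OF coord_closed], of x a]
  by (simp add: \<Phi>_scale)

lemma coord_add: "x \<in> carrier V \<Longrightarrow> y \<in> carrier V \<Longrightarrow> coord (x \<oplus> y) = (\<lambda>i. coord x i + coord y i)"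
  using coord_\<Phi>[OF coord_space_add[OF coord_closed coord_closed], of x y]
  by (simp add: \<Phi>_add)

lemma coord_smult: "x \<in> carrier V \<Longrightarrow> coord (a \<odot> x) = (\<lambda>i. a * coord x i)"
  using coord_\<Phi>[OF coord_space_scale[OF coord_closed], of x a]
  by (simp add: \<Phi>_scale)

lemma coord_inj: "x \<in> carrier V \<Longrightarrow> y \<in> carrier V \<Longrightarrow> coord x = coord y \<Longrightarrow> x = y"
  by (metis \<Phi>_coord)

lemma zero_closed [simp]: "\<zero> \<in> carrier V"
  using \<Phi>_closed[OF coord_space_zero] by (simp add: \<Phi>_zero)

lemma coord_zero: "coord \<zero> = (\<lambda>_. 0)"
  using coord_\<Phi>[OF coord_space_zero] by (simp add: \<Phi>_zero)

lemma abelian: "abelian_group V"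
proof (rule abelian_groupI)
  fix x assume x: "x \<in> carrier V"
  have "((-1) \<odot> x) \<oplus> x = \<zero>"
    using x by (intro coord_inj) (auto simp: coord_add coord_smult coord_zero)
  then show "\<exists>y\<in>carrier V. y \<oplus> x = \<zero>"
    using x smult_closed by blast
qed (auto intro!: coord_inj simp: coord_add coord_zero add_ac)

lemma vectorspace: "vectorspace complex_field V"
proof -
  interpret abelian_group V by (rule abelian)
  have "module complex_field V"
    by (rule Module.module.intro, rule class_cring.cring_axioms, rule abelian, unfold_locales)
      (auto intro!: coord_inj simp: coord_add coord_smult algebra_simps class_ring_simps)
  then show ?thesis
    by (intro vectorspace.intro class_field.field_axioms)
qed

definition diag_coeff :: "('v \<Rightarrow> 'v) \<Rightarrow> 'i \<Rightarrow> complex" where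
  "diag_coeff T i = coord (T (\<Phi> (unit_coord i))) i"

lemma coord_linear_expand:
  fixes U :: "(complex, 'u) module"
  assumes U: "lin_coord U J \<Psi>" and T: "T \<in> module_hom complex_field U V"
    and S: "finite S" "S \<subseteq> J" "\<And>j. j \<notin> S \<Longrightarrow> c j = 0"
  shows "coord (T (\<Psi> c)) k = (\<Sum>j\<in>S. c j * coord (T (\<Psi> (unit_coord j))) k)"
proof (rule linear_functional_expand[where I = J])
  interpret U: lin_coord U J \<Psi> by (rule U)
  fix c d a assume "c \<in> coord_space J"
  then show "coord (T (\<Psi> (\<lambda>i. a * c i))) k = a * coord (T (\<Psi> c)) k"
    using T by (simp add: U.\<Phi>_scale module_hom_smult module_hom_closed[THEN funcset_mem] coord_smult)
  assume "d \<in> coord_space J"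
  with \<open>c \<in> coord_space J\<close> show "coord (T (\<Psi> (\<lambda>i. c i + d i))) k = coord (T (\<Psi> c)) k + coord (T (\<Psi> d)) k"
    using T by (simp add: U.\<Phi>_add LinearCombinations.module_hom_add[OF T] module_hom_closed[THEN funcset_mem] coord_add)
qed (use S in auto)

text \<open>With \<open>X\<close> and \<open>Y\<close> the two changes of basis and \<open>B\<close>
  the matrix of \<open>T\<close> for \<open>\<Psi>\<close>, the matrix for \<open>\<Phi>\<close> is
  \<open>Y B X\<close>. Rotating the product under the trace leaves \<open>B\<close>, because
  \<open>X Y\<close> is the identity.\<close>

lemma sum_diag_coeff_independent:
  assumes "lin_coord V J \<Psi>" "finite I" "finite J"
    and T: "T \<in> module_hom complex_field V V"
  shows "(\<Sum>i\<in>I. diag_coeff T i) = (\<Sum>j\<in>J. lin_coord.diag_coeff J \<Psi> T j)"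
proof -
  interpret W: lin_coord V J \<Psi> by fact
  have id: "(\<lambda>x. x) \<in> module_hom complex_field V V"
    by (simp add: LinearCombinations.module_hom_def)
  have supI: "\<And>x k. x \<in> carrier V \<Longrightarrow> k \<notin> I \<Longrightarrow> coord x k = 0"
    and supJ: "\<And>x k. x \<in> carrier V \<Longrightarrow> k \<notin> J \<Longrightarrow> W.coord x k = 0"
    by (auto intro: coord_space_eq_0 coord_closed W.coord_closed)
  define X where "X j i = W.coord (\<Phi> (unit_coord i)) j" for j i
  define Y where "Y i j = coord (\<Psi> (unit_coord j)) i" for i j
  define B where "B l j = W.coord (T (\<Psi> (unit_coord j))) l" for l j
  note Tc = module_hom_closed[OF T, THEN funcset_mem]
  have "coord (T (\<Phi> (unit_coord i))) i = (\<Sum>j\<in>J. \<Sum>l\<in>J. X j i * (B l j * Y i l))" if "i \<in> I" for i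
  proof -
    have "coord (T (\<Phi> (unit_coord i))) i = coord (T (\<Psi> (\<lambda>j. X j i))) i"
      using that by (simp add: X_def)
    also have "\<dots> = (\<Sum>j\<in>J. X j i * coord (T (\<Psi> (unit_coord j))) i)"
      using that assms(3) by (intro coord_linear_expand[OF W.lin_coord_axioms T]) (auto simp: X_def supJ)
    also have "\<dots> = (\<Sum>j\<in>J. X j i * coord (\<Psi> (\<lambda>l. B l j)) i)"
      by (intro sum.cong refl) (simp add: B_def Tc)
    also have "\<dots> = (\<Sum>j\<in>J. X j i * (\<Sum>l\<in>J. B l j * Y i l))"
      unfolding Y_def using assms(3) Tc
      by (intro sum.cong arg_cong2[of _ _ _ _ "(*)"] refl coord_linear_expand[OF W.lin_coord_axioms id, simplified])
        (auto simp: B_def supJ)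
    finally show ?thesis
      by (simp add: sum_distrib_left)
  qed
  then have "(\<Sum>i\<in>I. diag_coeff T i) = (\<Sum>i\<in>I. \<Sum>j\<in>J. \<Sum>l\<in>J. X j i * (B l j * Y i l))"
    by (simp add: diag_coeff_def)
  also have "\<dots> = (\<Sum>j\<in>J. \<Sum>i\<in>I. \<Sum>l\<in>J. X j i * (B l j * Y i l))"
    by (rule sum.swap)
  also have "\<dots> = (\<Sum>j\<in>J. \<Sum>l\<in>J. \<Sum>i\<in>I. X j i * (B l j * Y i l))"
    by (intro sum.cong refl sum.swap)
  also have "\<dots> = (\<Sum>j\<in>J. \<Sum>l\<in>J. B l j * (\<Sum>i\<in>I. Y i l * X j i))"
    by (simp add: sum_distrib_left mult_ac)
  also have "\<dots> = (\<Sum>j\<in>J. \<Sum>l\<in>J. if l = j then B l j else 0)"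
  proof (intro sum.cong refl)
    fix j l assume jl: "j \<in> J" "l \<in> J"
    have "W.coord (\<Phi> (\<lambda>i. Y i l)) j = (\<Sum>i\<in>I. Y i l * X j i)"
      unfolding X_def using assms(2) jl
      by (intro W.coord_linear_expand[OF lin_coord_axioms id, simplified]) (auto simp: Y_def supI)
    moreover have "W.coord (\<Phi> (\<lambda>i. Y i l)) j = (if l = j then 1 else 0)"
      using jl by (simp add: Y_def) (simp add: unit_coord_def)
    ultimately show "B l j * (\<Sum>i\<in>I. Y i l * X j i) = (if l = j then B l j else 0)"
      by (cases "l = j") auto
  qed
  also have "\<dots> = (\<Sum>j\<in>J. W.diag_coeff T j)"
    using assms(3) by (simp add: B_def W.diag_coeff_def)
  finally show ?thesis .
qed

lemma subspace_coord:
  assumes "K \<subseteq> I"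
  shows "lin_coord (V\<lparr>carrier := \<Phi> ` coord_space K\<rparr>) K \<Phi>"
proof unfold_locales
  show "bij_betw \<Phi> (coord_space K) (carrier (V\<lparr>carrier := \<Phi> ` coord_space K\<rparr>))"
    using bij coord_space_mono[OF _ assms] by (auto simp: bij_betw_def inj_on_def)
qed (use coord_space_mono[OF _ assms] in \<open>auto simp: \<Phi>_add \<Phi>_scale \<Phi>_zero\<close>)

lemma subspace_diag_coeff:
  assumes "K \<subseteq> I" "i \<in> K" "T (\<Phi> (unit_coord i)) \<in> \<Phi> ` coord_space K"
  shows "lin_coord.diag_coeff K \<Phi> T i = diag_coeff T i"
proof -
  interpret K: lin_coord "V\<lparr>carrier := \<Phi> ` coord_space K\<rparr>" K \<Phi>
    using assms(1) by (rule subspace_coord)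
  obtain c where c: "c \<in> coord_space K" "T (\<Phi> (unit_coord i)) = \<Phi> c"
    using assms(3) by blast
  then show ?thesis
    using coord_space_mono[OF _ assms(1)] by (simp add: K.diag_coeff_def diag_coeff_def)
qed

section \<open>Quotients by a coordinate subspace\<close>

context
  fixes J :: "'i set"
  assumes J: "J \<subseteq> I"
begin

abbreviation "N \<equiv> \<Phi> ` coord_space J"

lemma coset_eq:
  assumes c: "c \<in> coord_space I"
  shows "N +> \<Phi> c = \<Phi> ` {d \<in> coord_space I. \<forall>i\<in>I - J. d i = c i}"
proof -
  have "N +> \<Phi> c = {\<Phi> n \<oplus> \<Phi> c |n. n \<in> coord_space J}"
    by (auto simp: a_r_coset_def r_coset_def)
  also have "\<dots> = {\<Phi> (\<lambda>i. n i + c i) |n. n \<in> coord_space J}"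
    using \<Phi>_add[OF coord_space_mono[OF _ J] c] by (intro Collect_cong) metis
  also have "\<dots> = \<Phi> ` {d \<in> coord_space I. \<forall>i\<in>I - J. d i = c i}"
  proof (intro equalityI subsetI)
    fix x assume "x \<in> {\<Phi> (\<lambda>i. n i + c i) |n. n \<in> coord_space J}"
    then obtain n where "n \<in> coord_space J" "x = \<Phi> (\<lambda>i. n i + c i)" by blast
    then show "x \<in> \<Phi> ` {d \<in> coord_space I. \<forall>i\<in>I - J. d i = c i}"
      using c coord_space_mono[OF _ J] coord_space_eq_0 by (intro image_eqI) auto
  next
    fix x assume "x \<in> \<Phi> ` {d \<in> coord_space I. \<forall>i\<in>I - J. d i = c i}"
    then obtain d where d: "d \<in> coord_space I" "\<forall>i\<in>I - J. d i = c i" "x = \<Phi> d" by blast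
    have "(\<lambda>i. d i - c i) \<in> coord_space I"
      using c d by simp
    moreover have "{i. d i - c i \<noteq> 0} \<subseteq> J"
      using d c coord_space_eq_0[of _ I] by fastforce
    ultimately have "(\<lambda>i. d i - c i) \<in> coord_space J"
      by (simp add: coord_space_def)
    then show "x \<in> {\<Phi> (\<lambda>i. n i + c i) |n. n \<in> coord_space J}"
      using d(3) by (auto intro!: exI[of _ "\<lambda>i. d i - c i"])
  qed
  finally show ?thesis .
qed

lemma coset_eq_iff:
  assumes c: "c \<in> coord_space I" "d \<in> coord_space I"
  shows "N +> \<Phi> c = N +> \<Phi> d \<longleftrightarrow> (\<forall>i\<in>I - J. c i = d i)"
proof
  assume "N +> \<Phi> c = N +> \<Phi> d"
  then have "\<Phi> c \<in> \<Phi> ` {e \<in> coord_space I. \<forall>i\<in>I - J. e i = d i}"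
    using c coset_eq by blast
  then show "\<forall>i\<in>I - J. c i = d i"
    using c \<Phi>_inj by auto
next
  assume "\<forall>i\<in>I - J. c i = d i"
  then show "N +> \<Phi> c = N +> \<Phi> d"
    using c by (simp add: coset_eq cong: conj_cong)
qed

lemma coset_add:
  assumes "x \<in> carrier V" "y \<in> carrier V"
  shows "(N +> x) <+>\<^bsub>V\<^esub> (N +> y) = N +> (x \<oplus> y)"
proof -
  interpret abelian_group V by (rule abelian)
  have N: "N \<subseteq> carrier V"
    using coord_space_mono[OF _ J] by auto
  have "additive_subgroup N V"
  proof (rule additive_subgroup.intro, rule add.subgroupI)
    show "N \<noteq> {}" using coord_space_zero by blast
    fix x y assume "x \<in> N" "y \<in> N"
    then show "x \<oplus> y \<in> N"
      using coord_space_mono[OF _ J] by (auto simp flip: \<Phi>_add)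
    obtain c where c: "c \<in> coord_space J" "x = \<Phi> c"
      using \<open>x \<in> N\<close> by blast
    have "(-1) \<odot> x = \<Phi> (\<lambda>i. (-1) * c i)"
      unfolding c(2) using coord_space_mono[OF c(1) J] by (rule \<Phi>_scale[symmetric])
    then have "(-1) \<odot> x \<in> N"
      using coord_space_scale[OF c(1)] by blast
    moreover have "\<ominus> x = (-1) \<odot> x"
      using \<open>x \<in> N\<close> N by (intro minus_equality coord_inj) (auto simp: coord_add coord_smult coord_zero)
    ultimately show "\<ominus> x \<in> N" by simp
  qed (use N in auto)
  then interpret abelian_subgroup N V
    by (rule abelian_subgroupI3) (rule abelian)
  show ?thesis
    using assms by (rule a_rcos_sum)
qed

lemma coset_smult:
  assumes "c \<in> coord_space I"
  shows "N <+>\<^bsub>V\<^esub> (\<lambda>x. a \<odot> x) ` (N +> \<Phi> c) = N +> (a \<odot> \<Phi> c)"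
proof (intro equalityI subsetI)
  interpret abelian_group V by (rule abelian)
  fix y assume "y \<in> N <+>\<^bsub>V\<^esub> (\<lambda>x. a \<odot> x) ` (N +> \<Phi> c)"
  then obtain n x where nx: "n \<in> N" "x \<in> N +> \<Phi> c" "y = n \<oplus> a \<odot> x"
    by (auto simp: set_add_def set_mult_def)
  obtain e d where e: "e \<in> coord_space J" "n = \<Phi> e"
    and d: "d \<in> coord_space I" "\<forall>i\<in>I - J. d i = c i" "x = \<Phi> d"
    using nx assms by (auto simp: coset_eq)
  have "y = \<Phi> (\<lambda>i. e i + a * d i)"
    using e d nx coord_space_mono[OF _ J] by (simp add: \<Phi>_add \<Phi>_scale)
  moreover have "(\<lambda>i. e i + a * d i) \<in> coord_space I"
    using e d coord_space_mono[OF _ J] by simp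
  moreover have "\<forall>i\<in>I - J. e i + a * d i = a * c i"
    using e d coord_space_eq_0[OF e(1)] by auto
  ultimately show "y \<in> N +> (a \<odot> \<Phi> c)"
    using assms by (simp add: coset_eq flip: \<Phi>_scale)
next
  interpret abelian_group V by (rule abelian)
  fix y assume "y \<in> N +> (a \<odot> \<Phi> c)"
  then obtain n where n: "n \<in> N" "y = n \<oplus> (a \<odot> \<Phi> c)"
    by (auto simp: a_r_coset_def r_coset_def)
  moreover have "\<Phi> c \<in> N +> \<Phi> c"
    using assms by (auto simp: coset_eq)
  ultimately show "y \<in> N <+>\<^bsub>V\<^esub> (\<lambda>x. a \<odot> x) ` (N +> \<Phi> c)"
    unfolding set_add_def set_mult_def by auto
qed

text \<open>A coset is determined by the coordinates outside \<open>J\<close>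
  (\<open>coset_eq_iff\<close>), so the basis vectors outside \<open>J\<close> become a basis of the
  quotient. Erasing the coordinates in \<open>J\<close> selects the normal form of a coset.\<close>

lemma quotient_coord: "lin_coord (quotient_module V N) (I - J) (\<lambda>c. N +> \<Phi> c)"
proof unfold_locales
  have CS: "c \<in> coord_space (I - J) \<Longrightarrow> c \<in> coord_space I" for c
    by (rule coord_space_mono) auto
  have carrier: "carrier (quotient_module V N) = (\<lambda>x. N +> x) ` carrier V"
    by (auto simp: quotient_module_def ring.defs module.defs FactRing_def A_RCOSETS_def RCOSETS_def
        a_r_coset_def)
  show "bij_betw (\<lambda>c. N +> \<Phi> c) (coord_space (I - J)) (carrier (quotient_module V N))"
    unfolding bij_betw_def
  proof
    show "inj_on (\<lambda>c. N +> \<Phi> c) (coord_space (I - J))"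
    proof (rule inj_onI)
      fix c d assume cd: "c \<in> coord_space (I - J)" "d \<in> coord_space (I - J)" "N +> \<Phi> c = N +> \<Phi> d"
      then have "\<forall>i\<in>I - J. c i = d i"
        using CS coset_eq_iff by blast
      moreover have "c i = d i" if "i \<notin> I - J" for i
        using coord_space_eq_0[OF cd(1) that] coord_space_eq_0[OF cd(2) that] by simp
      ultimately show "c = d" by blast
    qed
    show "(\<lambda>c. N +> \<Phi> c) ` coord_space (I - J) = carrier (quotient_module V N)"
      unfolding carrier
    proof (intro equalityI subsetI)
      fix X assume "X \<in> (\<lambda>x. N +> x) ` carrier V"
      then obtain c where c: "c \<in> coord_space I" "X = N +> \<Phi> c"
        using ex_coord by blast
      define d where "d = (\<lambda>i. if i \<notin> J then c i else 0)"
      have d: "d \<in> coord_space (I - J)"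
        using coord_space_restrict[OF c(1), of "\<lambda>i. i \<notin> J"] by (simp add: d_def set_diff_eq)
      moreover have "X = N +> \<Phi> d"
        using c CS[OF d] by (simp add: coset_eq_iff d_def)
      ultimately show "X \<in> (\<lambda>c. N +> \<Phi> c) ` coord_space (I - J)" by blast
    qed (use CS in auto)
  qed
  fix c d a assume c: "c \<in> coord_space (I - J)"
  show "N +> \<Phi> (\<lambda>i. a * c i) = a \<odot>\<^bsub>quotient_module V N\<^esub> (N +> \<Phi> c)"
    using CS[OF c] by (simp add: quotient_module_def ring.defs module.defs coset_smult \<Phi>_scale)
  assume d: "d \<in> coord_space (I - J)"
  show "N +> \<Phi> (\<lambda>i. c i + d i) = (N +> \<Phi> c) \<oplus>\<^bsub>quotient_module V N\<^esub> (N +> \<Phi> d)"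
    using CS[OF c] CS[OF d] by (simp add: quotient_module_def ring.defs module.defs FactRing_def coset_add \<Phi>_add)
next
  interpret abelian_group V by (rule abelian)
  have "N +> \<zero> = N"
    using coord_space_mono[OF _ J] by (force simp: a_r_coset_def r_coset_def)
  then show "N +> \<Phi> (\<lambda>_. 0) = \<zero>\<^bsub>quotient_module V N\<^esub>"
    by (simp add: quotient_module_def ring.defs module.defs FactRing_def \<Phi>_zero)
qed

lemma image_coset:
  assumes T: "T \<in> module_hom complex_field V V" and TN: "T ` N = N" and x: "x \<in> carrier V"
  shows "T ` (N +> x) = N +> T x"
proof -
  have N: "n \<in> N \<Longrightarrow> n \<in> carrier V" for n
    using coord_space_mono[OF _ J] by auto
  have "T ` (N +> x) = {T n \<oplus> T x |n. n \<in> N}"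
  proof -
    have "T ` (N +> x) = (\<lambda>n. T (n \<oplus> x)) ` N"
      by (auto simp: a_r_coset_def r_coset_def)
    also have "\<dots> = (\<lambda>n. T n \<oplus> T x) ` N"
      using LinearCombinations.module_hom_add[OF T N x] by (intro image_cong) auto
    finally show ?thesis
      by blast
  qed
  also have "\<dots> = {n \<oplus> T x |n. n \<in> T ` N}"
    by blast
  also have "\<dots> = N +> T x"
    unfolding TN by (auto simp: a_r_coset_def r_coset_def)
  finally show ?thesis .
qed

text \<open>Passing to the quotient erases only coordinates in \<open>J\<close>, which does not
  affect the diagonal entry at an index outside \<open>J\<close>. Traces on quotients are thus
  partial sums of the diagonal coefficients upstairs.\<close>

lemma quotient_diag_coeff:
  assumes T: "T \<in> module_hom complex_field V V" and TN: "T ` N = N" and i: "i \<in> I - J"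
  shows "lin_coord.diag_coeff (I - J) (\<lambda>c. N +> \<Phi> c) ((`) T) i = diag_coeff T i"
proof -
  interpret Q: lin_coord "quotient_module V N" "I - J" "\<lambda>c. N +> \<Phi> c"
    by (rule quotient_coord)
  define c where "c = coord (T (\<Phi> (unit_coord i)))"
  have c: "c \<in> coord_space I" "T (\<Phi> (unit_coord i)) = \<Phi> c"
    using i module_hom_closed[OF T, THEN funcset_mem] by (auto simp: c_def)
  define d where "d = (\<lambda>i. if i \<notin> J then c i else 0)"
  have d: "d \<in> coord_space (I - J)"
    using coord_space_restrict[OF c(1), of "\<lambda>i. i \<notin> J"] by (simp add: d_def set_diff_eq)
  then have dI: "d \<in> coord_space I"
    by (rule coord_space_mono) auto
  have "T ` (N +> \<Phi> (unit_coord i)) = N +> \<Phi> c"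
    using image_coset[OF T TN] i c(2) by simp
  also have "\<dots> = N +> \<Phi> d"
    using c(1) dI by (simp add: coset_eq_iff d_def)
  finally have "Q.diag_coeff ((`) T) i = d i"
    using d by (simp add: Q.diag_coeff_def)
  then show ?thesis
    using i by (simp add: d_def diag_coeff_def c_def)
qed

end

end

section \<open>Finite-dimensional representations\<close>

lemma (in lin_coord) group_moduleI:
  assumes "group G"
    and "\<And>g. g \<in> carrier G \<Longrightarrow> \<rho> g \<in> module_hom complex_field V V"
    and "\<And>x. x \<in> carrier V \<Longrightarrow> \<rho> \<one>\<^bsub>G\<^esub> x = x"
    and "\<And>g h x. \<lbrakk>g \<in> carrier G; h \<in> carrier G; x \<in> carrier V\<rbrakk> \<Longrightarrow> \<rho> (g \<otimes>\<^bsub>G\<^esub> h) x = \<rho> g (\<rho> h x)"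
  shows "group_module G V \<rho>"
  by (intro group_module.intro group_module_axioms.intro assms vectorspace)

text \<open>Two spaces may come with different index types, while an intertwiner needs matrices over
  a common one. An initial segment of the naturals provides it for every dimension.\<close>

lemma (in lin_coord) ex_nat_coord:
  assumes "finite I"
  shows "\<exists>\<Psi>. lin_coord V {..<card I} \<Psi>"
proof -
  obtain f where f: "bij_betw f I {..<card I}"
    using ex_bij_betw_finite_nat[OF assms] by (auto simp: atLeast0LessThan)
  define R where "R c = (\<lambda>i. if i \<in> I then c (f i) else 0)" for c :: "nat \<Rightarrow> complex"
  have R_in: "R c \<in> coord_space I" for c
    using assms by (simp add: R_def coord_space_finite)
  have bij_R: "bij_betw R (coord_space {..<card I}) (coord_space I)"
  proof (rule bij_betw_byWitness[of _ "\<lambda>d k. if k < card I then d (the_inv_into I f k) else 0"])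
    show "\<forall>c\<in>coord_space {..<card I}. (\<lambda>k. if k < card I then R c (the_inv_into I f k) else 0) = c"
      using f by (auto simp: coord_space_finite R_def fun_eq_iff f_the_inv_into_f_bij_betw
          bij_betw_def intro: the_inv_into_into)
    show "\<forall>d\<in>coord_space I. R (\<lambda>k. if k < card I then d (the_inv_into I f k) else 0) = d"
      using f assms by (auto simp: coord_space_finite R_def fun_eq_iff the_inv_into_f_f bij_betw_def)
  qed (use R_in in \<open>auto simp: coord_space_finite\<close>)
  have "lin_coord V {..<card I} (\<Phi> \<circ> R)"
  proof unfold_locales
    show "bij_betw (\<Phi> \<circ> R) (coord_space {..<card I}) (carrier V)"
      using bij_R bij by (rule bij_betw_trans)
    have "R (\<lambda>i. c i + d i) = (\<lambda>i. R c i + R d i)" "R (\<lambda>i. a * c i) = (\<lambda>i. a * R c i)" "R (\<lambda>_. 0) = (\<lambda>_. 0)" for c d a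
      by (auto simp: R_def)
    then show "(\<Phi> \<circ> R) (\<lambda>i. c i + d i) = (\<Phi> \<circ> R) c \<oplus> (\<Phi> \<circ> R) d"
      "(\<Phi> \<circ> R) (\<lambda>i. a * c i) = a \<odot> (\<Phi> \<circ> R) c" "(\<Phi> \<circ> R) (\<lambda>_. 0) = \<zero>" for c d a
      by (simp_all add: \<Phi>_add \<Phi>_scale \<Phi>_zero R_in)
  qed
  then show ?thesis by blast
qed

definition apply_fmat :: "'i fmat \<Rightarrow> ('i \<Rightarrow> complex) \<Rightarrow> 'i \<Rightarrow> complex" where
  "apply_fmat A c = (\<lambda>i. \<Sum>j\<in>fsupp A. entry A i j * c j)"

lemma apply_fmat_superset:
  "finite S \<Longrightarrow> fsupp A \<subseteq> S \<Longrightarrow> apply_fmat A c i = (\<Sum>j\<in>S. entry A i j * c j)"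
  unfolding apply_fmat_def by (intro sum.mono_neutral_left) (auto simp: entry_eq_0)

lemma apply_fmat_times: "apply_fmat (A * B) c = apply_fmat A (apply_fmat B c)"
proof
  fix i
  define S where "S = fsupp A \<union> fsupp B \<union> fsupp (A * B)"
  have S: "finite S" "fsupp A \<subseteq> S" "fsupp B \<subseteq> S" "fsupp (A * B) \<subseteq> S"
    by (auto simp: S_def)
  have "apply_fmat (A * B) c i = (\<Sum>k\<in>S. \<Sum>j\<in>S. entry A i j * entry B j k * c k)"
    by (simp add: apply_fmat_superset[OF S(1)] entry_times_superset[OF S(1)] S sum_distrib_right)
  also have "\<dots> = (\<Sum>j\<in>S. \<Sum>k\<in>S. entry A i j * entry B j k * c k)"
    by (rule sum.swap)
  also have "\<dots> = apply_fmat A (apply_fmat B c) i"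
    by (simp add: apply_fmat_superset[OF S(1)] S sum_distrib_left mult.assoc)
  finally show "apply_fmat (A * B) c i = apply_fmat A (apply_fmat B c) i" .
qed

lemma apply_fmat_add: "apply_fmat A (\<lambda>i. c i + d i) = (\<lambda>i. apply_fmat A c i + apply_fmat A d i)"
  by (simp add: apply_fmat_def distrib_left sum.distrib)

lemma apply_fmat_scale: "apply_fmat A (\<lambda>i. a * c i) = (\<lambda>i. a * apply_fmat A c i)"
  by (simp add: apply_fmat_def sum_distrib_left mult_ac)

locale coord_rep = group_module G V \<rho> + lin_coord V I \<Phi>
  for G :: "('g, 'm) monoid_scheme" and V :: "(complex, 'v) module" and \<rho> and I :: "'i set" and \<Phi> +
  assumes finite_coords: "finite I" and finite_group: "finite (carrier G)"
begin

definition rep_matrix :: "'g \<Rightarrow> 'i fmat" where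
  "rep_matrix g = Abs_fmat (\<lambda>i j. if i \<in> I \<and> j \<in> I then coord (\<rho> g (\<Phi> (unit_coord j))) i else 0)"

lemma entry_rep_matrix:
  "entry (rep_matrix g) i j = (if i \<in> I \<and> j \<in> I then coord (\<rho> g (\<Phi> (unit_coord j))) i else 0)"
proof -
  have "{(i, j). (if i \<in> I \<and> j \<in> I then coord (\<rho> g (\<Phi> (unit_coord j))) i else 0) \<noteq> 0} \<subseteq> I \<times> I"
    by auto
  then have "finite {(i, j). (if i \<in> I \<and> j \<in> I then coord (\<rho> g (\<Phi> (unit_coord j))) i else 0) \<noteq> 0}"
    using finite_coords finite_subset by blast
  then show ?thesis
    by (simp add: rep_matrix_def Abs_fmat_inverse)
qed

lemma fsupp_rep_matrix: "fsupp (rep_matrix g) \<subseteq> I"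
  by (auto simp: fsupp_def entry_rep_matrix split: if_splits)

lemma act_closed [simp]: "g \<in> carrier G \<Longrightarrow> x \<in> carrier V \<Longrightarrow> \<rho> g x \<in> carrier V"
  using act_linear module_hom_closed by blast

lemma coord_act:
  assumes "g \<in> carrier G" "x \<in> carrier V"
  shows "coord (\<rho> g x) = apply_fmat (rep_matrix g) (coord x)"
proof
  fix i
  have x0: "coord x j = 0" if "j \<notin> I" for j
    using that by (rule coord_space_eq_0[OF coord_closed[OF assms(2)]])
  have "coord (\<rho> g (\<Phi> (coord x))) i = (\<Sum>j\<in>I. coord x j * coord (\<rho> g (\<Phi> (unit_coord j))) i)"
    by (rule coord_linear_expand[OF lin_coord_axioms act_linear[OF assms(1)] finite_coords order_refl x0])
  also have "\<dots> = (\<Sum>j\<in>I. entry (rep_matrix g) i j * coord x j)"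
  proof (cases "i \<in> I")
    case False
    then have "coord (\<rho> g (\<Phi> (unit_coord j))) i = 0" if "j \<in> I" for j
      using assms(1) that by (intro coord_space_eq_0[OF coord_closed]) auto
    then show ?thesis
      using False by (simp add: entry_rep_matrix)
  qed (simp add: entry_rep_matrix mult.commute)
  finally show "coord (\<rho> g x) i = apply_fmat (rep_matrix g) (coord x) i"
    using assms(2) fsupp_rep_matrix by (simp add: apply_fmat_superset[OF finite_coords])
qed

lemma ftrace_rep_matrix: "ftrace (rep_matrix g) = (\<Sum>i\<in>I. diag_coeff (\<rho> g) i)"
  by (simp add: ftrace_superset[OF finite_coords fsupp_rep_matrix] entry_rep_matrix diag_coeff_def)

lemma matrix_rep: "matrix_rep G rep_matrix"
proof unfold_locales
  fix g h assume gh: "g \<in> carrier G" "h \<in> carrier G"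
  show "rep_matrix (g \<otimes>\<^bsub>G\<^esub> h) = rep_matrix g * rep_matrix h"
  proof (rule fmat_eqI)
    fix i j
    show "entry (rep_matrix (g \<otimes>\<^bsub>G\<^esub> h)) i j = entry (rep_matrix g * rep_matrix h) i j"
    proof (cases "i \<in> I \<and> j \<in> I")
      case True
      then have "coord (\<rho> (g \<otimes>\<^bsub>G\<^esub> h) (\<Phi> (unit_coord j))) i
          = apply_fmat (rep_matrix g) (coord (\<rho> h (\<Phi> (unit_coord j)))) i"
        using gh by (simp add: act_mult coord_act)
      then show ?thesis
        using True by (simp add: entry_rep_matrix apply_fmat_superset[OF finite_coords fsupp_rep_matrix]
            entry_times_superset[OF finite_coords fsupp_rep_matrix])
    next
      case False
      then have "entry (rep_matrix g * rep_matrix h) i j = 0"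
        by (auto simp: entry_times_superset[OF finite_coords fsupp_rep_matrix] entry_rep_matrix intro: sum.neutral)
      with False show ?thesis
        by (auto simp: entry_rep_matrix)
    qed
  qed
qed (rule finite_group)

text \<open>Absorbing the matrix of \<open>\<one>\<close> on the left forces the rows outside
  \<open>I\<close> to vanish, so that the result is again a coordinate vector.\<close>

lemma apply_fmat_in:
  assumes "rep_matrix \<one>\<^bsub>G\<^esub> * A = A"
  shows "apply_fmat A c \<in> coord_space I"
proof -
  have "entry (rep_matrix \<one>\<^bsub>G\<^esub> * A) i j = 0" if "i \<notin> I" for i j
    using that by (simp add: entry_times_superset[OF finite_coords fsupp_rep_matrix] entry_rep_matrix)
  then show ?thesis
    using finite_coords assms by (simp add: coord_space_finite apply_fmat_def)
qed

end

theorem group_module_iso_if_same_traces: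
  fixes G :: "('g, 'm) monoid_scheme" and V :: "(complex, 'v) module" and W :: "(complex, 'w) module"
  assumes V: "group_module G V \<rho>" "lin_coord V I \<Phi>" "finite I"
    and W: "group_module G W \<phi>" "lin_coord W J \<Psi>" "finite J"
    and "finite (carrier G)"
    and trace: "\<And>g. g \<in> carrier G \<Longrightarrow>
      (\<Sum>i\<in>I. lin_coord.diag_coeff I \<Phi> (\<rho> g) i) = (\<Sum>j\<in>J. lin_coord.diag_coeff J \<Psi> (\<phi> g) j)"
  shows "group_module_iso G V \<rho> W \<phi>"
proof -
  obtain \<Phi>' where \<Phi>': "lin_coord V {..<card I} \<Phi>'"
    using lin_coord.ex_nat_coord V(2,3) by blast
  obtain \<Psi>' where \<Psi>': "lin_coord W {..<card J} \<Psi>'"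
    using lin_coord.ex_nat_coord W(2,3) by blast
  interpret V: coord_rep G V \<rho> "{..<card I}" \<Phi>'
    by (intro coord_rep.intro coord_rep_axioms.intro V \<Phi>' assms) simp
  interpret W: coord_rep G W \<phi> "{..<card J}" \<Psi>'
    by (intro coord_rep.intro coord_rep_axioms.intro W \<Psi>' assms) simp
  interpret matrix_rep_pair G V.rep_matrix W.rep_matrix
    by (intro matrix_rep_pair.intro V.matrix_rep W.matrix_rep)
  have "ftrace (V.rep_matrix g) = ftrace (W.rep_matrix g)" if g: "g \<in> carrier G" for g
    using trace[OF g] V.sum_diag_coeff_independent[OF V(2) _ V(3) V.act_linear[OF g]]
      W.sum_diag_coeff_independent[OF W(2) _ W(3) W.act_linear[OF g]]
    by (simp add: V.ftrace_rep_matrix W.ftrace_rep_matrix)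
  then obtain T S where TS: "intertwiner T" "S * T = V.rep_matrix \<one>\<^bsub>G\<^esub>" "T * S = W.rep_matrix \<one>\<^bsub>G\<^esub>"
    "S * W.rep_matrix \<one>\<^bsub>G\<^esub> = S"
    using equivalent_if_same_traces by blast
  have T1: "T * V.rep_matrix \<one>\<^bsub>G\<^esub> = T" "W.rep_matrix \<one>\<^bsub>G\<^esub> * T = T"
    using TS(1) unfolding intertwiner_def by (metis V.G.one_closed)+
  have S1: "V.rep_matrix \<one>\<^bsub>G\<^esub> * S = S"
    using TS(2-4) by (metis mult.assoc)
  define t where "t x = \<Psi>' (apply_fmat T (V.coord x))" for x
  define s where "s y = \<Phi>' (apply_fmat S (W.coord y))" for y
  have T_in: "apply_fmat T c \<in> coord_space {..<card J}" for c
    by (rule W.apply_fmat_in[OF T1(2)])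
  have S_in: "apply_fmat S c \<in> coord_space {..<card I}" for c
    by (rule V.apply_fmat_in[OF S1])
  \<comment> \<open>\<open>S * T\<close> is the matrix of \<open>\<one>\<close>, which acts as the
    identity; the same holds for \<open>T * S\<close> on the other side.\<close>
  have "s (t x) = x" if "x \<in> carrier V" for x
    using that by (simp add: s_def t_def T_in TS(2) V.act_one flip: apply_fmat_times V.coord_act)
  moreover have "t (s y) = y" if "y \<in> carrier W" for y
    using that by (simp add: s_def t_def S_in TS(3) W.act_one flip: apply_fmat_times W.coord_act)
  ultimately have bij: "bij_betw t (carrier V) (carrier W)"
    by (intro bij_betw_byWitness[of _ s]) (auto simp: s_def t_def T_in S_in)
  have "t (\<rho> g x) = \<phi> g (t x)" if g: "g \<in> carrier G" and x: "x \<in> carrier V" for g x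
  proof (rule W.coord_inj)
    have "T * V.rep_matrix g = W.rep_matrix g * T"
      using TS(1) g by (simp add: intertwiner_def)
    moreover have "W.coord (t (\<rho> g x)) = apply_fmat (T * V.rep_matrix g) (V.coord x)"
      using g x by (simp add: t_def T_in V.coord_act apply_fmat_times)
    moreover have "W.coord (\<phi> g (t x)) = apply_fmat (W.rep_matrix g * T) (V.coord x)"
      using g x by (simp add: t_def T_in W.coord_act apply_fmat_times)
    ultimately show "W.coord (t (\<rho> g x)) = W.coord (\<phi> g (t x))"
      by simp
  qed (use g x in \<open>auto simp: t_def T_in\<close>)
  moreover have "t \<in> module_hom complex_field V W"
    unfolding LinearCombinations.module_hom_def
    by (auto simp: t_def T_in V.coord_add V.coord_smult apply_fmat_add apply_fmat_scale W.\<Phi>_add W.\<Phi>_scale)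
  ultimately show ?thesis
    unfolding group_module_iso_def using V(1) W(1) bij by blast
qed

text \<open>Bridges from abstract bases, and the trace defined by a choice of one, to coordinate
  maps. The basis vectors serve as their own indices.\<close>

lemma fin_dim_coord:
  fixes V :: "(complex, 'v) module"
  assumes "fin_dim_representation G V \<rho>"
  shows "\<exists>I :: 'v set. \<exists>\<Phi>. finite I \<and> lin_coord V I \<Phi> \<and>
     (\<forall>T\<in>module_hom complex_field V V. linear_trace V T = (\<Sum>i\<in>I. lin_coord.diag_coeff I \<Phi> T i))"
proof -
  interpret fin_dim_representation G V \<rho> by fact
  \<comment> \<open>The choice must be the one made inside \<open>linear_trace\<close>, so that the
    trace unfolds to a sum over this very \<open>B\<close>.\<close>
  define B where "B = (SOME B. finite B \<and> basis B)"
  have "\<exists>B. finite B \<and> basis B"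
    using finite_basis_exists finite_dimensional by blast
  then have B: "finite B" "basis B"
    unfolding B_def by (metis (mono_tags, lifting) someI_ex)+
  have BV: "B \<subseteq> carrier V"
    using B(2) by (simp add: basis_def)
  have crit: "\<exists>!a. a \<in> B \<rightarrow>\<^sub>E UNIV \<and> lincomb a B = v" if "v \<in> carrier V" for v
    using basis_criterion[OF B(1) BV] B(2) that by (simp add: class_ring_simps)
  define \<Phi> where "\<Phi> c = lincomb c B" for c
  have restr: "lincomb (restrict c B) B = lincomb c B" for c
    unfolding lincomb_def using BV by (intro finsum_cong') auto
  have lin_closed: "lincomb c B \<in> carrier V" for c
    using BV by (intro lincomb_closed) auto
  have "lin_coord V B \<Phi>"
  proof unfold_locales
    show "bij_betw \<Phi> (coord_space B) (carrier V)"
      unfolding bij_betw_def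
    proof
      show "inj_on \<Phi> (coord_space B)"
      proof (rule inj_onI)
        fix c d assume cd: "c \<in> coord_space B" "d \<in> coord_space B" "\<Phi> c = \<Phi> d"
        have "restrict c B = restrict d B"
          using crit[OF lin_closed[of c]] cd(3) restr[of c] restr[of d] by (auto simp: \<Phi>_def)
        then have "c i = d i" if "i \<in> B" for i
          using that by (metis restrict_apply')
        moreover have "c i = d i" if "i \<notin> B" for i
          using that cd coord_space_eq_0 by metis
        ultimately show "c = d" by blast
      qed
      show "\<Phi> ` coord_space B = carrier V"
      proof (intro equalityI subsetI)
        fix v assume "v \<in> carrier V"
        then obtain a where a: "lincomb a B = v"
          using crit by blast
        define c where "c i = (if i \<in> B then a i else 0)" for i
        have "c \<in> coord_space B"
          using B(1) by (simp add: coord_space_finite c_def)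
        moreover have "\<Phi> c = v"
          using restr[of c] restr[of a] a by (simp add: \<Phi>_def c_def restrict_def cong: if_cong)
        ultimately show "v \<in> \<Phi> ` coord_space B" by blast
      qed (auto simp: \<Phi>_def lin_closed)
    qed
    show "\<Phi> (\<lambda>i. c i + d i) = \<Phi> c \<oplus>\<^bsub>V\<^esub> \<Phi> d" for c d
      using lincomb_sum[OF B(1) BV, of c d] by (simp add: \<Phi>_def)
    show scale: "\<Phi> (\<lambda>i. a * c i) = a \<odot>\<^bsub>V\<^esub> \<Phi> c" for a c
      using lincomb_smult[OF BV, of c a] by (simp add: \<Phi>_def)
    show "\<Phi> (\<lambda>_. 0) = \<zero>\<^bsub>V\<^esub>"
      using scale[of 0 "\<lambda>_. 0"] lin_closed[of "\<lambda>_. 0"] smult_l_null by (simp add: \<Phi>_def)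
  qed
  then interpret C: lin_coord V B \<Phi> .
  have "linear_trace V T = (\<Sum>i\<in>B. C.diag_coeff T i)" if T: "T \<in> module_hom complex_field V V" for T
  proof -
    have "coordinates V B (T b) b = C.diag_coeff T b" if b: "b \<in> B" for b
    proof -
      have "\<Phi> (unit_coord b) = (\<Oplus>\<^bsub>V\<^esub>v\<in>B. if b = v then v else \<zero>\<^bsub>V\<^esub>)"
        unfolding \<Phi>_def lincomb_def using BV smult_l_null smult_one
        by (intro finsum_cong') (auto simp: unit_coord_def)
      then have "\<Phi> (unit_coord b) = b"
        using finsum_singleton[OF b B(1), of "\<lambda>v. v"] BV by auto
      moreover have "coordinates V B v b = C.coord v b" if v: "v \<in> carrier V" for v
      proof -
        have "restrict (C.coord v) B \<in> B \<rightarrow>\<^sub>E UNIV \<and> lincomb (restrict (C.coord v) B) B = v"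
          using C.\<Phi>_coord[OF v] by (simp add: restr \<Phi>_def)
        then have "coordinates V B v = restrict (C.coord v) B"
          unfolding coordinates_def using crit[OF v] by (intro the1_equality)
        then show ?thesis
          using b by simp
      qed
      ultimately show ?thesis
        using T b BV by (auto simp: C.diag_coeff_def dest: module_hom_closed)
    qed
    then show ?thesis
      unfolding linear_trace_def Let_def B_def[symmetric] by simp
  qed
  then have "finite B \<and> lin_coord V B \<Phi> \<and>
      (\<forall>T\<in>module_hom complex_field V V. linear_trace V T = (\<Sum>i\<in>B. C.diag_coeff T i))"
    using B(1) C.lin_coord_axioms by simp
  then show ?thesis
    by (intro exI)
qed

text \<open>The disjoint union of the bases is a basis of the direct sum. The matrix of a
  componentwise map is block diagonal, so its diagonal entries are those of the blocks.\<close>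

lemma module_sum_coord:
  assumes coord: "\<And>i. i \<in> K \<Longrightarrow> lin_coord (V i) (I i) (\<Phi> i)" and fin: "finite K" "\<And>i. i \<in> K \<Longrightarrow> finite (I i)"
  defines "\<Psi> \<equiv> \<lambda>c. \<lambda>i\<in>K. \<Phi> i (\<lambda>j. c (i, j))"
  shows "lin_coord (module_sum K V) (Sigma K I) \<Psi>"
    and "\<lbrakk>i \<in> K; j \<in> I i; \<And>i. i \<in> K \<Longrightarrow> T i \<in> module_hom complex_field (V i) (V i)\<rbrakk> \<Longrightarrow>
      lin_coord.diag_coeff (Sigma K I) \<Psi> (\<lambda>x. \<lambda>i\<in>K. T i (x i)) (i, j) = lin_coord.diag_coeff (I i) (\<Phi> i) (T i) j"
proof -
  have finS: "finite (Sigma K I)"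
    using fin by simp
  have slice: "(\<lambda>j. c (i, j)) \<in> coord_space (I i)" if "c \<in> coord_space (Sigma K I)" "i \<in> K" for c i
    using that fin by (simp add: coord_space_finite)
  define R where "R x = (\<lambda>(i, j). if i \<in> K then lin_coord.coord (I i) (\<Phi> i) (x i) j else 0)" for x
  have R_in: "R x \<in> coord_space (Sigma K I)" if "x \<in> (\<Pi>\<^sub>E i\<in>K. carrier (V i))" for x
  proof -
    have "R x (i, j) = 0" if "i \<in> K" "j \<notin> I i" for i j
      using coord_space_eq_0[OF lin_coord.coord_closed[OF coord[OF that(1)] PiE_mem[OF \<open>x \<in> _\<close> that(1)]] that(2)]
      by (simp add: R_def)
    then show ?thesis
      by (auto simp: coord_space_finite[OF finS] R_def)
  qed
  have "\<Psi> c \<in> (\<Pi>\<^sub>E i\<in>K. carrier (V i))" if "c \<in> coord_space (Sigma K I)" for c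
    using slice[OF that] coord lin_coord.\<Phi>_closed by (fastforce simp: \<Psi>_def)
  moreover have R\<Psi>: "R (\<Psi> c) = c" if c: "c \<in> coord_space (Sigma K I)" for c
  proof (rule ext, clarify)
    fix i j
    show "R (\<Psi> c) (i, j) = c (i, j)"
      using lin_coord.coord_\<Phi>[OF coord slice[OF c]] coord_space_eq_0[OF c, of "(i, j)"]
      by (auto simp: R_def \<Psi>_def)
  qed
  moreover have \<Psi>R: "\<Psi> (R x) = x" if x: "x \<in> (\<Pi>\<^sub>E i\<in>K. carrier (V i))" for x
  proof
    fix i
    show "\<Psi> (R x) i = x i"
      using x lin_coord.\<Phi>_coord[OF coord PiE_mem[OF x]] by (auto simp: \<Psi>_def R_def PiE_def extensional_def)
  qed
  ultimately have "bij_betw \<Psi> (coord_space (Sigma K I)) (\<Pi>\<^sub>E i\<in>K. carrier (V i))"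
    using R_in by (intro bij_betw_byWitness[of _ R]) auto
  then have *: "lin_coord (module_sum K V) (Sigma K I) \<Psi>"
    by unfold_locales
      (auto simp: module_sum_def \<Psi>_def slice lin_coord.\<Phi>_add[OF coord] lin_coord.\<Phi>_scale[OF coord]
        lin_coord.\<Phi>_zero[OF coord] intro!: restrict_ext)
  then show "lin_coord (module_sum K V) (Sigma K I) \<Psi>" .
  interpret M: lin_coord "module_sum K V" "Sigma K I" \<Psi> by (rule *)
  assume ij: "i \<in> K" "j \<in> I i" and T: "\<And>i. i \<in> K \<Longrightarrow> T i \<in> module_hom complex_field (V i) (V i)"
  define x where "x = (\<lambda>k\<in>K. T k (\<Psi> (unit_coord (i, j)) k))"
  have "x \<in> (\<Pi>\<^sub>E k\<in>K. carrier (V k))"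
    using T M.\<Phi>_closed[OF unit_coord_in, of "(i, j)"] ij
    by (fastforce simp: x_def module_sum_def dest: module_hom_closed)
  then have "M.coord x = R x"
    using M.coord_\<Phi>[OF R_in] \<Psi>R by metis
  moreover have "(\<lambda>l. unit_coord (i, j) (i, l)) = unit_coord j"
    by (auto simp: unit_coord_def)
  ultimately show "M.diag_coeff (\<lambda>x. \<lambda>i\<in>K. T i (x i)) (i, j) = lin_coord.diag_coeff (I i) (\<Phi> i) (T i) j"
    using ij by (simp add: M.diag_coeff_def lin_coord.diag_coeff_def[OF coord] flip: x_def)
      (simp add: R_def x_def \<Psi>_def)
qed

section \<open>Unitriangular families of polynomials\<close>

lemma lookup_scale:
  "lookup (single 0 c * f) m = c * lookup f m" for c :: complex
  unfolding mult_map_scale_conv_mult[symmetric] by (simp add: Poly_Mapping.map.rep_eq when_def)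

definition lin_comb :: "('i \<Rightarrow> ('m :: comm_monoid_add) \<Rightarrow>\<^sub>0 complex) \<Rightarrow> ('i \<Rightarrow> complex) \<Rightarrow> 'm \<Rightarrow>\<^sub>0 complex" where
  "lin_comb g c = (\<Sum>i | c i \<noteq> 0. single 0 (c i) * g i)"

lemma lin_comb_superset:
  "finite S \<Longrightarrow> {i. c i \<noteq> 0} \<subseteq> S \<Longrightarrow> lin_comb g c = (\<Sum>i\<in>S. single 0 (c i) * g i)"
  unfolding lin_comb_def by (intro sum.mono_neutral_left) auto

lemma lookup_lin_comb:
  "lookup (lin_comb g c) m = (\<Sum>i | c i \<noteq> 0. c i * lookup (g i) m)"
  by (simp add: lin_comb_def lookup_sum lookup_scale)

lemma lin_comb_add:
  assumes "c \<in> coord_space I" "d \<in> coord_space I"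
  shows "lin_comb g (\<lambda>i. c i + d i) = lin_comb g c + lin_comb g d"
proof -
  have fin: "finite ({i. c i \<noteq> 0} \<union> {i. d i \<noteq> 0})"
    using assms by (simp add: coord_space_def)
  show ?thesis
    by (subst (1 2 3) lin_comb_superset[OF fin]) (auto simp: single_add algebra_simps sum.distrib)
qed

lemma lin_comb_scale: "lin_comb g (\<lambda>i. a * c i) = single 0 a * lin_comb g c"
proof (cases "a = 0")
  case False
  then have "{i. a * c i \<noteq> 0} = {i. c i \<noteq> 0}" by auto
  then show ?thesis
    by (simp add: lin_comb_def sum_distrib_left mult_single flip: mult.assoc)
qed (simp add: lin_comb_def)

lemma lin_comb_zero [simp]: "lin_comb g (\<lambda>_. 0) = 0"
  by (simp add: lin_comb_def)

lemma lin_comb_unit [simp]: "lin_comb g (unit_coord i) = g i"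
  by (simp add: lin_comb_def unit_coord_def)

lemma keys_lin_comb:
  assumes "c \<in> coord_space I" "\<And>i. i \<in> I \<Longrightarrow> keys (g i) \<subseteq> P"
  shows "keys (lin_comb g c) \<subseteq> P"
proof
  fix m assume "m \<in> keys (lin_comb g c)"
  then have "(\<Sum>i | c i \<noteq> 0. c i * lookup (g i) m) \<noteq> 0"
    by (simp add: in_keys_iff lookup_lin_comb)
  then obtain i where "c i \<noteq> 0" "lookup (g i) m \<noteq> 0"
    using sum.not_neutral_contains_not_neutral by force
  then have "i \<in> I" "m \<in> keys (g i)"
    using assms(1) by (auto simp: coord_space_def in_keys_iff)
  then show "m \<in> P"
    using assms(2) by blast
qed

lemma lin_comb_image_sum:
  assumes "\<And>x. x \<in> X \<Longrightarrow> f x \<in> lin_comb g ` coord_space I"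
  shows "(\<Sum>x\<in>X. f x) \<in> lin_comb g ` coord_space I"
  using assms
proof (induction X rule: infinite_finite_induct)
  case (insert x X)
  then have "f x \<in> lin_comb g ` coord_space I" "(\<Sum>x\<in>X. f x) \<in> lin_comb g ` coord_space I"
    by simp_all
  then obtain c d where "c \<in> coord_space I" "d \<in> coord_space I" "f x = lin_comb g c" "(\<Sum>x\<in>X. f x) = lin_comb g d"
    by (elim imageE)
  then have "(\<Sum>x\<in>insert x X. f x) = lin_comb g (\<lambda>i. c i + d i)"
    using insert.hyps lin_comb_add[of c I d g] by simp
  then show ?case
    using \<open>c \<in> coord_space I\<close> \<open>d \<in> coord_space I\<close> by simp
qed (auto intro: image_eqI[of _ _ "\<lambda>_. 0"])

lemma lin_comb_image_scale:
  "f \<in> lin_comb g ` coord_space I \<Longrightarrow> single 0 a * f \<in> lin_comb g ` coord_space I"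
  by (auto simp flip: lin_comb_scale)

lemma poly_mapping_as_sum: "f = (\<Sum>q\<in>keys f. single q (lookup f q))"
proof (rule poly_mapping_eqI)
  fix m
  have "lookup (\<Sum>q\<in>keys f. single q (lookup f q)) m
      = (\<Sum>q\<in>keys f. if q = m then lookup f m else 0)"
    unfolding lookup_sum by (intro sum.cong) (auto simp: lookup_single)
  then show "lookup f m
      = lookup (\<Sum>q\<in>keys f. single q (lookup f q)) m"
    by (auto simp: in_keys_iff)
qed

text \<open>The transition from monomials to the family is unitriangular with respect to
  \<open>rk\<close>. Different leading monomials may have equal rank: all other monomials of a
  member have strictly smaller rank than its leading one, and this suffices for both spanning and
  independence.\<close>

locale unitriangular =
  fixes g :: "'i \<Rightarrow> ('m :: comm_monoid_add) \<Rightarrow>\<^sub>0 complex" and I :: "'i set" and P :: "'m set"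
    and lead :: "'i \<Rightarrow> 'm" and rk :: "'m \<Rightarrow> nat"
  assumes lead: "bij_betw lead I P"
    and lookup_lead: "i \<in> I \<Longrightarrow> lookup (g i) (lead i) = 1"
    and keys_lead: "i \<in> I \<Longrightarrow> keys (g i) \<subseteq> {m \<in> P. m = lead i \<or> rk m < rk (lead i)}"
begin

text \<open>Among the members occurring, take one whose leading monomial has maximal rank. No other
  member contains this monomial: it would be that member's own leading monomial, against
  injectivity, or of smaller rank than it, against maximality. Nothing can cancel it.\<close>

lemma ex_top_term:
  assumes c: "c \<in> coord_space I" "c i \<noteq> 0"
  obtains j where "c j \<noteq> 0" "j \<in> I" "\<And>l. c l \<noteq> 0 \<Longrightarrow> rk (lead l) \<le> rk (lead j)"
    "lookup (lin_comb g c) (lead j) = c j"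
proof -
  have fin: "finite {i. c i \<noteq> 0}" and I: "\<And>l. c l \<noteq> 0 \<Longrightarrow> l \<in> I"
    using c by (auto simp: coord_space_def)
  have "Max ((\<lambda>l. rk (lead l)) ` {i. c i \<noteq> 0}) \<in> (\<lambda>l. rk (lead l)) ` {i. c i \<noteq> 0}"
    using fin c(2) by (intro Max_in) auto
  then obtain j where "c j \<noteq> 0" "rk (lead j) = Max ((\<lambda>l. rk (lead l)) ` {i. c i \<noteq> 0})"
    by auto
  then have j: "c j \<noteq> 0" "\<And>l. c l \<noteq> 0 \<Longrightarrow> rk (lead l) \<le> rk (lead j)"
    using fin by auto
  have "lookup (g l) (lead j) = 0" if "c l \<noteq> 0" "l \<noteq> j" for l
  proof (rule ccontr)
    assume "lookup (g l) (lead j) \<noteq> 0"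
    then have "lead j = lead l \<or> rk (lead j) < rk (lead l)"
      using keys_lead[OF I[OF that(1)]] by (auto simp: in_keys_iff)
    then show False
      using j that I lead by (auto simp: bij_betw_def inj_on_def dest: leD)
  qed
  then have "lookup (lin_comb g c) (lead j) = (\<Sum>l | c l \<noteq> 0. if l = j then c j else 0)"
    unfolding lookup_lin_comb using lookup_lead[OF I[OF j(1)]] by (intro sum.cong) auto
  also have "\<dots> = c j"
    using fin j(1) by simp
  finally show ?thesis
    using that j I by blast
qed

text \<open>The member with leading monomial \<open>m\<close> is solved for \<open>m\<close>; the
  remaining monomials have smaller rank and lie in the span by induction.\<close>

lemma monomial_in_span: "m \<in> P \<Longrightarrow> single m 1 \<in> lin_comb g ` coord_space I"
proof (induction "rk m" arbitrary: m rule: less_induct)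
  case less
  obtain i where i: "i \<in> I" "lead i = m"
    using less.prems lead by (auto simp: bij_betw_def)
  let ?c = "lookup (g i)"
  define h where "h = (\<Sum>q\<in>keys (g i) - {m}. single 0 (- ?c q) * single q 1)"
  have "single m 1 = g i + h"
  proof (rule poly_mapping_eqI)
    fix q
    have "lookup h q = (\<Sum>q'\<in>keys (g i) - {m}. if q' = q then - ?c q else 0)"
      unfolding h_def lookup_sum by (intro sum.cong) (auto simp: mult_single lookup_single)
    also have "\<dots> = (if q = m then 0 else - ?c q)"
      by (auto simp: in_keys_iff)
    finally show "lookup (single m 1) q = lookup (g i + h) q"
      using lookup_lead[OF i(1)] i(2) by (auto simp: lookup_add lookup_single when_def)
  qed
  moreover have "h \<in> lin_comb g ` coord_space I"
    unfolding h_def using less.hyps keys_lead[OF i(1)] i(2)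
    by (intro lin_comb_image_sum lin_comb_image_scale) auto
  then obtain d where "d \<in> coord_space I" "h = lin_comb g d" by blast
  ultimately show ?case
    using lin_comb_add[of "unit_coord i" I d g] i(1) by (intro image_eqI[of _ _ "\<lambda>j. unit_coord i j + d j"]) auto
qed

lemma span: "keys f \<subseteq> P \<Longrightarrow> f \<in> lin_comb g ` coord_space I"
proof -
  assume f: "keys f \<subseteq> P"
  have "f = (\<Sum>q\<in>keys f. single 0 (lookup f q) * single q 1)"
    by (subst poly_mapping_as_sum) (simp add: mult_single)
  also have "\<dots> \<in> lin_comb g ` coord_space I"
    using f by (intro lin_comb_image_sum lin_comb_image_scale monomial_in_span) auto
  finally show ?thesis .
qed

lemma lin_comb_inj: "inj_on (lin_comb g) (coord_space I)"
proof (rule inj_onI)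
  fix c d assume cd: "c \<in> coord_space I" "d \<in> coord_space I" "lin_comb g c = lin_comb g d"
  define e where "e = (\<lambda>i. c i + (-1) * d i)"
  have md: "(\<lambda>i. (-1) * d i) \<in> coord_space I"
    by (rule coord_space_scale[OF cd(2)])
  have e: "e \<in> coord_space I"
    unfolding e_def using cd(1) md by (rule coord_space_add)
  have "lin_comb g e = lin_comb g c + single 0 (-1) * lin_comb g d"
    unfolding e_def lin_comb_add[OF cd(1) md] lin_comb_scale ..
  then have zero: "lookup (lin_comb g e) m = 0" for m
    using cd(3) by (simp add: lookup_add lookup_scale)
  have "e i = 0" for i
  proof (rule ccontr)
    assume "e i \<noteq> 0"
    then show False
      using ex_top_term[OF e] zero by metis
  qed
  then show "c = d"
    by (auto simp: e_def fun_eq_iff)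
qed

lemma lin_coord:
  assumes "carrier V = {f. keys f \<subseteq> P}" "add V = (+)" "\<zero>\<^bsub>V\<^esub> = 0"
    "smult V = (\<lambda>c f. single 0 c * f)"
  shows "lin_coord V I (lin_comb g)"
proof
  show "bij_betw (lin_comb g) (coord_space I) (carrier V)"
    unfolding bij_betw_def assms using lin_comb_inj span keys_lin_comb[of _ I g P] keys_lead by blast
qed (simp_all add: assms lin_comb_add lin_comb_scale)

end

section \<open>Sorting multidegrees\<close>

text \<open>An exchange argument: \<open>A - B\<close> and \<open>B - A\<close> are equinumerous, a
  matching between them increases \<open>f\<close> strictly, and the common part contributes
  equally.\<close>

lemma sum_less_top:
  fixes f :: "'a \<Rightarrow> nat"
  assumes "finite A" "finite B" "card A = card B" "A \<noteq> B"
    and less: "\<And>a b. a \<in> A - B \<Longrightarrow> b \<in> B \<Longrightarrow> f a < f b"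
  shows "sum f A < sum f B"
proof -
  have card: "card (A - B) = card (B - A)"
    using assms(1-3) by (metis card_Diff_subset_Int finite_Int Int_commute)
  then obtain h where h: "bij_betw h (A - B) (B - A)"
    using assms(1,2) by (metis finite_Diff finite_same_card_bij)
  have "A - B \<noteq> {}"
    using assms(1-4) by (metis Diff_eq_empty_iff card_subset_eq)
  then have "sum f (A - B) < (\<Sum>a\<in>A - B. f (h a))"
    using assms(1) less bij_betwE[OF h] by (intro sum_strict_mono) auto
  also have "\<dots> = sum f (B - A)"
    using h by (rule sum.reindex_bij_betw)
  finally have "sum f (A - B) + sum f (A \<inter> B) < sum f (B - A) + sum f (A \<inter> B)"
    by simp
  then show ?thesis
    using sum.Int_Diff[OF assms(1), of f B] sum.Int_Diff[OF assms(2), of f A] by (simp add: Int_commute)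
qed

locale coinvariants =
  fixes n :: nat
  assumes n_pos: "n \<ge> 1"
begin

text \<open>On \<open>{1..n}\<close> the keys compare values first and break ties in favour of smaller indices.\<close>

definition key :: "multidegree \<Rightarrow> nat \<Rightarrow> nat" where
  "key p j = n * lookup p j + (n - j)"

definition sorts :: "(nat \<Rightarrow> nat) \<Rightarrow> multidegree \<Rightarrow> bool" where
  "sorts w p \<longleftrightarrow> w permutes {1..n} \<and> (\<forall>i j. 1 \<le> i \<longrightarrow> i < j \<longrightarrow> j \<le> n \<longrightarrow> key p (w j) < key p (w i))"

lemma key_less_iff:
  assumes "i \<in> {1..n}" "j \<in> {1..n}"
  shows "key p i < key p j \<longleftrightarrow> lookup p i < lookup p j \<or>
    lookup p i = lookup p j \<and> j < i"
proof -
  have *: "key p i < key p j" if "a < b" "i \<in> {1..n}" "j \<in> {1..n}" "a = lookup p i" "b = lookup p j"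
    for a b i j
  proof -
    have "n * a + n \<le> n * b"
      using \<open>a < b\<close> by (metis Suc_leI mult_Suc_right mult_le_mono2 add.commute)
    then show ?thesis
      using that by (auto simp: key_def)
  qed
  show ?thesis
  proof (cases "lookup p i" "lookup p j" rule: linorder_cases)
    case less
    then show ?thesis using *[OF less assms] by auto
  next
    case equal
    then show ?thesis using assms by (auto simp: key_def)
  next
    case greater
    then show ?thesis using *[OF greater assms(2,1)] by auto
  qed
qed

lemma key_inj: "inj_on (key p) {1..n}"
  by (rule inj_onI) (metis key_less_iff less_irrefl linorder_neqE_nat)

lemma ex_sorts: "\<exists>w. sorts w p"
proof -
  define M where "M = key p ` {1..n}"
  have M: "finite M" "card M = n"
    using card_image[OF key_inj] by (auto simp: M_def)
  obtain h where h: "bij_betw h {..<n} M" "strict_mono_on {..<n} h"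
    using ex_bij_betw_strict_mono_card[OF M(1)] M(2) by blast
  define k where "k = the_inv_into {1..n} (key p)"
  have k: "bij_betw k M {1..n}"
    unfolding k_def M_def by (intro bij_betw_the_inv_into inj_on_imp_bij_betw key_inj)
  have r: "bij_betw (\<lambda>i. n - i) {1..n} {..<n}"
    by (rule bij_betw_byWitness[of _ "\<lambda>i. n - i"]) auto
  \<comment> \<open>\<open>h\<close> enumerates the keys in increasing order and \<open>k\<close>
    recovers the index from its key. The reversal \<open>n - i\<close> gives the largest key to
    \<open>w 1\<close>.\<close>
  define w where "w = (\<lambda>i. if i \<in> {1..n} then (k \<circ> h \<circ> (\<lambda>i. n - i)) i else i)"
  have bij: "bij_betw (k \<circ> h \<circ> (\<lambda>i. n - i)) {1..n} {1..n}"
    using bij_betw_trans[OF bij_betw_trans[OF r h(1)] k] by (simp add: comp_assoc)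
  have "w permutes {1..n}"
  proof (rule bij_imp_permutes)
    show "bij_betw w {1..n} {1..n}"
      using bij by (subst bij_betw_cong[of _ _ "k \<circ> h \<circ> (\<lambda>i. n - i)"]) (auto simp: w_def)
  qed (simp only: w_def if_False)
  moreover have "key p (w i) = h (n - i)" if "1 \<le> i" "i \<le> n" for i
  proof -
    have "h (n - i) \<in> key p ` {1..n}"
      using bij_betwE[OF h(1)] that by (simp add: M_def)
    then have "key p (k (h (n - i))) = h (n - i)"
      unfolding k_def by (rule f_the_inv_into_f[OF key_inj])
    then show ?thesis
      using that by (simp add: w_def)
  qed
  moreover have "h (n - j) < h (n - i)" if "1 \<le> i" "i < j" "j \<le> n" for i j
    using h(2) that by (intro strict_mono_onD[OF h(2)]) auto
  ultimately have "sorts w p"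
    unfolding sorts_def by simp
  then show ?thesis by blast
qed

lemma sorts_bij: "sorts w p \<Longrightarrow> bij_betw w {1..n} {1..n}"
  by (simp add: sorts_def permutes_imp_bij)

lemma sorts_in: "sorts w p \<Longrightarrow> i \<in> {1..n} \<Longrightarrow> w i \<in> {1..n}"
  by (metis sorts_def permutes_in_image)

text \<open>Keys are pairwise distinct, and the index in place \<open>i\<close> is the one whose key
  is matched or exceeded by exactly \<open>i\<close> keys, itself included.\<close>

lemma sorts_unique:
  assumes "sorts w p" "sorts v p"
  shows "w = v"
proof -
  have rank: "card {j \<in> {1..n}. key p (u i) \<le> key p j} = i" if u: "sorts u p" and i: "i \<in> {1..n}" for u i
  proof -
    have "{j \<in> {1..n}. key p (u i) \<le> key p j} = u ` {1..i}"
    proof (intro equalityI subsetI)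
      fix j assume "j \<in> {j \<in> {1..n}. key p (u i) \<le> key p j}"
      then have "j \<in> u ` {1..n}" "key p (u i) \<le> key p j"
        using sorts_bij[OF u] by (auto simp: bij_betw_def)
      then obtain l where l: "l \<in> {1..n}" "j = u l" "key p (u i) \<le> key p (u l)"
        by blast
      then have "l \<le> i"
        using u i unfolding sorts_def by (metis atLeastAtMost_iff leD not_le)
      then show "j \<in> u ` {1..i}"
        using l by auto
    next
      fix j assume "j \<in> u ` {1..i}"
      then obtain l where l: "l \<in> {1..i}" "j = u l" by blast
      then have "key p (u i) \<le> key p (u l)"
        using u i unfolding sorts_def by (cases "l = i") (auto intro: less_imp_le)
      then show "j \<in> {j \<in> {1..n}. key p (u i) \<le> key p j}"
        using l i sorts_in[OF u, of l] by auto
    qed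
    moreover have "inj_on u {1..i}"
      using sorts_bij[OF u] i by (auto simp: bij_betw_def intro: inj_on_subset)
    ultimately show ?thesis
      by (simp add: card_image)
  qed
  have "w i = v i" if i: "i \<in> {1..n}" for i
  proof -
    obtain l where l: "l \<in> {1..n}" "w i = v l"
      using sorts_bij[OF assms(2)] sorts_in[OF assms(1) i] by (metis bij_betw_def imageE)
    then have "l = i"
      using rank[OF assms(1) i] rank[OF assms(2) l(1)] by simp
    then show ?thesis using l by simp
  qed
  then show ?thesis
    using assms unfolding sorts_def permutes_def by (intro ext) metis
qed

definition srt :: "multidegree \<Rightarrow> nat \<Rightarrow> nat" where
  "srt p = (THE w. sorts w p)"

lemma sorts_srt: "sorts (srt p) p"
  unfolding srt_def using ex_sorts sorts_unique by (metis theI)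

lemma srt_eq: "sorts w p \<Longrightarrow> srt p = w"
  using sorts_srt sorts_unique by blast

text \<open>Equal exponents are listed by increasing index. Consequently a descent of
  \<open>w\<close> forces a strict drop of the exponents at that place, the property on which the
  decomposition into descents and weights depends.\<close>

lemma sorts_iff:
  "sorts w p \<longleftrightarrow> w permutes {1..n} \<and> (\<forall>i j. 1 \<le> i \<longrightarrow> i < j \<longrightarrow> j \<le> n \<longrightarrow>
     lookup p (w j) < lookup p (w i) \<or>
     lookup p (w j) = lookup p (w i) \<and> w i < w j)"
proof (cases "w permutes {1..n}")
  case True
  then have "w i \<in> {1..n} \<longleftrightarrow> i \<in> {1..n}" for i
    by (rule permutes_in_image)
  then have "key p (w j) < key p (w i) \<longleftrightarrow> lookup p (w j) < lookup p (w i) \<or>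
     lookup p (w j) = lookup p (w i) \<and> w i < w j"
    if "1 \<le> i" "i < j" "j \<le> n" for i j
    using that by (intro key_less_iff) auto
  then show ?thesis
    unfolding sorts_def by blast
qed (simp add: sorts_def)

section \<open>Sets of the largest exponents and the rank they define\<close>

definition top_set :: "(nat \<Rightarrow> nat) \<Rightarrow> nat \<Rightarrow> nat set" where
  "top_set w s = w ` {1..s}"

lemma card_top: "w permutes {1..n} \<Longrightarrow> card (top_set w s) = s"
  unfolding top_set_def by (subst card_image) (auto intro: inj_on_subset[OF permutes_inj])

lemma finite_top [simp]: "finite (top_set w s)"
  by (simp add: top_set_def)

lemma top_set_subset: "w permutes {1..n} \<Longrightarrow> s \<le> n \<Longrightarrow> top_set w s \<subseteq> {1..n}"
  unfolding top_set_def using permutes_in_image by fastforce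

definition top_sum :: "(nat \<Rightarrow> nat) \<Rightarrow> multidegree \<Rightarrow> nat \<Rightarrow> nat" where
  "top_sum w p s = sum (key p) (top_set w s)"

text \<open>Distinct keys make the set of the \<open>s\<close> largest ones the unique maximizer, by
  exchange against any other set of the same size.\<close>

lemma sum_key_less:
  assumes "D \<subseteq> {1..n}" "card D = s" "D \<noteq> top_set (srt p) s"
  shows "sum (key p) D < top_sum (srt p) p s"
  unfolding top_sum_def
proof (rule sum_less_top)
  have w: "srt p permutes {1..n}"
    using sorts_srt by (simp add: sorts_def)
  have s: "s \<le> n"
    using assms(1,2) card_mono[of "{1..n}" D] by simp
  show "card D = card (top_set (srt p) s)"
    using card_top[OF w] assms(2) by simp
  fix a b assume "a \<in> D - top_set (srt p) s" "b \<in> top_set (srt p) s"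
  then have "a \<in> srt p ` {1..n}" "b \<in> srt p ` {1..s}"
    using assms(1) sorts_bij[OF sorts_srt[of p]] by (auto simp: top_set_def bij_betw_def)
  then obtain i j where ij: "i \<in> {1..n}" "a = srt p i" "j \<in> {1..s}" "b = srt p j"
    by blast
  moreover have "\<not> i \<le> s"
    using ij \<open>a \<in> D - top_set (srt p) s\<close> by (auto simp: top_set_def)
  ultimately show "key p a < key p b"
    using sorts_srt[of p] s unfolding sorts_def by auto
qed (use assms finite_subset in auto)

lemma sum_key_le:
  assumes "D \<subseteq> {1..n}" "card D = s"
  shows "sum (key p) D \<le> top_sum (srt p) p s"
  using sum_key_less[OF assms, of p] by (cases "D = top_set (srt p) s") (auto simp: top_sum_def less_imp_le)

text \<open>The rank measures monomials in such a way that multiplication by an elementary symmetric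
  polynomial has a unique leading term.\<close>

definition rank :: "multidegree \<Rightarrow> nat" where
  "rank p = (\<Sum>s=1..n. top_sum (srt p) p s)"

definition chi :: "nat set \<Rightarrow> multidegree" where
  "chi C = (\<Sum>j\<in>C. single j 1)"

lemma lookup_chi: "finite C \<Longrightarrow> lookup (chi C) j = (if j \<in> C then 1 else 0)"
  by (simp add: chi_def lookup_sum lookup_single when_def)

lemma keys_chi: "finite C \<Longrightarrow> keys (chi C) = C"
  by (auto simp: in_keys_iff lookup_chi split: if_splits)

lemma sum_key_chi:
  assumes "finite C" "finite D"
  shows "sum (key (p + chi C)) D = sum (key p) D + n * card (C \<inter> D)"
proof -
  have "sum (key (p + chi C)) D = (\<Sum>j\<in>D. key p j + n * (if j \<in> C then 1 else 0))"
    by (simp add: key_def lookup_add lookup_chi assms(1) algebra_simps)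
  also have "\<dots> = sum (key p) D + n * (\<Sum>j\<in>D. if j \<in> C then 1 else 0)"
    by (simp only: sum.distrib sum_distrib_left)
  also have "(\<Sum>j\<in>D. if j \<in> C then 1 else 0) = card (C \<inter> D)"
    using assms(2) by (simp add: sum.If_cases Int_commute Int_def)
  finally show ?thesis .
qed

text \<open>The new top sum is an old key sum over some set of size \<open>s\<close> plus
  \<open>n\<close> for every element shared with \<open>C\<close>. Each part has its own upper
  bound, so equality of the total forces both to be extremal.\<close>

lemma top_chi:
  fixes p C
  assumes C: "C \<subseteq> {1..n}" and s: "s \<in> {1..n}"
  defines "u \<equiv> srt (p + chi C)"
  shows "top_sum u (p + chi C) s \<le> top_sum (srt p) p s + n * min (card C) s"
    and "top_sum u (p + chi C) s = top_sum (srt p) p s + n * min (card C) s \<Longrightarrow>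
      top_set u s = top_set (srt p) s \<and> card (C \<inter> top_set u s) = min (card C) s"
proof -
  have u: "u permutes {1..n}"
    using sorts_srt by (simp add: u_def sorts_def)
  have fin: "finite C"
    using C finite_subset by blast
  have D: "top_set u s \<subseteq> {1..n}" "card (top_set u s) = s"
    using top_set_subset[OF u] card_top[OF u] s by auto
  have eq: "top_sum u (p + chi C) s = sum (key p) (top_set u s) + n * card (C \<inter> top_set u s)"
    unfolding top_sum_def using fin by (simp add: sum_key_chi)
  have le1: "sum (key p) (top_set u s) \<le> top_sum (srt p) p s"
    by (rule sum_key_le[OF D])
  have "card (C \<inter> top_set u s) \<le> min (card C) s"
    using D(2) fin by (metis Int_lower1 Int_lower2 card_mono finite_top min.bounded_iff)
  then have le2: "n * card (C \<inter> top_set u s) \<le> n * min (card C) s"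
    by simp
  show "top_sum u (p + chi C) s \<le> top_sum (srt p) p s + n * min (card C) s"
    using eq le1 le2 by linarith
  assume "top_sum u (p + chi C) s = top_sum (srt p) p s + n * min (card C) s"
  then have "sum (key p) (top_set u s) = top_sum (srt p) p s" "n * card (C \<inter> top_set u s) = n * min (card C) s"
    using eq le1 le2 by linarith+
  then show "top_set u s = top_set (srt p) s \<and> card (C \<inter> top_set u s) = min (card C) s"
    using sum_key_less[OF D, of p] n_pos by auto
qed

lemma rank_chi_le:
  assumes "C \<subseteq> {1..n}"
  shows "rank (p + chi C) \<le> rank p + (\<Sum>s=1..n. n * min (card C) s)"
  unfolding rank_def sum.distrib[symmetric] using assms by (intro sum_mono top_chi)

text \<open>The loss occurs at \<open>s = card C\<close>: equality there would make the new top set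
  equal to the old one and also contain \<open>C\<close>, hence equal to \<open>C\<close> by
  cardinality.\<close>

lemma rank_chi_less:
  assumes C: "C \<subseteq> {1..n}" "C \<noteq> {}" "C \<noteq> top_set (srt p) (card C)"
  shows "rank (p + chi C) < rank p + (\<Sum>s=1..n. n * min (card C) s)"
proof -
  have fin: "finite C"
    using C finite_subset by blast
  have s: "card C \<in> {1..n}"
    using C card_mono[of "{1..n}" C] fin by (auto simp: Suc_le_eq card_gt_0_iff)
  define u where "u = srt (p + chi C)"
  have u: "u permutes {1..n}"
    using sorts_srt by (simp add: u_def sorts_def)
  have "top_sum u (p + chi C) (card C) \<noteq> top_sum (srt p) p (card C) + n * min (card C) (card C)"
  proof
    assume "top_sum u (p + chi C) (card C) = top_sum (srt p) p (card C) + n * min (card C) (card C)"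
    then have "top_set u (card C) = top_set (srt p) (card C) \<and> card (C \<inter> top_set u (card C)) = min (card C) (card C)"
      unfolding u_def by (rule top_chi(2)[OF C(1) s, of p])
    then have "top_set u (card C) = top_set (srt p) (card C)" "card (C \<inter> top_set u (card C)) = card C"
      by (metis min.idem)+
    moreover have "C \<inter> top_set u (card C) = C"
      using fin calculation(2) by (intro card_subset_eq) auto
    ultimately have "C = top_set (srt p) (card C)"
      using card_top[OF u, of "card C"] card_subset_eq[of "top_set u (card C)" C] by auto
    then show False using C(3) by blast
  qed
  then have "top_sum u (p + chi C) (card C) < top_sum (srt p) p (card C) + n * min (card C) (card C)"
    using top_chi(1)[OF C(1) s, of p] by (simp add: u_def)
  then show ?thesis
    unfolding rank_def sum.distrib[symmetric] using C(1) s top_chi(1)[OF C(1), of _ p]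
    by (intro sum_strict_mono_ex1 ballI bexI[of _ "card C"]) (auto simp: u_def)
qed

text \<open>Raising the \<open>r\<close> largest keys by the same amount keeps the order of all
  keys.\<close>

lemma srt_chi_top:
  assumes "r \<le> n"
  shows "srt (p + chi (top_set (srt p) r)) = srt p"
proof (rule srt_eq)
  have w: "srt p permutes {1..n}"
    using sorts_srt by (simp add: sorts_def)
  have mem: "srt p j \<in> top_set (srt p) r \<longleftrightarrow> j \<in> {1..r}" for j
    unfolding top_set_def using permutes_inj[OF w] by (simp add: inj_image_mem_iff)
  have "key (p + chi (top_set (srt p) r)) (srt p j) = key p (srt p j) + (if j \<in> {1..r} then n else 0)" for j
    using mem[of j] by (simp add: key_def lookup_add lookup_chi algebra_simps)
  then show "sorts (srt p) (p + chi (top_set (srt p) r))"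
    using sorts_srt[of p] unfolding sorts_def by (auto intro: add_less_le_mono trans_less_add1)
qed

lemma rank_chi_top:
  assumes "r \<le> n"
  shows "rank (p + chi (top_set (srt p) r)) = rank p + (\<Sum>s=1..n. n * min r s)"
  unfolding rank_def sum.distrib[symmetric] srt_chi_top[OF assms]
proof (rule sum.cong)
  fix s assume "s \<in> {1..n}"
  have w: "srt p permutes {1..n}"
    using sorts_srt by (simp add: sorts_def)
  have "top_set (srt p) r \<inter> top_set (srt p) s = top_set (srt p) (min r s)"
    unfolding top_set_def using image_Int[OF permutes_inj[OF w], of "{1..r}" "{1..s}"]
    by (simp add: min_def)
  then show "top_sum (srt p) (p + chi (top_set (srt p) r)) s = top_sum (srt p) p s + n * min r s"
    by (simp add: top_sum_def sum_key_chi card_top[OF w])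
qed simp

section \<open>A filtered basis of the polynomial ring\<close>

abbreviation mono :: "multidegree \<Rightarrow> mpoly" where
  "mono p \<equiv> single p 1"

definition esym :: "nat \<Rightarrow> mpoly" where
  "esym r = (\<Sum>C | C \<subseteq> {1..n} \<and> card C = r. mono (chi C))"

definition eprod :: "(nat \<Rightarrow> nat) \<Rightarrow> mpoly" where
  "eprod \<nu> = (\<Prod>j=1..n. esym j ^ \<nu> j)"

definition des :: "(nat \<Rightarrow> nat) \<Rightarrow> nat \<Rightarrow> nat" where
  "des w j = (if j < n \<and> w (Suc j) < w j then 1 else 0)"

text \<open>The exponent whose layers are the top sets of \<open>w\<close>, the one of size
  \<open>j\<close> occurring \<open>\<nu> j + des w j\<close> times. For \<open>\<nu> = 0\<close> it
  is the exponent of the Garsia-Stanton descent monomial of \<open>w\<close>.\<close>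

definition expo :: "(nat \<Rightarrow> nat) \<Rightarrow> (nat \<Rightarrow> nat) \<Rightarrow> multidegree" where
  "expo w \<nu> = (\<Sum>j=1..n. \<Sum>_<\<nu> j + des w j. chi (top_set w j))"

definition level :: "(nat \<Rightarrow> nat) \<Rightarrow> (nat \<Rightarrow> nat) \<Rightarrow> nat" where
  "level w \<nu> = (\<Sum>j=1..n. \<nu> j + des w j)"

definition weights :: "(nat \<Rightarrow> nat) set" where
  "weights = {\<nu>. \<forall>j. j \<notin> {1..n} \<longrightarrow> \<nu> j = 0}"

definition indices :: "((nat \<Rightarrow> nat) \<times> (nat \<Rightarrow> nat)) set" where
  "indices = {w. w permutes {1..n}} \<times> weights"

definition bounded :: "nat \<Rightarrow> multidegree set" where
  "bounded k = {p \<in> multidegrees n. \<forall>i. lookup p i \<le> k}"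

definition basis_poly :: "(nat \<Rightarrow> nat) \<times> (nat \<Rightarrow> nat) \<Rightarrow> mpoly" where
  "basis_poly = (\<lambda>(w, \<nu>). eprod \<nu> * mono (expo w (\<lambda>_. 0)))"

lemma finite_subsets [simp]: "finite {C. C \<subseteq> {1..n} \<and> card C = r}"
  by (rule finite_subset[of _ "Pow {1..n}"]) auto

lemma lookup_expo:
  assumes w: "w permutes {1..n}" and i: "i \<in> {1..n}"
  shows "lookup (expo w \<nu>) (w i) = (\<Sum>j=i..n. \<nu> j + des w j)"
proof -
  have "w i \<in> top_set w j \<longleftrightarrow> i \<le> j" for j
    unfolding top_set_def using i permutes_inj[OF w] by (simp add: inj_image_mem_iff)
  then have "lookup (expo w \<nu>) (w i) = (\<Sum>j=1..n. if i \<le> j then \<nu> j + des w j else 0)"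
    unfolding expo_def lookup_sum by (intro sum.cong) (auto simp: lookup_chi)
  also have "\<dots> = (\<Sum>j=i..n. \<nu> j + des w j)"
    using i by (intro sum.mono_neutral_cong_right) auto
  finally show ?thesis .
qed

lemma expo_in_multidegrees:
  assumes "w permutes {1..n}"
  shows "expo w \<nu> \<in> multidegrees n"
proof -
  have "lookup (expo w \<nu>) k = 0" if "k \<notin> {1..n}" for k
    unfolding expo_def lookup_sum using that
    by (intro sum.neutral ballI) (auto simp: lookup_chi dest: subsetD[OF top_set_subset[OF assms]])
  then have "keys (expo w \<nu>) \<subseteq> {1..n}"
    by (metis in_keys_iff subsetI)
  then show ?thesis
    by (simp add: multidegrees_def)
qed

text \<open>Exponents decrease weakly along \<open>w\<close>, so the largest one belongs to
  \<open>w 1\<close>, which lies in every layer; it counts all layers and equals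
  \<open>level w \<nu>\<close>.\<close>

lemma expo_bounded:
  assumes w: "w permutes {1..n}"
  shows "expo w \<nu> \<in> bounded k \<longleftrightarrow> level w \<nu> \<le> k"
proof
  assume "expo w \<nu> \<in> bounded k"
  then have "lookup (expo w \<nu>) (w 1) \<le> k"
    by (simp add: bounded_def)
  then show "level w \<nu> \<le> k"
    using lookup_expo[OF w, of 1] n_pos by (simp add: level_def)
next
  assume le: "level w \<nu> \<le> k"
  have "lookup (expo w \<nu>) l \<le> k" for l
  proof (cases "l \<in> {1..n}")
    case True
    then obtain i where i: "i \<in> {1..n}" "l = w i"
      using permutes_image[OF w] by blast
    have "(\<Sum>j=i..n. \<nu> j + des w j) \<le> level w \<nu>"
      unfolding level_def using i by (intro sum_mono2) auto
    then show ?thesis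
      using lookup_expo[OF w i(1)] i(2) le by simp
  next
    case False
    then have "l \<notin> keys (expo w \<nu>)"
      using expo_in_multidegrees[OF w, of \<nu>] unfolding multidegrees_def by blast
    then show ?thesis
      by (simp add: in_keys_iff)
  qed
  then show "expo w \<nu> \<in> bounded k"
    using expo_in_multidegrees[OF w] by (simp add: bounded_def)
qed

lemma sorts_adjacent:
  assumes w: "w permutes {1..n}"
    and less: "\<And>i. 1 \<le> i \<Longrightarrow> i < n \<Longrightarrow> key p (w (Suc i)) < key p (w i)"
  shows "sorts w p"
proof -
  have "key p (w j) < key p (w i)" if "1 \<le> i" "i < j" "j \<le> n" for i j
    using that(2,3)
  proof (induction j)
    case (Suc j)
    then show ?case
      using less[of j] \<open>1 \<le> i\<close> by (cases "i = j") auto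
  qed simp
  then show ?thesis
    using w by (simp add: sorts_def)
qed

text \<open>At a descent of \<open>w\<close> the exponent drops by at least one. At an ascent it may
  stay equal, and then the tie is broken in favour of the smaller index, again as \<open>w\<close>
  has it.\<close>

lemma srt_expo:
  assumes w: "w permutes {1..n}"
  shows "srt (expo w \<nu>) = w"
proof (rule srt_eq, rule sorts_adjacent[OF w])
  fix i assume i: "1 \<le> i" "i < n"
  have "lookup (expo w \<nu>) (w i) = \<nu> i + des w i + lookup (expo w \<nu>) (w (Suc i))"
    using i sum.atLeast_Suc_atMost[of i n "\<lambda>j. \<nu> j + des w j"]
      lookup_expo[OF w, of i \<nu>] lookup_expo[OF w, of "Suc i" \<nu>] by simp
  moreover have "w i \<noteq> w (Suc i)"
    by (simp add: inj_eq[OF permutes_inj[OF w]])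
  moreover have "w i \<in> {1..n}" "w (Suc i) \<in> {1..n}"
    using permutes_in_image[OF w] i by auto
  ultimately show "key (expo w \<nu>) (w (Suc i)) < key (expo w \<nu>) (w i)"
    using i by (subst key_less_iff) (auto simp: des_def)
qed

text \<open>Sorting the exponent recovers \<open>w\<close>; the differences of consecutive sorted
  exponents, less the descents, recover \<open>\<nu>\<close>.\<close>

lemma expo_inj: "inj_on (\<lambda>(w, \<nu>). expo w \<nu>) indices"
proof (rule inj_onI, clarify)
  fix w \<nu> v \<mu> assume "(w, \<nu>) \<in> indices" "(v, \<mu>) \<in> indices" and eq: "expo w \<nu> = expo v \<mu>"
  then have w: "w permutes {1..n}" and v: "v permutes {1..n}" and wt: "\<nu> \<in> weights" "\<mu> \<in> weights"
    by (auto simp: indices_def)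
  have wv: "w = v"
    using srt_expo[OF w] srt_expo[OF v] eq by metis
  have "(\<Sum>j=i..n. \<nu> j + des w j) = (\<Sum>j=i..n. \<mu> j + des w j)" if "i \<in> {1..Suc n}" for i
    using lookup_expo[OF w, of i \<nu>] lookup_expo[OF v, of i \<mu>] eq wv that by (cases "i = Suc n") auto
  note S = this
  have "\<nu> i = \<mu> i" for i
  proof (cases "i \<in> {1..n}")
    case True
    then show ?thesis
      using S[of i] S[of "Suc i"] by (simp add: sum.atLeast_Suc_atMost)
  next
    case False
    then show ?thesis
      using wt by (simp add: weights_def)
  qed
  then show "w = v \<and> \<nu> = \<mu>"
    using wv by auto
qed

lemma expo_surj:
  assumes p: "p \<in> multidegrees n"
  obtains w \<nu> where "(w, \<nu>) \<in> indices" "p = expo w \<nu>"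
proof -
  define w where "w = srt p"
  have sorts: "sorts w p" and w: "w permutes {1..n}"
    using sorts_srt by (auto simp: w_def sorts_def)
  define S where "S i = (if i \<le> n then lookup p (w i) else 0)" for i
  \<comment> \<open>Each drop of the sorted exponents is reduced by one at a descent. The
    subtraction of naturals is never truncated, since the tie-breaking makes drops at descents
    positive; \<open>S (Suc n) = 0\<close> turns the last exponent into a drop as well.\<close>
  define \<nu> where "\<nu> i = (if i \<in> {1..n} then S i - S (Suc i) - des w i else 0)" for i
  have step: "\<nu> i + des w i + S (Suc i) = S i" if i: "i \<in> {1..n}" for i
  proof -
    have "S (Suc i) + des w i \<le> S i"
      using sorts i unfolding sorts_iff S_def des_def by fastforce
    then show ?thesis
      using i by (simp add: \<nu>_def)
  qed
  have sum: "(\<Sum>j=i..n. \<nu> j + des w j) = S i" if "1 \<le> i" "i \<le> Suc n" for i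
    using that(2,1)
  proof (induction i rule: inc_induct)
    case base
    show ?case by (simp add: S_def)
  next
    case (step i)
    then show ?case
      using \<open>\<And>i. i \<in> {1..n} \<Longrightarrow> \<nu> i + des w i + S (Suc i) = S i\<close>[of i] by (simp add: sum.atLeast_Suc_atMost)
  qed
  have "p = expo w \<nu>"
  proof (rule poly_mapping_eqI)
    fix l
    show "lookup p l = lookup (expo w \<nu>) l"
    proof (cases "l \<in> {1..n}")
      case True
      then obtain i where i: "i \<in> {1..n}" "l = w i"
        using permutes_image[OF w] by blast
      then show ?thesis
        using lookup_expo[OF w i(1), of \<nu>] sum[of i] by (simp add: S_def)
    next
      case False
      then have "l \<notin> keys (expo w \<nu>)" "l \<notin> keys p"
        using expo_in_multidegrees[OF w, of \<nu>] p unfolding multidegrees_def by blast+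
      then show ?thesis
        by (simp add: in_keys_iff)
    qed
  qed
  moreover have "(w, \<nu>) \<in> indices"
    using w by (simp add: indices_def weights_def \<nu>_def)
  ultimately show ?thesis
    using that by blast
qed

section \<open>Leading terms of products with elementary symmetric polynomials\<close>

definition leads :: "nat \<Rightarrow> mpoly \<Rightarrow> multidegree \<Rightarrow> bool" where
  "leads k f p \<longleftrightarrow> lookup f p = 1 \<and>
     keys f \<subseteq> {q \<in> bounded k. q = p \<or> rank q < rank p}"

lemma bounded_chi:
  assumes "q \<in> bounded k" "C \<subseteq> {1..n}"
  shows "chi C + q \<in> bounded (Suc k)"
proof -
  have fin: "finite C"
    using assms(2) by (rule finite_subset) simp
  have "keys (chi C + q) \<subseteq> {1..n}"
    using keys_add[of "chi C" q] assms unfolding keys_chi[OF fin] bounded_def multidegrees_def by blast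
  moreover have "lookup (chi C + q) i \<le> Suc k" for i
    using assms(1) by (simp add: bounded_def lookup_add lookup_chi[OF fin] le_SucI)
  ultimately show ?thesis
    by (simp add: bounded_def multidegrees_def)
qed

lemma lookup_mono_times: "lookup (mono c * f) (c + q) = lookup f q"
  by (simp add: lookup_mult lookup_single when_mult)

text \<open>Every monomial of the product is \<open>chi C + q\<close> with
  \<open>card C = j\<close>, and the possible gain of rank depends on \<open>j\<close> only. If
  \<open>q\<close> is not \<open>p\<close>, it starts with smaller rank; if it is \<open>p\<close>
  and \<open>C\<close> is not the top set, the gain is not fully realized. Only one pair reaches the
  maximum, so there is no cancellation.\<close>

lemma leads_esym:
  assumes f: "leads k f p" and j: "j \<in> {1..n}"
  shows "leads (Suc k) (esym j * f) (p + chi (top_set (srt p) j))"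
proof -
  define T where "T = top_set (srt p) j"
  have srt: "srt p permutes {1..n}"
    using sorts_srt by (simp add: sorts_def)
  have T: "T \<subseteq> {1..n}" "card T = j"
    using top_set_subset[OF srt] card_top[OF srt] j by (auto simp: T_def)
  have rank_T: "rank (p + chi T) = rank p + (\<Sum>s=1..n. n * min j s)"
    using rank_chi_top j by (simp add: T_def)
  have fin: "C \<subseteq> {1..n} \<Longrightarrow> finite C" for C
    by (auto intro: finite_subset)
  have lower: "rank (chi C + q) < rank (p + chi T)"
    if "C \<subseteq> {1..n}" "card C = j" "q \<in> keys f" "q \<noteq> p \<or> C \<noteq> T" for C q
  proof (cases "q = p")
    case True
    then have "C \<noteq> {}" "C \<noteq> top_set (srt p) (card C)"
      using that j by (auto simp: T_def)
    then show ?thesis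
      using rank_chi_less[OF that(1), of p] that(2) True by (simp add: rank_T add.commute)
  next
    case False
    then have "rank q < rank p"
      using that(3) f by (auto simp: leads_def)
    then show ?thesis
      using rank_chi_le[OF that(1), of q] that(2) by (simp add: rank_T add.commute)
  qed
  have keys: "\<exists>C q. C \<subseteq> {1..n} \<and> card C = j \<and> q \<in> keys f \<and> P = chi C + q"
    if "P \<in> keys (esym j * f)" for P
  proof -
    have "P \<in> (\<Union>C\<in>{C. C \<subseteq> {1..n} \<and> card C = j}. keys (mono (chi C) * f))"
      using subsetD[OF keys_sum that[unfolded esym_def sum_distrib_right]] .
    then obtain C where C: "C \<subseteq> {1..n}" "card C = j" "P \<in> keys (mono (chi C) * f)"
      by blast
    then obtain q where "q \<in> keys f" "P = chi C + q"
      using keys_mult[of "mono (chi C)" f] by auto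
    with C show ?thesis by blast
  qed
  have "lookup (esym j * f) (p + chi T)
      = (\<Sum>C | C \<subseteq> {1..n} \<and> card C = j. if C = T then 1 else 0)"
    unfolding esym_def sum_distrib_right lookup_sum
  proof (intro sum.cong refl)
    fix C assume C: "C \<in> {C. C \<subseteq> {1..n} \<and> card C = j}"
    show "lookup (mono (chi C) * f) (p + chi T) = (if C = T then 1 else 0)"
    proof (cases "C = T")
      case True
      then show ?thesis
        using lookup_mono_times[of "chi T" f p] f by (simp add: leads_def add.commute)
    next
      case False
      have "p + chi T \<notin> keys (mono (chi C) * f)"
      proof
        assume "p + chi T \<in> keys (mono (chi C) * f)"
        then obtain q where "q \<in> keys f" "p + chi T = chi C + q"
          using keys_mult[of "mono (chi C)" f] by auto
        then show False
          using lower[of C q] C False by simp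
      qed
      then show ?thesis
        using False by (simp add: in_keys_iff)
    qed
  qed
  also have "\<dots> = 1"
    using T by simp
  finally have one: "lookup (esym j * f) (p + chi T) = 1" .
  have "P \<in> {q \<in> bounded (Suc k). q = p + chi T \<or> rank q < rank (p + chi T)}"
    if P: "P \<in> keys (esym j * f)" for P
  proof -
    obtain C q where Cq: "C \<subseteq> {1..n}" "card C = j" "q \<in> keys f" "P = chi C + q"
      using keys[OF P] by blast
    moreover have "q \<in> bounded k"
      using Cq(3) f by (auto simp: leads_def)
    ultimately show ?thesis
      using lower[OF Cq(1-3)] bounded_chi[of q k C] by (auto simp: add.commute)
  qed
  then show ?thesis
    using one by (auto simp: leads_def T_def)
qed

lemma expo_step:
  assumes "j \<in> {1..n}"
  shows "expo w (\<nu>(j := Suc (\<nu> j))) = expo w \<nu> + chi (top_set w j)"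
proof -
  have "expo w (\<nu>(j := Suc (\<nu> j))) = (\<Sum>i=1..n. (\<Sum>_<\<nu> i + des w i. chi (top_set w i)) + (if i = j then chi (top_set w j) else 0))"
    unfolding expo_def by (intro sum.cong) (auto simp: algebra_simps)
  then show ?thesis
    using assms by (simp add: sum.distrib expo_def)
qed

lemma level_step:
  assumes "j \<in> {1..n}"
  shows "level w (\<nu>(j := Suc (\<nu> j))) = Suc (level w \<nu>)"
proof -
  have "level w (\<nu>(j := Suc (\<nu> j))) = (\<Sum>i=1..n. \<nu> i + des w i + (if i = j then 1 else 0))"
    unfolding level_def by (intro sum.cong) auto
  then show ?thesis
    using assms by (simp add: sum.distrib level_def)
qed

lemma eprod_add: "eprod (\<lambda>j. \<nu> j + \<mu> j) = eprod \<nu> * eprod \<mu>"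
  by (simp add: eprod_def power_add prod.distrib)

lemma eprod_zero [simp]: "eprod (\<lambda>_. 0) = 1"
  by (simp add: eprod_def)

lemma eprod_step:
  assumes "j \<in> {1..n}"
  shows "eprod (\<nu>(j := Suc (\<nu> j))) = esym j * eprod \<nu>"
proof -
  have "eprod (\<nu>(j := Suc (\<nu> j))) = (\<Prod>i=1..n. esym i ^ \<nu> i * (if i = j then esym j else 1))"
    unfolding eprod_def by (intro prod.cong) auto
  then show ?thesis
    using assms by (simp add: prod.distrib eprod_def)
qed

lemma weights_induct [consumes 1, case_names zero step]:
  assumes "\<nu> \<in> weights" and "P (\<lambda>_. 0)"
    and "\<And>\<nu> j. \<nu> \<in> weights \<Longrightarrow> j \<in> {1..n} \<Longrightarrow> P \<nu> \<Longrightarrow> P (\<nu>(j := Suc (\<nu> j)))"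
  shows "P \<nu>"
  using assms(1)
proof (induction "\<Sum>j=1..n. \<nu> j" arbitrary: \<nu> rule: less_induct)
  case less
  show ?case
  proof (cases "\<nu> = (\<lambda>_. 0)")
    case False
    then obtain j where j: "\<nu> j \<noteq> 0" by auto
    then have jn: "j \<in> {1..n}"
      using less.prems by (auto simp: weights_def)
    define \<mu> where "\<mu> = \<nu>(j := \<nu> j - 1)"
    have "(\<Sum>i=1..n. \<mu> i) < (\<Sum>i=1..n. \<nu> i)"
      using j jn by (intro sum_strict_mono_ex1) (auto simp: \<mu>_def)
    moreover have "\<mu> \<in> weights"
      using less.prems by (auto simp: \<mu>_def weights_def)
    moreover have "\<nu> = \<mu>(j := Suc (\<mu> j))"
      using j by (auto simp: \<mu>_def)
    ultimately show ?thesis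
      using less.hyps assms(3) jn by metis
  qed (simp add: assms(2))
qed

text \<open>Induction on \<open>\<nu>\<close>. Sorting the current leading exponent always gives
  back \<open>w\<close>, so each factor \<open>esym j\<close> adds precisely the layer
  \<open>top_set w j\<close> and one unit of level.\<close>

lemma leads_basis_poly:
  assumes w: "w permutes {1..n}" and "\<nu> \<in> weights"
  shows "leads (level w \<nu>) (basis_poly (w, \<nu>)) (expo w \<nu>)"
  using assms(2)
proof (induction rule: weights_induct)
  case zero
  show ?case
    using expo_bounded[OF w, of "\<lambda>_. 0" "level w (\<lambda>_. 0)"] by (simp add: leads_def basis_poly_def)
next
  case (step \<nu> j)
  have "leads (Suc (level w \<nu>)) (esym j * basis_poly (w, \<nu>)) (expo w \<nu> + chi (top_set w j))"
    using leads_esym[OF step(3,2)] by (simp only: srt_expo[OF w])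
  moreover have "basis_poly (w, \<nu>(j := Suc (\<nu> j))) = esym j * basis_poly (w, \<nu>)"
    unfolding basis_poly_def case_prod_conv eprod_step[OF step(2)] by (rule mult.assoc)
  ultimately show ?case
    unfolding expo_step[OF step(2)] level_step[OF step(2)] by (simp only:)
qed

lemma bounded_subset: "bounded k \<subseteq> multidegrees n"
  by (auto simp: bounded_def)

text \<open>Stated for a set \<open>P\<close> closed downwards in the level, so that the whole
  polynomial ring and each bounded part get their bases from the same family.\<close>

lemma unitriangular_basis:
  assumes down: "\<And>w \<nu>. (w, \<nu>) \<in> indices \<Longrightarrow> expo w \<nu> \<in> P \<Longrightarrow> bounded (level w \<nu>) \<subseteq> P"
    and P: "P \<subseteq> multidegrees n"
  shows "unitriangular basis_poly {(w, \<nu>) \<in> indices. expo w \<nu> \<in> P} P (\<lambda>(w, \<nu>). expo w \<nu>) rank"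
proof
  let ?I = "{(w, \<nu>) \<in> indices. expo w \<nu> \<in> P}"
  show "bij_betw (\<lambda>(w, \<nu>). expo w \<nu>) ?I P"
    unfolding bij_betw_def
  proof (intro conjI equalityI subsetI)
    show "inj_on (\<lambda>(w, \<nu>). expo w \<nu>) ?I"
      using expo_inj by (rule inj_on_subset) auto
    fix p assume p: "p \<in> P"
    then obtain w \<nu> where "(w, \<nu>) \<in> indices" "p = expo w \<nu>"
      using expo_surj P by blast
    then show "p \<in> (\<lambda>(w, \<nu>). expo w \<nu>) ` ?I"
      using p by (intro image_eqI[of _ _ "(w, \<nu>)"]) simp_all
  qed auto
  fix i assume "i \<in> ?I"
  then obtain w \<nu> where i: "i = (w, \<nu>)" "(w, \<nu>) \<in> indices" "expo w \<nu> \<in> P" by auto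
  then have "leads (level w \<nu>) (basis_poly i) (expo w \<nu>)"
    using leads_basis_poly by (auto simp: indices_def)
  then show "lookup (basis_poly i) (case i of (w, \<nu>) \<Rightarrow> expo w \<nu>) = 1"
    "keys (basis_poly i) \<subseteq> {m \<in> P. m = (case i of (w, \<nu>) \<Rightarrow> expo w \<nu>) \<or>
      rank m < rank (case i of (w, \<nu>) \<Rightarrow> expo w \<nu>)}"
    using down[OF i(2,3)] by (auto simp: leads_def i(1))
qed

definition indices_upto :: "nat \<Rightarrow> ((nat \<Rightarrow> nat) \<times> (nat \<Rightarrow> nat)) set" where
  "indices_upto k = {(w, \<nu>) \<in> indices. level w \<nu> \<le> k}"

lemma unitriangular_all:
  "unitriangular basis_poly indices (multidegrees n) (\<lambda>(w, \<nu>). expo w \<nu>) rank"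
proof -
  have "{(w, \<nu>) \<in> indices. expo w \<nu> \<in> multidegrees n} = indices"
    using expo_in_multidegrees by (auto simp: indices_def)
  then show ?thesis
    using unitriangular_basis[of "multidegrees n"] bounded_subset by simp
qed

lemma unitriangular_upto:
  "unitriangular basis_poly (indices_upto k) (bounded k) (\<lambda>(w, \<nu>). expo w \<nu>) rank"
proof -
  have "{(w, \<nu>) \<in> indices. expo w \<nu> \<in> bounded k} = indices_upto k"
    using expo_bounded by (auto simp: indices_upto_def indices_def)
  moreover have "bounded (level w \<nu>) \<subseteq> bounded k" if "(w, \<nu>) \<in> indices" "expo w \<nu> \<in> bounded k" for w \<nu>
    using that expo_bounded[of w \<nu> k] by (auto simp: bounded_def indices_def intro: order_trans)
  ultimately show ?thesis
    using unitriangular_basis[of "bounded k"] bounded_subset by simp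
qed

end

section \<open>Subrepresentations and quotients\<close>

context lin_coord
begin

lemma subspace_group_module:
  assumes \<rho>: "group_module G V \<rho>" and K: "K \<subseteq> I"
    and stable: "\<And>g. g \<in> carrier G \<Longrightarrow> \<rho> g ` (\<Phi> ` coord_space K) \<subseteq> \<Phi> ` coord_space K"
  shows "group_module G (V\<lparr>carrier := \<Phi> ` coord_space K\<rparr>) \<rho>"
proof -
  interpret group_module G V \<rho> by (rule \<rho>)
  interpret K: lin_coord "V\<lparr>carrier := \<Phi> ` coord_space K\<rparr>" K \<Phi>
    using K by (rule subspace_coord)
  have sub: "x \<in> carrier V" if "x \<in> \<Phi> ` coord_space K" for x
    using that coord_space_mono[OF _ K] by auto
  show ?thesis
  proof (rule K.group_moduleI[OF G.group_axioms])
    fix g assume g: "g \<in> carrier G"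
    show "\<rho> g \<in> module_hom complex_field (V\<lparr>carrier := \<Phi> ` coord_space K\<rparr>) (V\<lparr>carrier := \<Phi> ` coord_space K\<rparr>)"
      using act_linear[OF g] stable[OF g] sub by (auto simp: LinearCombinations.module_hom_def)
  qed (use sub act_one act_mult in auto)
qed

lemma quotient_group_module:
  assumes \<rho>: "group_module G V \<rho>" and J: "J \<subseteq> I"
    and stable: "\<And>g. g \<in> carrier G \<Longrightarrow> \<rho> g ` (\<Phi> ` coord_space J) = \<Phi> ` coord_space J"
  shows "group_module G (quotient_module V (\<Phi> ` coord_space J)) (quotient_action \<rho>)"
proof -
  interpret group_module G V \<rho> by (rule \<rho>)
  let ?N = "\<Phi> ` coord_space J"
  let ?Q = "quotient_module V ?N"
  interpret Q: lin_coord "?Q" "I - J" "\<lambda>c. ?N +> \<Phi> c"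
    using J by (rule quotient_coord)
  have act: "quotient_action \<rho> g (?N +> x) = ?N +> \<rho> g x" if "g \<in> carrier G" "x \<in> carrier V" for g x
    unfolding quotient_action_def using image_coset[OF J act_linear[OF that(1)] stable[OF that(1)] that(2)] .
  have carrier: "\<exists>x\<in>carrier V. X = ?N +> x" if "X \<in> carrier (?Q)" for X
    using Q.ex_coord[OF that] coord_space_mono[of _ "I - J" I] by fastforce
  have coset_in: "?N +> x \<in> carrier (?Q)" if "x \<in> carrier V" for x
    using that by (auto simp: quotient_module_def ring.defs module.defs FactRing_def A_RCOSETS_def RCOSETS_def
        a_r_coset_def)
  have closed: "\<rho> g x \<in> carrier V" if "g \<in> carrier G" "x \<in> carrier V" for g x
    using act_linear[OF that(1)] that(2) module_hom_closed by blast
  have add: "(?N +> x) \<oplus>\<^bsub>?Q\<^esub> (?N +> y) = ?N +> (x \<oplus> y)"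
    if "x \<in> carrier V" "y \<in> carrier V" for x y
    using coset_add[OF J that] by (simp add: quotient_module_def ring.defs module.defs FactRing_def)
  have smult: "a \<odot>\<^bsub>?Q\<^esub> (?N +> x) = ?N +> (a \<odot> x)" if "x \<in> carrier V" for a x
    using coset_smult[OF J coord_closed[OF that]] that by (simp add: quotient_module_def ring.defs module.defs)
  show ?thesis
  proof (rule Q.group_moduleI[OF G.group_axioms])
    fix g assume g: "g \<in> carrier G"
    show "quotient_action \<rho> g \<in> module_hom complex_field (?Q) (?Q)"
      unfolding LinearCombinations.module_hom_def
    proof (intro CollectI conjI allI impI funcsetI)
      fix X assume "X \<in> carrier (?Q)"
      then obtain x where x: "x \<in> carrier V" "X = ?N +> x" using carrier by blast
      then show "quotient_action \<rho> g X \<in> carrier (?Q)"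
        using g by (simp add: act closed coset_in)
    next
      fix X Y assume "X \<in> carrier (?Q) \<and> Y \<in> carrier (?Q)"
      then obtain x y where xy: "x \<in> carrier V" "X = ?N +> x" "y \<in> carrier V" "Y = ?N +> y"
        using carrier by blast
      then show "quotient_action \<rho> g (X \<oplus>\<^bsub>?Q\<^esub> Y)
          = quotient_action \<rho> g X \<oplus>\<^bsub>?Q\<^esub> quotient_action \<rho> g Y"
        using g LinearCombinations.module_hom_add[OF act_linear[OF g]] by (simp add: act closed add)
    next
      fix a X assume "a \<in> carrier complex_field \<and> X \<in> carrier (?Q)"
      then obtain x where x: "x \<in> carrier V" "X = ?N +> x" using carrier by blast
      then show "quotient_action \<rho> g (a \<odot>\<^bsub>?Q\<^esub> X)
          = a \<odot>\<^bsub>?Q\<^esub> quotient_action \<rho> g X"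
        using g LinearCombinations.module_hom_smult[OF act_linear[OF g]] by (simp add: act closed smult)
    qed
  next
    fix X assume "X \<in> carrier (?Q)"
    then obtain x where "x \<in> carrier V" "X = ?N +> x" using carrier by blast
    then show "quotient_action \<rho> \<one>\<^bsub>G\<^esub> X = X"
      by (simp add: act act_one)
  next
    fix g h X assume gh: "g \<in> carrier G" "h \<in> carrier G" and "X \<in> carrier (?Q)"
    then obtain x where "x \<in> carrier V" "X = ?N +> x" using carrier by blast
    then show "quotient_action \<rho> (g \<otimes>\<^bsub>G\<^esub> h) X = quotient_action \<rho> g (quotient_action \<rho> h X)"
      using gh by (simp add: act act_mult closed)
  qed
qed

end

section \<open>Permuting the variables\<close>

abbreviation permute_degree :: "(nat \<Rightarrow> nat) \<Rightarrow> multidegree \<Rightarrow> multidegree" where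
  "permute_degree g \<equiv> Poly_Mapping.map_key g"

lemma lookup_map_key: "inj g \<Longrightarrow> lookup (Poly_Mapping.map_key g p) k = lookup p (g k)"
  by (simp add: Poly_Mapping.map_key.rep_eq)

lemma permute_degree_inverse:
  assumes "bij g"
  shows "permute_degree g (permute_degree (inv_into UNIV g) p) = p" "permute_degree (inv_into UNIV g) (permute_degree g p) = p"
  by (intro poly_mapping_eqI, simp add: lookup_map_key[OF bij_is_inj] assms bij_imp_bij_inv
      surj_f_inv_f[OF bij_is_surj] inv_f_f[OF bij_is_inj])+

lemma permute_degree_zero: "bij g \<Longrightarrow> permute_degree g 0 = 0"
  by (simp add: map_key_zero bij_is_inj)

lemma inj_permute_degree: "bij g \<Longrightarrow> inj (permute_degree g)"
  using permute_degree_inverse(2) by (metis injI)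

lemma lookup_perm_action:
  "bij g \<Longrightarrow> lookup (perm_action g f) p = lookup f (permute_degree g p)"
  unfolding perm_action_def by (rule lookup_map_key[OF inj_permute_degree])

lemma perm_action_single:
  assumes "bij g"
  shows "perm_action g (single p c) = single (permute_degree (inv_into UNIV g) p) c"
  using permute_degree_inverse[OF assms]
  by (intro poly_mapping_eqI) (auto simp: lookup_perm_action[OF assms] lookup_single when_def)

lemma perm_action_add: "bij g \<Longrightarrow> perm_action g (f + h) = perm_action g f + perm_action g h"
  by (rule poly_mapping_eqI) (simp add: lookup_perm_action lookup_add)

lemma perm_action_zero [simp]: "bij g \<Longrightarrow> perm_action g 0 = 0"
  by (rule poly_mapping_eqI) (simp add: lookup_perm_action)

lemma perm_action_sum: "bij g \<Longrightarrow> perm_action g (\<Sum>x\<in>X. f x) = (\<Sum>x\<in>X. perm_action g (f x))"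
  by (induction X rule: infinite_finite_induct) (auto simp: perm_action_add)

lemma permute_degree_add: "bij g \<Longrightarrow> permute_degree g (p + q) = permute_degree g p + permute_degree g q"
  by (simp add: map_key_plus bij_is_inj)

lemma perm_action_mult:
  assumes g: "bij g"
  shows "perm_action g (f * h) = perm_action g f * perm_action g h"
proof -
  let ?s = "\<lambda>f q. single q (lookup f q)"
  have "f * h = (\<Sum>p\<in>keys f. \<Sum>q\<in>keys h. ?s f p * ?s h q)"
    by (simp flip: sum_product poly_mapping_as_sum)
  also have "perm_action g \<dots>
      = (\<Sum>p\<in>keys f. \<Sum>q\<in>keys h. perm_action g (?s f p) * perm_action g (?s h q))"
    by (simp add: perm_action_sum[OF g] perm_action_single[OF g] mult_single
        permute_degree_add[OF bij_imp_bij_inv[OF g]])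
  also have "\<dots> = perm_action g (\<Sum>p\<in>keys f. ?s f p) * perm_action g (\<Sum>q\<in>keys h. ?s h q)"
    by (simp add: perm_action_sum[OF g] sum_product)
  finally show ?thesis
    by (simp flip: poly_mapping_as_sum)
qed

lemma perm_action_one: "bij g \<Longrightarrow> perm_action g 1 = 1"
  using perm_action_single[of g 0 1] by (simp add: permute_degree_zero bij_imp_bij_inv)

lemma perm_action_scale:
  "bij g \<Longrightarrow> perm_action g (single 0 c * f) = single 0 c * perm_action g f"
  by (simp add: perm_action_mult perm_action_single permute_degree_zero bij_imp_bij_inv)

lemma perm_action_id: "perm_action id f = f"
  by (rule poly_mapping_eqI) (simp add: lookup_perm_action[OF bij_id] map_key_id[folded id_def])

lemma perm_action_comp:
  "bij g \<Longrightarrow> bij h \<Longrightarrow> perm_action (g \<circ> h) f = perm_action g (perm_action h f)"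
  by (rule poly_mapping_eqI) (simp add: lookup_perm_action bij_comp map_key_compose bij_is_inj)

lemma keys_perm_action: "bij g \<Longrightarrow> keys (perm_action g f) = permute_degree g -` keys f"
  by (auto simp: in_keys_iff lookup_perm_action)

context coinvariants
begin

lemma permute_degree_bounded:
  assumes "g permutes {1..n}"
  shows "permute_degree g p \<in> bounded k \<longleftrightarrow> p \<in> bounded k"
proof -
  have bij: "bij g" using assms by (rule permutes_bij)
  have "g -` keys p \<subseteq> {1..n} \<longleftrightarrow> keys p \<subseteq> {1..n}"
  proof
    assume sub: "g -` keys p \<subseteq> {1..n}"
    show "keys p \<subseteq> {1..n}"
    proof
      fix k assume "k \<in> keys p"
      moreover obtain i where "k = g i"
        using bij_is_surj[OF bij] by (rule surjE)
      ultimately show "k \<in> {1..n}"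
        using sub permutes_in_image[OF assms] by blast
    qed
  next
    assume "keys p \<subseteq> {1..n}"
    then show "g -` keys p \<subseteq> {1..n}"
      using permutes_in_image[OF assms] by blast
  qed
  moreover have "(\<forall>i. lookup p (g i) \<le> k) \<longleftrightarrow> (\<forall>i. lookup p i \<le> k)"
    using bij_is_surj[OF bij] by (metis surj_def)
  ultimately show ?thesis
    by (simp add: bounded_def multidegrees_def keys_map_key bij_is_inj[OF bij] lookup_map_key)
qed

lemma multidegrees_bounded: "p \<in> multidegrees n \<longleftrightarrow> (\<exists>k. p \<in> bounded k)"
proof
  assume p: "p \<in> multidegrees n"
  have "lookup p i \<le> (\<Sum>j\<in>keys p. lookup p j)" for i
    by (cases "i \<in> keys p") (auto intro: member_le_sum simp: in_keys_iff)
  then show "\<exists>k. p \<in> bounded k"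
    using p by (auto simp: bounded_def)
qed (auto simp: bounded_def)

lemma permute_degree_multidegrees:
  "g permutes {1..n} \<Longrightarrow> permute_degree g p \<in> multidegrees n \<longleftrightarrow> p \<in> multidegrees n"
  by (simp add: multidegrees_bounded permute_degree_bounded)

lemma perm_action_mono_chi:
  assumes "bij g" "finite C"
  shows "perm_action g (mono (chi C)) = mono (chi (g ` C))"
proof -
  have "inv_into UNIV g k \<in> C \<longleftrightarrow> k \<in> g ` C" for k
  proof
    assume "inv_into UNIV g k \<in> C"
    then have "g (inv_into UNIV g k) \<in> g ` C" by (rule imageI)
    then show "k \<in> g ` C"
      by (simp only: surj_f_inv_f[OF bij_is_surj[OF assms(1)]])
  next
    assume "k \<in> g ` C"
    then show "inv_into UNIV g k \<in> C"
      by (auto simp: inv_f_f[OF bij_is_inj[OF assms(1)]])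
  qed
  then have "permute_degree (inv_into UNIV g) (chi C) = chi (g ` C)"
    using assms by (intro poly_mapping_eqI) (simp add: lookup_map_key bij_is_inj bij_imp_bij_inv lookup_chi)
  then show ?thesis
    using assms by (simp add: perm_action_single)
qed

lemma perm_action_esym:
  assumes g: "g permutes {1..n}"
  shows "perm_action g (esym r) = esym r"
proof -
  have bij: "bij g" using g by (rule permutes_bij)
  have "perm_action g (esym r) = (\<Sum>C | C \<subseteq> {1..n} \<and> card C = r. mono (chi (g ` C)))"
    unfolding esym_def perm_action_sum[OF bij]
  proof (rule sum.cong)
    fix C assume "C \<in> {C. C \<subseteq> {1..n} \<and> card C = r}"
    then have "finite C"
      using finite_subset[of C "{1..n}"] by auto
    then show "perm_action g (mono (chi C)) = mono (chi (g ` C))"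
      by (rule perm_action_mono_chi[OF bij])
  qed simp
  also have "\<dots> = (\<Sum>C | C \<subseteq> {1..n} \<and> card C = r. mono (chi C))"
  proof (rule sum.reindex_bij_betw[of "(`) g" _ _ "\<lambda>C. mono (chi C)"])
    have card: "card (g ` C) = card C" for C
      by (rule card_image[OF inj_on_subset[OF bij_is_inj[OF bij] subset_UNIV]])
    have sub: "g ` C \<subseteq> {1..n} \<longleftrightarrow> C \<subseteq> {1..n}" for C
      using permutes_in_image[OF g] by blast
    have "D \<in> (`) g ` {C. C \<subseteq> {1..n} \<and> card C = r}" if D: "D \<subseteq> {1..n}" "card D = r" for D
    proof (rule image_eqI)
      show DD: "D = g ` inv_into UNIV g ` D"
        by (rule image_f_inv_f[OF bij_is_surj[OF bij], symmetric])
      show "inv_into UNIV g ` D \<in> {C. C \<subseteq> {1..n} \<and> card C = r}"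
        using D card[of "inv_into UNIV g ` D"] sub[of "inv_into UNIV g ` D"] DD by simp
    qed
    moreover have "inj_on ((`) g) A" for A
      by (simp add: inj_on_def inj_image_eq_iff[OF bij_is_inj[OF bij]])
    moreover have "g ` C \<in> {C. C \<subseteq> {1..n} \<and> card C = r}" if "C \<in> {C. C \<subseteq> {1..n} \<and> card C = r}" for C
      using that by (simp only: mem_Collect_eq card sub)
    ultimately show "bij_betw ((`) g) {C. C \<subseteq> {1..n} \<and> card C = r} {C. C \<subseteq> {1..n} \<and> card C = r}"
      unfolding bij_betw_def by (intro conjI equalityI subsetI) (simp, blast, simp)
  qed
  also have "\<dots> = esym r"
    by (simp only: esym_def)
  finally show ?thesis .
qed

lemma perm_action_eprod:
  assumes g: "g permutes {1..n}"
  shows "perm_action g (eprod \<nu>) = eprod \<nu>"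
proof -
  have bij: "bij g" using g by (rule permutes_bij)
  have pow: "perm_action g (f ^ m) = perm_action g f ^ m" for f m
    by (induction m) (simp_all add: perm_action_one[OF bij] perm_action_mult[OF bij])
  have "perm_action g (\<Prod>j\<in>A. f j) = (\<Prod>j\<in>A. perm_action g (f j))" for A :: "nat set" and f
    by (induction A rule: infinite_finite_induct) (simp_all add: perm_action_one[OF bij] perm_action_mult[OF bij])
  then show ?thesis
    by (simp add: eprod_def pow perm_action_esym[OF g])
qed

section \<open>The polynomial ring and the coinvariant ideal\<close>

lemma poly_ring_simps [simp]:
  "carrier (poly_ring n) = {f. keys f \<subseteq> multidegrees n}"
  "add (poly_ring n) = (+)" "\<zero>\<^bsub>poly_ring n\<^esub> = 0" "mult (poly_ring n) = (*)" "\<one>\<^bsub>poly_ring n\<^esub> = 1"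
  "smult (poly_ring n) = (\<lambda>c f. single 0 c * f)"
  by (simp_all add: poly_ring_def)

lemma multidegrees_add: "p \<in> multidegrees n \<Longrightarrow> q \<in> multidegrees n \<Longrightarrow> p + q \<in> multidegrees n"
  using keys_add[of p q] unfolding multidegrees_def by blast

lemma keys_mult_multidegrees:
  assumes "keys f \<subseteq> multidegrees n" "keys h \<subseteq> multidegrees n"
  shows "keys (f * h) \<subseteq> multidegrees n"
  using keys_mult[of f h] assms multidegrees_add by blast

sublocale R: lin_coord "poly_ring n" indices "lin_comb basis_poly"
  by (rule unitriangular.lin_coord[OF unitriangular_all]) simp_all

lemma zero_in_multidegrees [simp]: "0 \<in> multidegrees n"
  by (simp add: multidegrees_def)

lemma cring_poly_ring: "cring (poly_ring n)"
proof (rule cringI)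
  show "abelian_group (poly_ring n)"
    by (rule R.abelian)
  show "comm_monoid (poly_ring n)"
    by unfold_locales (auto simp: mult_ac dest: subsetD[OF keys_mult_multidegrees])
qed (auto simp: algebra_simps)

definition ideal_indices :: "((nat \<Rightarrow> nat) \<times> (nat \<Rightarrow> nat)) set" where
  "ideal_indices = {(w, \<nu>) \<in> indices. \<nu> \<noteq> (\<lambda>_. 0)}"

lemma ideal_indices_subset: "ideal_indices \<subseteq> indices"
  by (auto simp: ideal_indices_def)

lemma basis_poly_in_span: "i \<in> I \<Longrightarrow> basis_poly i \<in> lin_comb basis_poly ` coord_space I"
  using lin_comb_unit[of basis_poly i] unit_coord_in[of i I] by (metis imageI)

text \<open>\<open>eprod\<close> turns sums of weights into products, so multiplication by
  \<open>eprod \<nu>\<close> merely shifts the second component of the indices.\<close>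

lemma eprod_times_in_span:
  assumes f: "f \<in> lin_comb basis_poly ` coord_space I"
    and I: "\<And>w \<mu>. (w, \<mu>) \<in> I \<Longrightarrow> (w, \<lambda>j. \<nu> j + \<mu> j) \<in> I'"
  shows "eprod \<nu> * f \<in> lin_comb basis_poly ` coord_space I'"
proof -
  obtain c where c: "c \<in> coord_space I" "f = lin_comb basis_poly c"
    using f by blast
  have "eprod \<nu> * f = (\<Sum>i | c i \<noteq> 0. single 0 (c i) * (eprod \<nu> * basis_poly i))"
    unfolding c(2) lin_comb_def sum_distrib_left by (simp add: mult_ac)
  also have "\<dots> \<in> lin_comb basis_poly ` coord_space I'"
  proof (intro lin_comb_image_sum lin_comb_image_scale)
    fix i assume "i \<in> {i. c i \<noteq> 0}"
    then have "i \<in> I"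
      using c(1) by (auto simp: coord_space_def)
    moreover have "eprod \<nu> * basis_poly i = basis_poly (fst i, \<lambda>j. \<nu> j + snd i j)"
      by (simp add: basis_poly_def case_prod_unfold eprod_add mult.assoc)
    ultimately show "eprod \<nu> * basis_poly i \<in> lin_comb basis_poly ` coord_space I'"
      using I[of "fst i" "snd i"] basis_poly_in_span by simp
  qed
  finally show ?thesis .
qed

text \<open>Absorption: in \<open>x * eprod \<nu> * mono a\<close> the factor
  \<open>x * mono a\<close> is expanded in the full basis, and \<open>eprod \<nu>\<close> shifts all
  its indices by the nonzero weight \<open>\<nu>\<close>, back into
  \<open>ideal_indices\<close>.\<close>

lemma ideal_span: "ideal (lin_comb basis_poly ` coord_space ideal_indices) (poly_ring n)"
proof (rule idealI)
  let ?J = "lin_comb basis_poly ` coord_space ideal_indices"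
  interpret cring "poly_ring n" by (rule cring_poly_ring)
  show "ring (poly_ring n)" by (rule ring_axioms)
  have J: "?J \<subseteq> carrier (poly_ring n)"
    using R.\<Phi>_closed coord_space_mono[OF _ ideal_indices_subset] by blast
  show "subgroup ?J (add_monoid (poly_ring n))"
  proof (rule add.subgroupI)
    show "?J \<subseteq> carrier (poly_ring n)" by (rule J)
    show "?J \<noteq> {}" using coord_space_zero by blast
    fix a b assume a: "a \<in> ?J"
    have "single 0 (-1) * a \<in> ?J"
      using a by (rule lin_comb_image_scale)
    moreover have "\<ominus>\<^bsub>poly_ring n\<^esub> a = single 0 (-1) * a"
      using a J by (intro minus_equality)
        (auto simp: single_uminus keys_minus intro!: poly_mapping_eqI simp: lookup_add lookup_scale dest: subsetD)
    ultimately show "\<ominus>\<^bsub>poly_ring n\<^esub> a \<in> ?J" by simp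
    assume "b \<in> ?J"
    with a show "a \<oplus>\<^bsub>poly_ring n\<^esub> b \<in> ?J"
      by (auto simp flip: lin_comb_add)
  qed
  fix a x assume a: "a \<in> ?J" and x: "x \<in> carrier (poly_ring n)"
  obtain c where c: "c \<in> coord_space ideal_indices" "a = lin_comb basis_poly c"
    using a by blast
  have "x * a = (\<Sum>i | c i \<noteq> 0. single 0 (c i) * (x * basis_poly i))"
    unfolding c(2) lin_comb_def sum_distrib_left by (simp add: mult_ac)
  also have "\<dots> \<in> ?J"
  proof (intro lin_comb_image_sum lin_comb_image_scale)
    fix i assume "i \<in> {i. c i \<noteq> 0}"
    then have "i \<in> ideal_indices"
      using c(1) by (auto simp: coord_space_def)
    then obtain w \<nu> where i: "i = (w, \<nu>)" "w permutes {1..n}" "\<nu> \<in> weights" "\<nu> \<noteq> (\<lambda>_. 0)"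
      by (auto simp: ideal_indices_def indices_def)
    have "keys (x * mono (expo w (\<lambda>_. 0))) \<subseteq> multidegrees n"
      using x expo_in_multidegrees[OF i(2)] by (intro keys_mult_multidegrees) auto
    then have "x * mono (expo w (\<lambda>_. 0)) \<in> lin_comb basis_poly ` coord_space indices"
      using R.ex_coord by auto
    then have "eprod \<nu> * (x * mono (expo w (\<lambda>_. 0))) \<in> ?J"
      by (rule eprod_times_in_span) (use i in \<open>auto simp: ideal_indices_def indices_def weights_def fun_eq_iff\<close>)
    then show "x * basis_poly i \<in> ?J"
      by (simp add: i(1) basis_poly_def mult_ac)
  qed
  finally show "x \<otimes>\<^bsub>poly_ring n\<^esub> a \<in> ?J" by simp
  then show "a \<otimes>\<^bsub>poly_ring n\<^esub> x \<in> ?J" by (simp add: mult.commute)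
qed

text \<open>Both exponents have the same sorted values, so their top sums differ only in the
  tie-breaking parts \<open>n - j\<close>. After sorting, these are summed over initial segments,
  where they are largest; a nonidentical \<open>w\<close> moves some initial segment and loses
  strictly there.\<close>

lemma rank_sorted_greater:
  assumes p: "p \<in> multidegrees n" and not_id: "srt p \<noteq> id"
  shows "rank p < rank (permute_degree (srt p) p)"
proof -
  define w where "w = srt p"
  define q where "q = permute_degree w p"
  have sorts: "sorts w p" and w: "w permutes {1..n}"
    using sorts_srt by (auto simp: w_def sorts_def)
  have inj: "inj w"
    using w by (rule permutes_inj)
  have lookup_q: "lookup q i = lookup p (w i)" for i
    by (simp add: q_def lookup_map_key[OF inj])
  have srt_q: "srt q = id"
    using sorts unfolding sorts_iff by (intro srt_eq) (auto simp: sorts_iff permutes_id lookup_q)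
  define f where "f j = n - j" for j
  have top_p: "top_sum w p s = n * (\<Sum>i=1..s. lookup p (w i)) + sum f (top_set w s)" for s
    unfolding top_sum_def key_def sum.distrib f_def[symmetric] top_set_def
    by (simp add: sum.reindex[OF inj_on_subset[OF inj]] sum_distrib_left)
  have top_q: "top_sum id q s = n * (\<Sum>i=1..s. lookup p (w i)) + sum f {1..s}" for s
    unfolding top_sum_def key_def sum.distrib f_def[symmetric] top_set_def
    by (simp add: lookup_q sum_distrib_left)
  have less: "sum f (top_set w s) < sum f {1..s}" if "s \<in> {1..n}" "top_set w s \<noteq> {1..s}" for s
    using that card_top[OF w, of s] top_set_subset[OF w, of s]
    by (intro sum_less_top) (auto simp: f_def diff_less_mono2 dest!: subsetD)
  have "\<exists>s\<in>{1..n}. top_set w s \<noteq> {1..s}"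
  proof (rule ccontr)
    assume "\<not> ?thesis"
    then have eq: "w ` {1..s} = {1..s}" if "s \<le> n" for s
      using that by (cases "s = 0") (auto simp: top_set_def)
    \<comment> \<open>The point \<open>s\<close> is the difference of two initial segments, both
      preserved by the injective \<open>w\<close>.\<close>
    have "w s = s" if s: "s \<in> {1..n}" for s
    proof -
      have "w ` ({1..s} - {1..s - 1}) = w ` {1..s} - w ` {1..s - 1}"
        using inj by (rule image_set_diff)
      moreover have "w ` {1..s} = {1..s}" "w ` {1..s - 1} = {1..s - 1}"
        using s by (auto simp only: atLeastAtMost_iff intro!: eq)
      moreover have "{1..s} - {1..s - 1} = {s}"
        using s by auto
      ultimately show ?thesis by simp
    qed
    then have "w = id"
      using w unfolding permutes_def by (intro ext) (metis id_apply)
    then show False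
      using not_id by (simp add: w_def)
  qed
  then obtain t where t: "t \<in> {1..n}" "top_set w t \<noteq> {1..t}" by blast
  have "(\<Sum>s=1..n. top_sum w p s) < (\<Sum>s=1..n. top_sum id q s)"
  proof (rule sum_strict_mono_ex1)
    show "\<forall>s\<in>{1..n}. top_sum w p s \<le> top_sum id q s"
      using less by (metis top_p top_q add_left_mono less_imp_le order_refl)
    show "\<exists>s\<in>{1..n}. top_sum w p s < top_sum id q s"
      using less[OF t] t(1) by (metis top_p top_q add_strict_left_mono)
  qed simp
  then show ?thesis
    by (simp add: rank_def srt_q w_def flip: q_def[unfolded w_def])
qed

lemma esym_no_constant: "j \<in> {1..n} \<Longrightarrow> lookup (esym j * f) 0 = 0"
proof (rule ccontr)
  assume j: "j \<in> {1..n}" and "lookup (esym j * f) 0 \<noteq> 0"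
  then have "0 \<in> keys (esym j * f)"
    by (simp add: in_keys_iff)
  then obtain p q where pq: "p \<in> keys (esym j)" "0 = p + q"
    using keys_mult by blast
  then have "p = 0"
    by (metis add_eq_0_iff_both_eq_0 lookup_add lookup_zero poly_mapping_eqI)
  have "p \<in> (\<Union>C\<in>{C. C \<subseteq> {1..n} \<and> card C = j}. keys (mono (chi C)))"
    using subsetD[OF keys_sum pq(1)[unfolded esym_def]] .
  then obtain C where C: "C \<subseteq> {1..n}" "card C = j" "p = chi C" by auto
  then have "C = keys p"
    using keys_chi finite_subset by blast
  then show False
    using C j \<open>p = 0\<close> by simp
qed

lemma weights_step: "\<nu> \<in> weights \<Longrightarrow> \<nu> \<noteq> (\<lambda>_. 0) \<Longrightarrow> \<exists>\<mu>\<in>weights. \<exists>j\<in>{1..n}. eprod \<nu> = esym j * eprod \<mu>"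
proof (induction rule: weights_induct)
  case (step \<nu> j)
  then show ?case
    using eprod_step by blast
qed simp

text \<open>The fundamental theorem of symmetric polynomials: a leading monomial of the part of \<open>f\<close>
  involving basis elements for \<open>w \<noteq> id\<close> would have a rearrangement of larger rank.\<close>

lemma symmetric_in_span:
  assumes sym: "symmetric_poly n f"
  shows "\<exists>c\<in>coord_space {i \<in> indices. fst i = id}. f = lin_comb basis_poly c"
proof -
  have f: "f \<in> carrier (poly_ring n)" and inv: "\<And>g. g permutes {1..n} \<Longrightarrow> perm_action g f = f"
    using sym by (auto simp: symmetric_poly_def sym_group_def)
  obtain c where c: "c \<in> coord_space indices" "f = lin_comb basis_poly c"
    using R.ex_coord[OF f] by blast
  define a where "a i = (if fst i = id then c i else 0)" for i
  define d where "d i = (if fst i \<noteq> id then c i else 0)" for i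
  have a: "a \<in> coord_space {i \<in> indices. fst i = id}" and d: "d \<in> coord_space {i \<in> indices. fst i \<noteq> id}"
    unfolding a_def d_def using c(1) by (auto intro: coord_space_restrict)
  have aI: "a \<in> coord_space indices" and dI: "d \<in> coord_space indices"
    using a d by (auto elim: coord_space_mono)
  have "c = (\<lambda>i. a i + d i)"
    by (auto simp: a_def d_def)
  then have split: "f = lin_comb basis_poly a + lin_comb basis_poly d"
    using lin_comb_add[OF aI dI] c(2) by simp
  \<comment> \<open>The descent monomial of the identity is 1, so the part given by \<open>a\<close>
    is a combination of the invariant products \<open>eprod \<nu>\<close>. Subtracting it shows that
    the part given by \<open>d\<close> is invariant too.\<close>
  have "expo id (\<lambda>_. 0) = 0"
    by (simp add: expo_def des_def)
  then have inv_a: "perm_action g (lin_comb basis_poly a) = lin_comb basis_poly a" if g: "g permutes {1..n}" for g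
    using a unfolding lin_comb_def perm_action_sum[OF permutes_bij[OF g]]
    by (intro sum.cong) (auto simp: coord_space_def perm_action_scale[OF permutes_bij[OF g]] basis_poly_def
        perm_action_eprod[OF g])
  have inv_d: "perm_action g (lin_comb basis_poly d) = lin_comb basis_poly d" if g: "g permutes {1..n}" for g
  proof -
    have "lin_comb basis_poly a + perm_action g (lin_comb basis_poly d) = perm_action g f"
      unfolding split perm_action_add[OF permutes_bij[OF g]] inv_a[OF g] ..
    then show ?thesis
      unfolding inv[OF g] by (simp add: split)
  qed
  have "d i = 0" for i
  proof (rule ccontr)
    interpret U: unitriangular basis_poly indices "multidegrees n" "\<lambda>(w, \<nu>). expo w \<nu>" rank
      by (rule unitriangular_all)
    assume "d i \<noteq> 0"
    then obtain j where j: "d j \<noteq> 0" "j \<in> indices"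
      "\<And>l. d l \<noteq> 0 \<Longrightarrow> rank (case l of (w, \<nu>) \<Rightarrow> expo w \<nu>) \<le> rank (case j of (w, \<nu>) \<Rightarrow> expo w \<nu>)"
      "lookup (lin_comb basis_poly d) (case j of (w, \<nu>) \<Rightarrow> expo w \<nu>) = d j"
      using U.ex_top_term[OF dI] by blast
    obtain w \<nu> where w\<nu>: "j = (w, \<nu>)" "w permutes {1..n}" "w \<noteq> id"
      using j(1,2) by (cases j) (auto simp: indices_def d_def split: if_splits)
    define p where "p = expo w \<nu>"
    have p: "p \<in> multidegrees n" "srt p = w"
      using w\<nu> by (simp_all add: p_def expo_in_multidegrees srt_expo)
    have "lookup (lin_comb basis_poly d) (permute_degree w p) = d j"
      using j(4) inv_d[OF w\<nu>(2)] lookup_perm_action[OF permutes_bij[OF w\<nu>(2)], of "lin_comb basis_poly d" p]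
      by (simp add: w\<nu>(1) p_def)
    then have "(\<Sum>l | d l \<noteq> 0. d l * lookup (basis_poly l) (permute_degree w p)) \<noteq> 0"
      using j(1) by (simp add: lookup_lin_comb)
    then obtain l where "d l * lookup (basis_poly l) (permute_degree w p) \<noteq> 0"
      by (rule sum.not_neutral_contains_not_neutral)
    then have l: "d l \<noteq> 0" "lookup (basis_poly l) (permute_degree w p) \<noteq> 0"
      by auto
    then have "l \<in> indices"
      using dI by (auto simp: coord_space_def)
    moreover have "permute_degree w p \<in> keys (basis_poly l)"
      using l(2) by (simp add: in_keys_iff)
    ultimately have "rank (permute_degree w p) \<le> rank (case l of (w, \<nu>) \<Rightarrow> expo w \<nu>)"
      using U.keys_lead[of l] by (auto simp del: split_paired_All)
    also have "\<dots> \<le> rank p"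
      using j(3)[OF l(1)] by (simp add: w\<nu>(1) p_def)
    finally show False
      using rank_sorted_greater[OF p(1)] p(2) w\<nu>(3) by simp
  qed
  then have "lin_comb basis_poly d = 0"
    by (simp add: lin_comb_def)
  then show ?thesis
    using split a by auto
qed

text \<open>A generator is a combination of products \<open>eprod \<nu>\<close>, and its constant
  term is the coefficient at \<open>\<nu> = 0\<close>, as every other product contains some
  \<open>esym j\<close> with \<open>j\<close> positive. Conversely such a factor
  \<open>esym j\<close> is itself a generator.\<close>

lemma coinv_ideal_eq: "coinv_ideal n = lin_comb basis_poly ` coord_space ideal_indices"
proof
  let ?J = "lin_comb basis_poly ` coord_space ideal_indices"
  let ?S = "{f. symmetric_poly n f \<and> lookup f 0 = 0}"
  interpret cring "poly_ring n" by (rule cring_poly_ring)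
  have S: "?S \<subseteq> carrier (poly_ring n)"
    by (auto simp: symmetric_poly_def)
  interpret I: ideal "coinv_ideal n" "poly_ring n"
    unfolding coinv_ideal_def using S by (rule genideal_ideal)
  show "coinv_ideal n \<subseteq> ?J"
    unfolding coinv_ideal_def
  proof (rule genideal_minimal[OF ideal_span], clarify)
    fix f assume sym: "symmetric_poly n f" and zero: "lookup f 0 = 0"
    obtain c where c: "c \<in> coord_space {i \<in> indices. fst i = id}" "f = lin_comb basis_poly c"
      using symmetric_in_span[OF sym] by blast
    have id: "expo id (\<lambda>_. 0) = 0"
      by (simp add: expo_def des_def)
    have const: "lookup (basis_poly i) 0 = (if i = (id, \<lambda>_. 0) then 1 else 0)" if ci: "c i \<noteq> 0" for i
    proof -
      obtain \<nu> where i: "i = (id, \<nu>)" "\<nu> \<in> weights"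
        using ci c(1) by (cases i) (auto simp: coord_space_def indices_def)
      show ?thesis
      proof (cases "\<nu> = (\<lambda>_. 0)")
        case False
        then obtain \<mu> j where "j \<in> {1..n}" "eprod \<nu> = esym j * eprod \<mu>"
          using weights_step[OF i(2)] by blast
        then show ?thesis
          using False i esym_no_constant by (auto simp: basis_poly_def mult.assoc)
      qed (simp add: i basis_poly_def id)
    qed
    have fin: "finite {i. c i \<noteq> 0}"
      using c(1) by (simp add: coord_space_def)
    have "0 = (\<Sum>i | c i \<noteq> 0. if i = (id, \<lambda>_. 0) then c i else 0)"
      using zero unfolding c(2) lookup_lin_comb by (simp add: const if_distrib[of "(*) _"] cong: if_cong)
    then have "c (id, \<lambda>_. 0) = 0"
      using fin by (auto split: if_splits)
    then have "c \<in> coord_space ideal_indices"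
      using c(1) by (fastforce simp: coord_space_def ideal_indices_def)
    then show "f \<in> ?J"
      using c(2) by blast
  qed
  show "?J \<subseteq> coinv_ideal n"
  proof clarify
    fix c assume c: "c \<in> coord_space ideal_indices"
    have basis: "single 0 a * basis_poly i \<in> coinv_ideal n" if i: "i \<in> ideal_indices" for i a
    proof -
      obtain w \<nu> where w\<nu>: "i = (w, \<nu>)" "w permutes {1..n}" "\<nu> \<in> weights" "\<nu> \<noteq> (\<lambda>_. 0)"
        using i by (auto simp: ideal_indices_def indices_def)
      obtain \<mu> j where \<mu>: "\<mu> \<in> weights" "j \<in> {1..n}" "eprod \<nu> = esym j * eprod \<mu>"
        using weights_step[OF w\<nu>(3,4)] by blast
      have in_R: "keys (single 0 a * basis_poly (w, \<mu>)) \<subseteq> multidegrees n"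
        using leads_basis_poly[OF w\<nu>(2) \<mu>(1)] bounded_subset
        by (intro keys_mult_multidegrees) (auto simp: leads_def)
      have "keys (esym j) \<subseteq> multidegrees n"
        unfolding esym_def
      proof (rule order_trans[OF keys_sum], rule UN_least)
        fix C assume "C \<in> {C. C \<subseteq> {1..n} \<and> card C = j}"
        then have "C \<subseteq> {1..n}" "finite C"
          using finite_subset[of C "{1..n}"] by auto
        then show "keys (mono (chi C)) \<subseteq> multidegrees n"
          by (simp add: multidegrees_def keys_chi)
      qed
      then have "esym j \<in> ?S"
        using esym_no_constant[OF \<mu>(2), of 1] perm_action_esym by (auto simp: symmetric_poly_def sym_group_def)
      then have "esym j \<in> coinv_ideal n"
        unfolding coinv_ideal_def using genideal_self[OF S] by blast
      then have "(single 0 a * basis_poly (w, \<mu>)) \<otimes>\<^bsub>poly_ring n\<^esub> esym j \<in> coinv_ideal n"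
        using in_R by (intro I.I_l_closed) auto
      then show ?thesis
        by (simp add: w\<nu>(1) \<mu>(3) basis_poly_def mult_ac)
    qed
    have "(\<Sum>i\<in>X. single 0 (c i) * basis_poly i) \<in> coinv_ideal n"
      if "finite X" "X \<subseteq> ideal_indices" for X
      using that
    proof (induction X rule: finite_induct)
      case empty
      then show ?case using I.zero_closed by simp
    next
      case (insert i X)
      then show ?case using I.a_closed basis by simp
    qed
    then show "lin_comb basis_poly c \<in> coinv_ideal n"
      using c unfolding lin_comb_def coord_space_def by blast
  qed
qed

end

section \<open>Generating functions\<close>

lemma fps_partial_sums:
  fixes f :: "nat \<Rightarrow> 'a :: comm_ring_1"
  shows "Abs_fps (\<lambda>m. \<Sum>i\<le>m. f i) * (1 - fps_X) = Abs_fps f"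
proof (rule fps_ext)
  fix m
  show "fps_nth (Abs_fps (\<lambda>m. \<Sum>i\<le>m. f i) * (1 - fps_X)) m = fps_nth (Abs_fps f) m"
    by (cases m) (simp_all add: algebra_simps)
qed

definition weights_upto :: "'a set \<Rightarrow> nat \<Rightarrow> ('a \<Rightarrow> nat) set" where
  "weights_upto A m = {\<nu>. (\<forall>j. j \<notin> A \<longrightarrow> \<nu> j = 0) \<and> sum \<nu> A \<le> m}"

text \<open>The new entry takes \<open>m - i\<close>, which leaves the budget \<open>i\<close> for
  the entries on \<open>A\<close>.\<close>

lemma weights_upto_insert:
  assumes "finite A" "a \<notin> A"
  shows "bij_betw (\<lambda>(i, \<nu>). \<nu>(a := m - i)) (SIGMA i:{..m}. weights_upto A i) (weights_upto (insert a A) m)"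
proof (rule bij_betw_byWitness[of _ "\<lambda>\<nu>. (m - \<nu> a, \<nu>(a := 0))"])
  have upd: "sum (\<nu>(a := i)) A = sum \<nu> A" for \<nu> :: "'a \<Rightarrow> nat" and i
    using assms(2) by (intro sum.cong) auto
  show "\<forall>x\<in>SIGMA i:{..m}. weights_upto A i. (\<lambda>\<nu>. (m - \<nu> a, \<nu>(a := 0))) ((\<lambda>(i, \<nu>). \<nu>(a := m - i)) x) = x"
    using assms(2) by (auto simp: weights_upto_def fun_eq_iff)
  show "\<forall>\<nu>\<in>weights_upto (insert a A) m. (\<lambda>(i, \<nu>). \<nu>(a := m - i)) ((\<lambda>\<nu>. (m - \<nu> a, \<nu>(a := 0))) \<nu>) = \<nu>"
    using assms by (auto simp: weights_upto_def fun_eq_iff)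
  show "(\<lambda>(i, \<nu>). \<nu>(a := m - i)) ` (SIGMA i:{..m}. weights_upto A i) \<subseteq> weights_upto (insert a A) m"
    using assms by (auto simp: weights_upto_def upd simp del: fun_upd_apply) (auto simp: weights_upto_def)
  show "(\<lambda>\<nu>. (m - \<nu> a, \<nu>(a := 0))) ` weights_upto (insert a A) m \<subseteq> (SIGMA i:{..m}. weights_upto A i)"
    using assms by (auto simp: weights_upto_def upd simp del: fun_upd_apply) (auto simp: weights_upto_def)
qed

text \<open>Each variable contributes a factor \<open>1 / (1 - X)\<close>, and bounding the total
  instead of prescribing it amounts to one further slack variable. For \<open>{1..n}\<close> this is
  the origin of \<open>n + 1\<close> in the binomial coefficients of
  \<open>tau_char\<close>.\<close>

lemma weights_upto_gf:
  assumes "finite A"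
  shows "(\<forall>m. finite (weights_upto A m)) \<and>
    Abs_fps (\<lambda>m. of_nat (card (weights_upto A m))) * (1 - fps_X) ^ Suc (card A) = (1 :: complex fps)"
  using assms
proof (induction A rule: finite_induct)
  case empty
  have "weights_upto {} m = {\<lambda>_ :: 'a. 0}" for m
    by (auto simp: weights_upto_def)
  moreover have "Abs_fps (\<lambda>m. \<Sum>i\<le>m. if i = 0 then 1 else 0) * (1 - fps_X) = (1 :: complex fps)"
    unfolding fps_partial_sums by (rule fps_ext) simp
  ultimately show ?case by simp
next
  case (insert a A)
  have fin: "finite (SIGMA i:{..m}. weights_upto A i)" for m
    using insert.IH by simp
  have "card (weights_upto (insert a A) m) = (\<Sum>i\<le>m. card (weights_upto A i))" for m
    using bij_betw_same_card[OF weights_upto_insert[OF insert.hyps(1,2), of m]] insert.IH by simp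
  then have card: "of_nat (card (weights_upto (insert a A) m)) = (\<Sum>i\<le>m. of_nat (card (weights_upto A i)) :: complex)" for m
    by simp
  have "Abs_fps (\<lambda>m. of_nat (card (weights_upto (insert a A) m))) * (1 - fps_X) ^ Suc (card (insert a A))
      = (Abs_fps (\<lambda>m. \<Sum>i\<le>m. of_nat (card (weights_upto A i)) :: complex) * (1 - fps_X)) * (1 - fps_X) ^ Suc (card A)"
    using insert.hyps by (simp add: card mult.assoc)
  also have "\<dots> = 1"
    unfolding fps_partial_sums using insert.IH by blast
  finally show ?case
    using bij_betw_finite[OF weights_upto_insert[OF insert.hyps(1,2)]] fin by blast
qed

lemma one_minus_X_power_nth: "fps_nth ((1 - fps_X) ^ m) j = (-1) ^ j * (of_nat (m choose j) :: complex)"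
proof (induction m arbitrary: j)
  case 0
  show ?case by (cases j) simp_all
next
  case (Suc m)
  show ?case
    by (cases j) (simp_all add: Suc algebra_simps)
qed

section \<open>Traces of permutations on bounded polynomials\<close>

context coinvariants
begin

lemma permutes_permutation: "g permutes {1..n} \<Longrightarrow> permutation g"
  unfolding permutation_permutes by blast

text \<open>A fixed multidegree is constant on the cycles of \<open>g\<close>, and on each cycle it
  may take any of the \<open>k + 1\<close> values from 0 to \<open>k\<close>.\<close>

lemma card_fixed_degrees:
  assumes g: "g permutes {1..n}"
  shows "card {p \<in> bounded k. permute_degree g p = p} = (k + 1) ^ num_cycles n g"
proof -
  define orbits where "orbits = orbit g ` {1..n}"
  have self: "i \<in> orbit g i" for i
    using permutation_self_in_orbit[OF permutes_permutation[OF g]] .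
  have step: "orbit g (g i) = orbit g i" for i
    using permutation_orbit_step[OF permutes_permutation[OF g]] .
  have inj: "inj g"
    using g by (rule permutes_inj)
  define F where "F h = Abs_poly_mapping (\<lambda>i. if i \<in> {1..n} then h (orbit g i) else 0 :: nat)" for h
  have lookup_F: "lookup (F h) i = (if i \<in> {1..n} then h (orbit g i) else 0)" for h i
  proof -
    have "finite {i. (if i \<in> {1..n} then h (orbit g i) else 0) \<noteq> 0}"
      by (rule finite_subset[of _ "{1..n}"]) auto
    then show ?thesis
      by (simp add: F_def)
  qed
  have "bij_betw F (orbits \<rightarrow>\<^sub>E {0..k}) {p \<in> bounded k. permute_degree g p = p}"
    unfolding bij_betw_def
  proof (intro conjI equalityI subsetI)
    show "inj_on F (orbits \<rightarrow>\<^sub>E {0..k})"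
    proof (rule inj_onI)
      fix h h' assume h: "h \<in> orbits \<rightarrow>\<^sub>E {0..k}" "h' \<in> orbits \<rightarrow>\<^sub>E {0..k}" "F h = F h'"
      have "h X = h' X" if "X \<in> orbits" for X
      proof -
        obtain i where "i \<in> {1..n}" "X = orbit g i"
          using \<open>X \<in> orbits\<close> by (auto simp: orbits_def)
        then show ?thesis
          using lookup_F[of h i] lookup_F[of h' i] h(3) by simp
      qed
      then show "h = h'"
        using h(1,2) by (intro PiE_ext)
    qed
  next
    fix p assume "p \<in> F ` (orbits \<rightarrow>\<^sub>E {0..k})"
    then obtain h where h: "h \<in> orbits \<rightarrow>\<^sub>E {0..k}" "p = F h" by blast
    have "lookup p i \<le> k" for i
      using h PiE_mem[OF h(1), of "orbit g i"] by (auto simp: lookup_F orbits_def)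
    moreover have "keys p \<subseteq> {1..n}"
      by (auto simp: h(2) in_keys_iff lookup_F split: if_splits)
    moreover have "permute_degree g p = p"
      by (rule poly_mapping_eqI)
        (simp only: lookup_map_key[OF inj] h(2) lookup_F step permutes_in_image[OF g])
    ultimately show "p \<in> {p \<in> bounded k. permute_degree g p = p}"
      by (simp add: bounded_def multidegrees_def)
  next
    fix p assume "p \<in> {p \<in> bounded k. permute_degree g p = p}"
    then have p: "p \<in> bounded k" "permute_degree g p = p" by auto
    have inv: "lookup p (g i) = lookup p i" for i
      using lookup_map_key[OF inj, of p i] p(2) by simp
    have const: "lookup p j = lookup p i" if "j \<in> orbit g i" for i j
      using that by (induction rule: orbit.induct) (simp_all add: inv)
    define h where "h = (\<lambda>X\<in>orbits. lookup p (SOME i. i \<in> X))"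
    have h: "h (orbit g i) = lookup p i" if "i \<in> {1..n}" for i
    proof -
      have "(SOME j. j \<in> orbit g i) \<in> orbit g i"
        using self by (rule someI)
      then show ?thesis
        using that const by (auto simp: h_def orbits_def)
    qed
    have "p = F h"
    proof (rule poly_mapping_eqI)
      fix i
      have "i \<in> {1..n}" if "lookup p i \<noteq> 0"
        using p(1) that unfolding bounded_def multidegrees_def by (auto simp: in_keys_iff subset_eq)
      then show "lookup p i = lookup (F h) i"
        using h by (auto simp: lookup_F)
    qed
    moreover have "h \<in> orbits \<rightarrow>\<^sub>E {0..k}"
      using p(1) by (auto simp: h_def bounded_def)
    ultimately show "p \<in> F ` (orbits \<rightarrow>\<^sub>E {0..k})" by blast
  qed
  then have "card {p \<in> bounded k. permute_degree g p = p} = card (orbits \<rightarrow>\<^sub>E {0..k})"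
    using bij_betw_same_card by fastforce
  then show ?thesis
    by (simp add: card_PiE prod_constant num_cycles_def orbits_def)
qed

lemma finite_bounded: "finite (bounded k)"
proof (rule finite_imageD)
  show "inj_on (\<lambda>p. restrict (lookup p) {1..n}) (bounded k)"
  proof (rule inj_onI, rule poly_mapping_eqI)
    fix p q i assume pq: "p \<in> bounded k" "q \<in> bounded k"
      and eq: "restrict (lookup p) {1..n} = restrict (lookup q) {1..n}"
    show "lookup p i = lookup q i"
    proof (cases "i \<in> {1..n}")
      case True
      then show ?thesis using fun_cong[OF eq, of i] by simp
    next
      case False
      then have "i \<notin> keys p" "i \<notin> keys q"
        using pq unfolding bounded_def multidegrees_def by blast+
      then show ?thesis by (simp add: in_keys_iff)
    qed
  qed
  have "(\<lambda>p. restrict (lookup p) {1..n}) ` bounded k \<subseteq> {1..n} \<rightarrow>\<^sub>E {0..k}"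
    by (auto simp: bounded_def)
  then show "finite ((\<lambda>p. restrict (lookup p) {1..n}) ` bounded k)"
    by (rule finite_subset) (simp add: finite_PiE)
qed

lemma finite_indices_upto: "finite (indices_upto k)"
  using bij_betw_finite[OF unitriangular.lead[OF unitriangular_upto]] finite_bounded by blast

lemma indices_upto_subset: "indices_upto k \<subseteq> indices"
  by (auto simp: indices_upto_def)

lemma span_upto: "lin_comb basis_poly ` coord_space (indices_upto k) = {f. keys f \<subseteq> bounded k}"
  using unitriangular.span[OF unitriangular_upto]
    keys_lin_comb[of _ "indices_upto k" basis_poly "bounded k"] unitriangular.keys_lead[OF unitriangular_upto]
  by blast

lemma perm_action_keys:
  assumes "g permutes {1..n}"
  shows "keys (perm_action g f) \<subseteq> bounded k \<longleftrightarrow> keys f \<subseteq> bounded k"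
    "keys (perm_action g f) \<subseteq> multidegrees n \<longleftrightarrow> keys f \<subseteq> multidegrees n"
proof -
  have bij: "bij g" using assms by (rule permutes_bij)
  have "permute_degree g -` keys f \<subseteq> X \<longleftrightarrow> keys f \<subseteq> X"
    if "\<And>p. permute_degree g p \<in> X \<longleftrightarrow> p \<in> X" for X
  proof
    assume sub: "permute_degree g -` keys f \<subseteq> X"
    show "keys f \<subseteq> X"
    proof
      fix q assume "q \<in> keys f"
      then have "permute_degree (inv_into UNIV g) q \<in> X"
        using sub by (auto simp: permute_degree_inverse(1)[OF bij])
      then show "q \<in> X"
        using that[of "permute_degree (inv_into UNIV g) q"] by (simp add: permute_degree_inverse(1)[OF bij])
    qed
  next
    assume "keys f \<subseteq> X"
    then show "permute_degree g -` keys f \<subseteq> X"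
      using that by blast
  qed
  then show "keys (perm_action g f) \<subseteq> bounded k \<longleftrightarrow> keys f \<subseteq> bounded k"
    "keys (perm_action g f) \<subseteq> multidegrees n \<longleftrightarrow> keys f \<subseteq> multidegrees n"
    by (simp_all add: keys_perm_action[OF bij] permute_degree_bounded[OF assms] permute_degree_multidegrees[OF assms])
qed

lemma perm_action_linear:
  assumes g: "g permutes {1..n}"
  shows "perm_action g \<in> module_hom complex_field (poly_ring n) (poly_ring n)"
    and "perm_action g \<in> module_hom complex_field ((poly_ring n)\<lparr>carrier := {f. keys f \<subseteq> bounded k}\<rparr>)
      ((poly_ring n)\<lparr>carrier := {f. keys f \<subseteq> bounded k}\<rparr>)"
  using perm_action_keys[OF g]
  by (simp_all add: LinearCombinations.module_hom_def perm_action_add perm_action_scale permutes_bij[OF g])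

definition diag :: "(nat \<Rightarrow> nat) \<Rightarrow> (nat \<Rightarrow> nat) \<Rightarrow> complex" where
  "diag g w = R.diag_coeff (perm_action g) (w, \<lambda>_. 0)"

text \<open>The products \<open>eprod \<nu>\<close> are invariant, so the diagonal coefficients do not depend on \<open>\<nu>\<close>.\<close>

lemma diag_coeff_eq:
  assumes g: "g permutes {1..n}" and i: "(w, \<nu>) \<in> indices"
  shows "R.diag_coeff (perm_action g) (w, \<nu>) = diag g w"
proof -
  have bij: "bij g" using g by (rule permutes_bij)
  have \<nu>: "\<nu> \<in> weights" and i0: "(w, \<lambda>_. 0) \<in> indices"
    using i by (auto simp: indices_def weights_def)
  define sh where "sh = (\<lambda>(u :: nat \<Rightarrow> nat, \<mu>). (u, \<lambda>j. \<nu> j + \<mu> j))"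
  have inj: "inj sh"
    by (rule injI) (auto simp: sh_def fun_eq_iff)
  have "basis_poly (w, \<lambda>_. 0) \<in> carrier (poly_ring n)"
    using R.\<Phi>_closed[OF unit_coord_in[OF i0]] by simp
  then have "perm_action g (basis_poly (w, \<lambda>_. 0)) \<in> carrier (poly_ring n)"
    using perm_action_keys(2)[OF g] by simp
  then obtain c where c: "c \<in> coord_space indices" "perm_action g (basis_poly (w, \<lambda>_. 0)) = lin_comb basis_poly c"
    using R.ex_coord by blast
  \<comment> \<open>The coefficients \<open>c\<close> are moved along the shift by
    \<open>\<nu>\<close>. Multiplying the expansion for weight zero by the invariant
    \<open>eprod \<nu>\<close> shows that \<open>d\<close> gives the expansion for weight
    \<open>\<nu>\<close>.\<close>
  define d where "d j = (if j \<in> range sh then c (the_inv sh j) else 0)" for j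
  have d_sh: "d (sh j) = c j" for j
    by (simp add: d_def the_inv_f_f[OF inj])
  have supp: "{j. d j \<noteq> 0} = sh ` {j. c j \<noteq> 0}"
    using d_sh by (auto simp: d_def the_inv_f_f[OF inj] split: if_splits)
  have fin: "finite {j. c j \<noteq> 0}"
    using c(1) by (simp add: coord_space_def)
  have sh_in: "sh j \<in> indices" if "j \<in> indices" for j
    using that \<nu> by (auto simp: sh_def indices_def weights_def)
  have d: "d \<in> coord_space indices"
  proof -
    have "finite {j. d j \<noteq> 0}"
      unfolding supp using fin by simp
    moreover have "{j. d j \<noteq> 0} \<subseteq> indices"
      unfolding supp using c(1) by (intro image_subsetI sh_in) (auto simp: coord_space_def)
    ultimately show ?thesis
      by (simp add: coord_space_def)
  qed
  have basis_sh: "basis_poly (sh j) = eprod \<nu> * basis_poly j" for j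
    by (simp add: sh_def basis_poly_def case_prod_unfold eprod_add mult.assoc)
  have "lin_comb basis_poly d = (\<Sum>j | c j \<noteq> 0. single 0 (c j) * (eprod \<nu> * basis_poly j))"
    unfolding lin_comb_def supp using inj
    by (simp add: sum.reindex[OF inj_on_subset[OF inj subset_UNIV]] d_sh basis_sh)
  also have "\<dots> = eprod \<nu> * lin_comb basis_poly c"
    unfolding lin_comb_def sum_distrib_left by (simp add: mult_ac)
  also have "\<dots> = perm_action g (basis_poly (w, \<nu>))"
    using c(2) by (simp add: basis_poly_def perm_action_mult[OF bij] perm_action_eprod[OF g])
  finally have "perm_action g (basis_poly (w, \<nu>)) = lin_comb basis_poly d"
    by (rule sym)
  then have "R.diag_coeff (perm_action g) (w, \<nu>) = d (w, \<nu>)"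
    by (simp add: R.diag_coeff_def R.coord_\<Phi>[OF d])
  also have "\<dots> = c (w, \<lambda>_. 0)"
    using d_sh[of "(w, \<lambda>_. 0)"] by (simp add: sh_def)
  also have "\<dots> = diag g w"
    using c i0 by (simp add: diag_def R.diag_coeff_def)
  finally show ?thesis .
qed

lemma sum_diag_upto:
  assumes g: "g permutes {1..n}"
  shows "(\<Sum>(w, \<nu>)\<in>indices_upto k. diag g w) = of_nat ((k + 1) ^ num_cycles n g)"
proof -
  have bij: "bij g" using g by (rule permutes_bij)
  let ?V = "(poly_ring n)\<lparr>carrier := {f. keys f \<subseteq> bounded k}\<rparr>"
  interpret B: lin_coord ?V "indices_upto k" "lin_comb basis_poly"
    using R.subspace_coord[OF indices_upto_subset] by (simp only: span_upto)
  \<comment> \<open>The monomials are a unitriangular family of their own, with constant rank, which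
    supplies the second basis for the comparison of traces.\<close>
  have "unitriangular (\<lambda>p. mono p) (bounded k) (bounded k) (\<lambda>p. p) (\<lambda>_. 0)"
    by unfold_locales (auto simp: bij_betw_def)
  then interpret M: lin_coord ?V "bounded k" "lin_comb (\<lambda>p. mono p)"
    by (rule unitriangular.lin_coord) simp_all
  have "(\<Sum>(w, \<nu>)\<in>indices_upto k. diag g w) = (\<Sum>i\<in>indices_upto k. B.diag_coeff (perm_action g) i)"
  proof (rule sum.cong)
    fix i assume i: "i \<in> indices_upto k"
    have "B.diag_coeff (perm_action g) i = R.diag_coeff (perm_action g) i"
    proof (rule R.subspace_diag_coeff[OF indices_upto_subset i])
      have "lin_comb basis_poly (unit_coord i) \<in> {f. keys f \<subseteq> bounded k}"
        using i unit_coord_in[OF i] span_upto by blast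
      then show "perm_action g (lin_comb basis_poly (unit_coord i)) \<in> lin_comb basis_poly ` coord_space (indices_upto k)"
        using perm_action_keys(1)[OF g] by (simp add: span_upto)
    qed
    then show "(case i of (w, \<nu>) \<Rightarrow> diag g w) = B.diag_coeff (perm_action g) i"
      using diag_coeff_eq[OF g] subsetD[OF indices_upto_subset i] by (cases i) simp
  qed simp
  also have "\<dots> = (\<Sum>p\<in>bounded k. M.diag_coeff (perm_action g) p)"
    by (rule B.sum_diag_coeff_independent[OF M.lin_coord_axioms finite_indices_upto finite_bounded perm_action_linear(2)[OF g]])
  also have "\<dots> = (\<Sum>p\<in>bounded k. if permute_degree g p = p then 1 else 0)"
  proof (intro sum.cong refl)
    fix p assume p: "p \<in> bounded k"
    let ?q = "permute_degree (inv_into UNIV g) p"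
    have q: "?q \<in> bounded k"
      using permute_degree_bounded[OF g, of ?q] p by (simp add: permute_degree_inverse[OF bij])
    have "M.coord (lin_comb (\<lambda>p. mono p) (unit_coord ?q)) = unit_coord ?q"
      using q by (intro M.coord_\<Phi>) simp
    then have "M.diag_coeff (perm_action g) p = unit_coord ?q p"
      by (simp add: M.diag_coeff_def perm_action_single[OF bij])
    moreover have "?q = p \<longleftrightarrow> permute_degree g p = p"
      using permute_degree_inverse[OF bij] by metis
    ultimately show "M.diag_coeff (perm_action g) p = (if permute_degree g p = p then 1 else 0)"
      by (auto simp: unit_coord_def)
  qed
  also have "\<dots> = of_nat (card {p \<in> bounded k. permute_degree g p = p})"
    by (simp add: finite_bounded flip: sum.inter_filter)
  finally show ?thesis
    by (simp only: card_fixed_degrees[OF g])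
qed

section \<open>Grouping the trace by numbers of descents\<close>

definition num_des :: "(nat \<Rightarrow> nat) \<Rightarrow> nat" where
  "num_des w = (\<Sum>j=1..n. des w j)"

definition descent_class :: "nat \<Rightarrow> (nat \<Rightarrow> nat) set" where
  "descent_class d = {w. w permutes {1..n} \<and> num_des w = d}"

lemma level_eq: "level w \<nu> = sum \<nu> {1..n} + num_des w"
  by (simp add: level_def num_des_def sum.distrib)

lemma indices_upto_eq:
  "indices_upto k = (SIGMA w:{w. w permutes {1..n} \<and> num_des w \<le> k}. weights_upto {1..n} (k - num_des w))"
  by (auto simp: indices_upto_def indices_def weights_def weights_upto_def level_eq)

lemma finite_perms: "finite {w. w permutes {1..n}}"
  by (simp add: finite_permutations)

text \<open>A permutation with \<open>d\<close> descents leaves \<open>k - d\<close> as the bound on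
  the total weight, so the trace over all indices of level at most \<open>k\<close> becomes a Cauchy
  product.\<close>

lemma convolution:
  assumes g: "g permutes {1..n}"
  shows "of_nat ((k + 1) ^ num_cycles n g)
    = (\<Sum>d=0..k. sum (diag g) (descent_class d) * of_nat (card (weights_upto {1..n} (k - d))))"
proof -
  have fin: "finite {w. w permutes {1..n} \<and> num_des w \<le> k}"
    by (rule finite_subset[OF _ finite_perms]) auto
  have "(\<Sum>d=0..k. sum (diag g) (descent_class d) * of_nat (card (weights_upto {1..n} (k - d))))
      = (\<Sum>d\<in>{0..k}. \<Sum>w\<in>{w \<in> {w. w permutes {1..n} \<and> num_des w \<le> k}. num_des w = d}.
          diag g w * of_nat (card (weights_upto {1..n} (k - num_des w))))"
    unfolding sum_distrib_right by (intro sum.cong) (auto simp: descent_class_def)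
  also have "\<dots> = (\<Sum>w | w permutes {1..n} \<and> num_des w \<le> k.
      diag g w * of_nat (card (weights_upto {1..n} (k - num_des w))))"
    using fin by (intro sum.group) auto
  also have "\<dots> = (\<Sum>w | w permutes {1..n} \<and> num_des w \<le> k. \<Sum>\<nu>\<in>weights_upto {1..n} (k - num_des w). diag g w)"
    by (simp add: mult.commute)
  also have "\<dots> = (\<Sum>(w, \<nu>)\<in>indices_upto k. diag g w)"
    unfolding indices_upto_eq using weights_upto_gf[of "{1..n}"] fin by (intro sum.Sigma) auto
  finally show ?thesis
    using sum_diag_upto[OF g] by simp
qed

lemma sum_diag_descent_class:
  assumes g: "g permutes {1..n}"
  shows "sum (diag g) (descent_class d) = tau_char n (Suc d) g"
proof -
  define A where "A = Abs_fps (\<lambda>d. sum (diag g) (descent_class d))"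
  define C where "C = Abs_fps (\<lambda>k. of_nat ((k + 1) ^ num_cycles n g) :: complex)"
  define N where "N = Abs_fps (\<lambda>m. of_nat (card (weights_upto {1..n} m)) :: complex)"
  have "A * N = C"
    by (rule fps_ext) (simp only: A_def N_def C_def fps_mult_nth fps_nth_Abs_fps convolution[OF g])
  moreover have "N * (1 - fps_X) ^ Suc n = 1"
    using weights_upto_gf[of "{1..n}"] by (simp add: N_def)
  ultimately have "A = (1 - fps_X) ^ Suc n * C"
    by (metis mult.assoc mult.commute mult.right_neutral)
  then have "sum (diag g) (descent_class d) = fps_nth ((1 - fps_X) ^ Suc n * C) d"
    unfolding A_def by (metis fps_nth_Abs_fps)
  \<comment> \<open>The coefficients of \<open>C\<close> start with \<open>1\<close> raised to the
    number of cycles, so degree \<open>d - j\<close> carries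
    \<open>sigma_char n (Suc d - j)\<close>; this causes the shift from \<open>d\<close> to
    \<open>Suc d\<close>.\<close>
  also have "\<dots> = tau_char n (Suc d) g"
    unfolding fps_mult_nth tau_char_def one_minus_X_power_nth C_def
    by (simp add: sigma_char_def Suc_diff_le)
  finally show ?thesis .
qed

section \<open>The filtration of the coinvariant algebra\<close>

lemma sorted_le_last: "sorted xs \<Longrightarrow> x \<in> set xs \<Longrightarrow> x \<le> last xs"
  by (induction xs) auto

lemma partition_of_hd:
  assumes p: "p \<in> multidegrees n"
  shows "hd (partition_of n p) \<le> k \<longleftrightarrow> p \<in> bounded k"
proof -
  let ?l = "map (lookup p) [1..<n + 1]"
  have set_l: "set ?l = lookup p ` {1..n}"
    by auto
  have ne: "sort ?l \<noteq> []"
    using n_pos by (metis Suc_eq_plus1 length_0_conv length_map length_sort length_upt diff_add_inverse2 not_one_le_zero)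
  have hd: "hd (partition_of n p) = last (sort ?l)"
    by (simp only: partition_of_def hd_rev)
  have last_in: "last (sort ?l) \<in> lookup p ` {1..n}"
    using last_in_set[OF ne] unfolding set_sort set_l .
  have last_max: "x \<le> last (sort ?l)" if "x \<in> lookup p ` {1..n}" for x
    using that sorted_le_last[OF sorted_sort, of x ?l] unfolding set_sort set_l by blast
  have "p \<in> bounded k \<longleftrightarrow> (\<forall>i\<in>{1..n}. lookup p i \<le> k)"
  proof -
    have "lookup p i = 0" if "i \<notin> {1..n}" for i
      using p that unfolding multidegrees_def by (auto simp: in_keys_iff subset_eq)
    then have "(\<forall>i. lookup p i \<le> k) \<longleftrightarrow> (\<forall>i\<in>{1..n}. lookup p i \<le> k)"
      by (metis zero_le)
    then show ?thesis
      using p by (simp add: bounded_def)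
  qed
  also have "\<dots> \<longleftrightarrow> last (sort ?l) \<le> k"
  proof
    assume "\<forall>i\<in>{1..n}. lookup p i \<le> k"
    then show "last (sort ?l) \<le> k"
      using last_in by auto
  next
    assume le: "last (sort ?l) \<le> k"
    show "\<forall>i\<in>{1..n}. lookup p i \<le> k"
    proof
      fix i assume "i \<in> {1..n}"
      then have "lookup p i \<le> last (sort ?l)"
        by (intro last_max imageI)
      then show "lookup p i \<le> k"
        using le by (rule order_trans)
    qed
  qed
  finally show ?thesis
    by (simp only: hd)
qed

lemma partition_of_in: "partition_of n p \<in> partitions n"
proof -
  have "sorted_wrt (\<ge>) (rev xs)" if "sorted xs" for xs :: "nat list"
    using that by (simp add: sorted_wrt_rev)
  then show ?thesis
    by (simp add: partitions_def partition_of_def del: upt_Suc)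
qed

lemma replicate_zero_le: "replicate (length \<mu>) (0 :: nat) \<le> \<mu>"
  by (induction \<mu>) auto

lemma hd_le: "xs \<le> ys \<Longrightarrow> length xs = length ys \<Longrightarrow> xs \<noteq> [] \<Longrightarrow> hd xs \<le> (hd ys :: nat)"
  by (cases xs; cases ys) auto

text \<open>For nonzero \<open>f\<close> the least admissible partition is the largest one occurring
  among its monomials. Lexicographic order compares first parts first, so a bound on the first part
  of the maximum bounds the first parts of all.\<close>

lemma filt_eq: "filt n k = {f. keys f \<subseteq> bounded k}"
proof -
  have "hd (pdeg n f) \<le> k \<longleftrightarrow> keys f \<subseteq> bounded k" if f: "keys f \<subseteq> multidegrees n" for f
  proof (cases "f = 0")
    case True
    \<comment> \<open>No monomial occurs, hence every partition is admissible and the least one is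
      zero; its head exists because \<open>n\<close> is positive.\<close>
    have "pdeg n f = replicate n 0"
      unfolding pdeg_def using True replicate_zero_le
      by (intro Least_equality) (auto simp: partitions_def sorted_wrt_iff_nth_less)
    then show ?thesis
      using True n_pos by (cases n) auto
  next
    case False
    define M where "M = partition_of n ` keys f"
    have M: "finite M" "M \<noteq> {}"
      using False by (auto simp: M_def)
    have len: "length \<mu> = n" if "\<mu> \<in> M" for \<mu>
      using that partition_of_in by (auto simp: M_def partitions_def)
    have pdeg: "pdeg n f = Max M"
      unfolding pdeg_def
    proof (rule Least_equality)
      show "Max M \<in> partitions n \<and>
        (\<forall>p\<in>multidegrees n. Max M < partition_of n p \<longrightarrow> lookup f p = 0)"
      proof (intro conjI ballI impI)
        show "Max M \<in> partitions n"
          using Max_in[OF M] partition_of_in by (auto simp: M_def)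
        fix p assume "Max M < partition_of n p"
        then have "partition_of n p \<notin> M"
          using Max_ge[OF M(1)] by (meson leD)
        then show "lookup f p = 0"
          by (auto simp: M_def in_keys_iff)
      qed
    next
      fix \<mu> assume \<mu>: "\<mu> \<in> partitions n \<and> (\<forall>p\<in>multidegrees n. \<mu> < partition_of n p \<longrightarrow> lookup f p = 0)"
      have "partition_of n p \<le> \<mu>" if "p \<in> keys f" for p
        using \<mu> f that by (metis in_keys_iff not_le subsetD)
      then show "Max M \<le> \<mu>"
        using M by (auto simp: M_def)
    qed
    have "hd (Max M) \<le> k \<longleftrightarrow> (\<forall>\<mu>\<in>M. hd \<mu> \<le> k)"
    proof
      assume le: "hd (Max M) \<le> k"
      show "\<forall>\<mu>\<in>M. hd \<mu> \<le> k"
      proof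
        fix \<mu> assume "\<mu> \<in> M"
        then have "hd \<mu> \<le> hd (Max M)"
          using Max_ge[OF M(1)] len[OF \<open>\<mu> \<in> M\<close>] len[OF Max_in[OF M]] n_pos by (intro hd_le) auto
        with le show "hd \<mu> \<le> k" by simp
      qed
    qed (use Max_in[OF M] in blast)
    also have "\<dots> \<longleftrightarrow> keys f \<subseteq> bounded k"
      using partition_of_hd f unfolding M_def by blast
    finally show ?thesis
      by (simp only: pdeg)
  qed
  moreover have "keys f \<subseteq> multidegrees n" if "keys f \<subseteq> bounded k" for f :: mpoly
    using that bounded_subset by blast
  ultimately show ?thesis
    unfolding filt_def poly_ring_simps by blast
qed

lemma sym_group_simps [simp]:
  "carrier (sym_group n) = {g. g permutes {1..n}}" "mult (sym_group n) = (\<circ>)" "\<one>\<^bsub>sym_group n\<^esub> = id"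
  by (simp_all add: sym_group_def)

lemma poly_group_module: "group_module (sym_group n) (poly_ring n) perm_action"
  by (rule R.group_moduleI[OF sym_group_is_group])
    (auto simp: perm_action_linear perm_action_id perm_action_comp permutes_bij)

section \<open>Descent monomials as a basis of the coinvariant algebra\<close>

abbreviation coinv_coord :: "((nat \<Rightarrow> nat) \<times> (nat \<Rightarrow> nat) \<Rightarrow> complex) \<Rightarrow> mpoly set" where
  "coinv_coord c \<equiv> lin_comb basis_poly ` coord_space ideal_indices +>\<^bsub>poly_ring n\<^esub> lin_comb basis_poly c"

lemma coinv_algebra_eq: "coinv_algebra n = quotient_module (poly_ring n) (lin_comb basis_poly ` coord_space ideal_indices)"
  by (simp add: coinv_algebra_def coinv_ideal_eq)

sublocale Q: lin_coord "coinv_algebra n" "indices - ideal_indices" coinv_coord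
  unfolding coinv_algebra_eq by (rule R.quotient_coord[OF ideal_indices_subset])

text \<open>A permutation fixes \<open>eprod \<nu>\<close> and moves only the descent monomial,
  whose image is expanded afresh and then shifted by the nonzero \<open>\<nu>\<close>. The inverse
  permutation turns the inclusion into an equality.\<close>

lemma perm_action_ideal:
  assumes g: "g permutes {1..n}"
  shows "perm_action g ` (lin_comb basis_poly ` coord_space ideal_indices) = lin_comb basis_poly ` coord_space ideal_indices"
proof -
  let ?J = "lin_comb basis_poly ` coord_space ideal_indices"
  have sub: "perm_action h ` ?J \<subseteq> ?J" if h: "h permutes {1..n}" for h
  proof clarify
    fix c assume c: "c \<in> coord_space ideal_indices"
    have "perm_action h (lin_comb basis_poly c)
        = (\<Sum>i | c i \<noteq> 0. single 0 (c i) * perm_action h (basis_poly i))"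
      unfolding lin_comb_def by (simp add: perm_action_sum perm_action_scale permutes_bij[OF h])
    also have "\<dots> \<in> ?J"
    proof (intro lin_comb_image_sum lin_comb_image_scale)
      fix i assume "i \<in> {i. c i \<noteq> 0}"
      then have "i \<in> ideal_indices"
        using c by (auto simp: coord_space_def)
      then obtain w \<nu> where i: "i = (w, \<nu>)" "w permutes {1..n}" "\<nu> \<in> weights" "\<nu> \<noteq> (\<lambda>_. 0)"
        by (auto simp: ideal_indices_def indices_def)
      have "keys (perm_action h (mono (expo w (\<lambda>_. 0)))) \<subseteq> multidegrees n"
        using expo_in_multidegrees[OF i(2)] by (simp add: perm_action_keys(2)[OF h])
      then have "perm_action h (mono (expo w (\<lambda>_. 0))) \<in> lin_comb basis_poly ` coord_space indices"
        using R.ex_coord by auto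
      then have "eprod \<nu> * perm_action h (mono (expo w (\<lambda>_. 0))) \<in> ?J"
        by (rule eprod_times_in_span) (use i in \<open>auto simp: ideal_indices_def indices_def weights_def fun_eq_iff\<close>)
      then show "perm_action h (basis_poly i) \<in> ?J"
        by (simp add: i(1) basis_poly_def perm_action_mult[OF permutes_bij[OF h]] perm_action_eprod[OF h])
    qed
    finally show "perm_action h (lin_comb basis_poly c) \<in> ?J" .
  qed
  have "f \<in> perm_action g ` ?J" if "f \<in> ?J" for f
  proof (rule image_eqI)
    have inv: "inv_into UNIV g permutes {1..n}"
      using g by (rule permutes_inv)
    show "perm_action (inv_into UNIV g) f \<in> ?J"
      using sub[OF inv] that by blast
    have "f = perm_action (g \<circ> inv_into UNIV g) f"
      using permutes_inv_o(1)[OF g] by (simp add: perm_action_id)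
    then show "f = perm_action g (perm_action (inv_into UNIV g) f)"
      by (simp only: perm_action_comp[OF permutes_bij[OF g] permutes_bij[OF inv]])
  qed
  then show ?thesis
    using sub[OF g] by blast
qed

lemma coinv_group_module: "group_module (sym_group n) (coinv_algebra n) coinv_action"
  unfolding coinv_algebra_eq coinv_action_def
  by (rule R.quotient_group_module[OF poly_group_module ideal_indices_subset]) (simp add: perm_action_ideal)

lemma coinv_diag_coeff:
  assumes "g permutes {1..n}" "i \<in> indices - ideal_indices"
  shows "Q.diag_coeff (coinv_action g) i = R.diag_coeff (perm_action g) i"
proof -
  have "coinv_action g = (`) (perm_action g)"
    by (simp add: coinv_action_def quotient_action_def fun_eq_iff)
  then show ?thesis
    using R.quotient_diag_coeff[OF ideal_indices_subset perm_action_linear(1)[OF assms(1)]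
        perm_action_ideal[OF assms(1)] assms(2)] by simp
qed

text \<open>The integer bound yields the empty set for negative \<open>k\<close>, in agreement with
  the convention that the filtration is zero there.\<close>

definition filt_indices :: "int \<Rightarrow> ((nat \<Rightarrow> nat) \<times> (nat \<Rightarrow> nat)) set" where
  "filt_indices k = (\<lambda>w. (w, \<lambda>_. 0)) ` {w. w permutes {1..n} \<and> int (num_des w) \<le> k}"

lemma filt_indices_subset: "filt_indices k \<subseteq> indices - ideal_indices"
  by (auto simp: filt_indices_def indices_def ideal_indices_def weights_def)

lemma filt_indices_mono: "k \<le> l \<Longrightarrow> filt_indices k \<subseteq> filt_indices l"
  by (auto simp: filt_indices_def)

lemma finite_filt_indices: "finite (filt_indices k)"
  unfolding filt_indices_def by (intro finite_imageI finite_subset[OF _ finite_perms]) auto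

lemma coinv_proj_eq: "coinv_proj n (lin_comb basis_poly c) = coinv_coord c"
  by (simp only: coinv_proj_def coinv_ideal_eq)

text \<open>Modulo the ideal only the coordinates with \<open>\<nu> = 0\<close> survive, and at
  those the level is the number of descents. That the basis is adapted both to the ideal and to the
  filtration is what makes the image this easy to describe.\<close>

lemma coinv_filt_eq: "coinv_filt n k = coinv_coord ` coord_space (filt_indices k)"
proof (cases "k < 0")
  case True
  then have "filt_indices k = {}"
    by (auto simp: filt_indices_def)
  then have "coord_space (filt_indices k) = {\<lambda>_. 0}"
    by (auto simp: coord_space_def)
  then show ?thesis
    using True Q.\<Phi>_zero by (simp add: coinv_filt_def)
next
  case False
  have "coinv_filt n k = coinv_proj n ` lin_comb basis_poly ` coord_space (indices_upto (nat k))"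
    using False by (simp add: coinv_filt_def filt_eq span_upto)
  also have "\<dots> = coinv_coord ` coord_space (indices_upto (nat k))"
    by (simp only: image_image coinv_proj_eq)
  also have "\<dots> = coinv_coord ` coord_space (filt_indices k)"
  proof (intro equalityI subsetI)
    fix X assume "X \<in> coinv_coord ` coord_space (indices_upto (nat k))"
    then obtain c where c: "c \<in> coord_space (indices_upto (nat k))" "X = coinv_coord c" by blast
    define d where "d i = (if i \<notin> ideal_indices then c i else 0)" for i
    have d: "d \<in> coord_space {i \<in> indices_upto (nat k). i \<notin> ideal_indices}"
      unfolding d_def using c(1) by (rule coord_space_restrict)
    have "{i \<in> indices_upto (nat k). i \<notin> ideal_indices} \<subseteq> filt_indices k"
      using False by (auto simp: indices_upto_def ideal_indices_def filt_indices_def indices_def level_eq)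
    then have "d \<in> coord_space (filt_indices k)"
      using d by (rule coord_space_mono[rotated])
    moreover have "X = coinv_coord d"
      using c d coord_space_mono[of _ _ indices] indices_upto_subset
      by (subst c(2), subst R.coset_eq_iff[OF ideal_indices_subset])
        (auto simp: d_def elim!: coord_space_mono dest: subsetD[OF indices_upto_subset])
    ultimately show "X \<in> coinv_coord ` coord_space (filt_indices k)" by blast
  next
    have "filt_indices k \<subseteq> indices_upto (nat k)"
      using False by (auto simp: indices_upto_def filt_indices_def indices_def weights_def level_eq)
    then show "X \<in> coinv_coord ` coord_space (indices_upto (nat k))"
      if "X \<in> coinv_coord ` coord_space (filt_indices k)" for X
      using that coord_space_mono by blast
  qed
  finally show ?thesis .
qed

lemma coinv_filt_stable:
  assumes g: "g permutes {1..n}"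
  shows "coinv_action g ` coinv_filt n k \<subseteq> coinv_filt n k"
proof (cases "k < 0")
  case True
  interpret group_module "sym_group n" "coinv_algebra n" coinv_action
    by (rule coinv_group_module)
  have "coinv_action g \<zero>\<^bsub>coinv_algebra n\<^esub> = coinv_action g (0 \<odot>\<^bsub>coinv_algebra n\<^esub> \<zero>\<^bsub>coinv_algebra n\<^esub>)"
    using smult_l_null by simp
  also have "\<dots> = \<zero>\<^bsub>coinv_algebra n\<^esub>"
    using LinearCombinations.module_hom_smult[OF act_linear, of g 0 "\<zero>\<^bsub>coinv_algebra n\<^esub>"] g
      module_hom_closed[OF act_linear, of g] smult_l_null by auto
  finally show ?thesis
    using True by (simp add: coinv_filt_def)
next
  case False
  have "coinv_action g (coinv_proj n f) = coinv_proj n (perm_action g f)" if "keys f \<subseteq> multidegrees n" for f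
    using R.image_coset[OF ideal_indices_subset perm_action_linear(1)[OF g] perm_action_ideal[OF g], of f] that
    by (simp add: coinv_action_def quotient_action_def coinv_proj_def coinv_ideal_eq)
  then show ?thesis
    using False perm_action_keys(1)[OF g] bounded_subset
    by (fastforce simp: coinv_filt_def filt_eq)
qed

lemma coinv_filt_module_coord: "lin_coord (coinv_filt_module n k) (filt_indices k) coinv_coord"
  unfolding coinv_filt_module_def coinv_filt_eq by (rule Q.subspace_coord[OF filt_indices_subset])

lemma coinv_filt_group_module: "group_module (sym_group n) (coinv_filt_module n k) coinv_action"
  unfolding coinv_filt_module_def coinv_filt_eq
  using coinv_filt_stable by (intro Q.subspace_group_module coinv_group_module filt_indices_subset) (simp add: coinv_filt_eq)

lemma coinv_filt_diag_coeff:
  assumes g: "g permutes {1..n}" and i: "i \<in> filt_indices k"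
  shows "lin_coord.diag_coeff (filt_indices k) coinv_coord (coinv_action g) i = diag g (fst i)"
proof -
  have "coinv_coord (unit_coord i) \<in> coinv_filt n k"
    unfolding coinv_filt_eq using i by (intro imageI unit_coord_in)
  then have "coinv_action g (coinv_coord (unit_coord i)) \<in> coinv_coord ` coord_space (filt_indices k)"
    using coinv_filt_stable[OF g, of k] unfolding coinv_filt_eq by blast
  then have "lin_coord.diag_coeff (filt_indices k) coinv_coord (coinv_action g) i = Q.diag_coeff (coinv_action g) i"
    by (rule Q.subspace_diag_coeff[OF filt_indices_subset i])
  also have "\<dots> = R.diag_coeff (perm_action g) i"
    using coinv_diag_coeff[OF g] filt_indices_subset i by blast
  also have "\<dots> = diag g (fst i)"
    using i by (auto simp: diag_def filt_indices_def)
  finally show ?thesis .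
qed

text \<open>The action on a quotient takes images of cosets, which are cosets again only if the
  subspace is mapped onto itself; the inverse permutation supplies surjectivity.\<close>

lemma coinv_filt_stable_eq:
  assumes g: "g permutes {1..n}"
  shows "coinv_action g ` coinv_filt n k = coinv_filt n k"
proof
  interpret group_module "sym_group n" "coinv_algebra n" coinv_action
    by (rule coinv_group_module)
  show "coinv_filt n k \<subseteq> coinv_action g ` coinv_filt n k"
  proof
    fix X assume X: "X \<in> coinv_filt n k"
    have inv: "inv_into UNIV g permutes {1..n}"
      using g by (rule permutes_inv)
    have "X \<in> carrier (coinv_algebra n)"
      using X Q.\<Phi>_closed coord_space_mono[OF _ filt_indices_subset] unfolding coinv_filt_eq by blast
    then have "X = coinv_action g (coinv_action (inv_into UNIV g) X)"
      using act_mult[of g "inv_into UNIV g" X] act_one[of X] g inv permutes_inv_o(1)[OF g] by simp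
    then show "X \<in> coinv_action g ` coinv_filt n k"
      using coinv_filt_stable[OF inv] X by blast
  qed
qed (rule coinv_filt_stable[OF g])

lemma graded_piece:
  fixes k :: int
  defines "W \<equiv> quotient_module (coinv_filt_module n k) (coinv_filt n (k - 1))"
    and "\<Psi> \<equiv> \<lambda>c. coinv_filt n (k - 1) +>\<^bsub>coinv_filt_module n k\<^esub> coinv_coord c"
  shows "lin_coord W (filt_indices k - filt_indices (k - 1)) \<Psi>"
    and "group_module (sym_group n) W (quotient_action coinv_action)"
    and "\<lbrakk>g permutes {1..n}; i \<in> filt_indices k - filt_indices (k - 1)\<rbrakk> \<Longrightarrow>
      lin_coord.diag_coeff (filt_indices k - filt_indices (k - 1)) \<Psi> (quotient_action coinv_action g) i = diag g (fst i)"
proof -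
  interpret F: lin_coord "coinv_filt_module n k" "filt_indices k" coinv_coord
    by (rule coinv_filt_module_coord)
  interpret G: group_module "sym_group n" "coinv_filt_module n k" coinv_action
    by (rule coinv_filt_group_module)
  have sub: "filt_indices (k - 1) \<subseteq> filt_indices k"
    by (rule filt_indices_mono) simp
  show "lin_coord W (filt_indices k - filt_indices (k - 1)) \<Psi>"
    unfolding W_def \<Psi>_def coinv_filt_eq by (rule F.quotient_coord[OF sub])
  show "group_module (sym_group n) W (quotient_action coinv_action)"
    unfolding W_def coinv_filt_eq using coinv_filt_stable_eq
    by (intro F.quotient_group_module coinv_filt_group_module sub) (simp add: coinv_filt_eq)
  assume g: "g permutes {1..n}" and i: "i \<in> filt_indices k - filt_indices (k - 1)"
  have "lin_coord.diag_coeff (filt_indices k - filt_indices (k - 1)) \<Psi> ((`) (coinv_action g)) i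
      = F.diag_coeff (coinv_action g) i"
    unfolding \<Psi>_def coinv_filt_eq
    using g i coinv_filt_stable_eq[OF g, of "k - 1"] G.act_linear[of g]
    by (intro F.quotient_diag_coeff[OF sub]) (simp_all add: coinv_filt_eq)
  also have "\<dots> = diag g (fst i)"
    using coinv_filt_diag_coeff[OF g] i by blast
  finally show "lin_coord.diag_coeff (filt_indices k - filt_indices (k - 1)) \<Psi> (quotient_action coinv_action g) i = diag g (fst i)"
    by (simp add: quotient_action_def[abs_def])
qed

text \<open>The indices surviving in the quotient are the permutations with exactly \<open>d\<close>
  descents.\<close>

lemma sum_diag_graded:
  assumes g: "g permutes {1..n}"
  shows "(\<Sum>i\<in>filt_indices (int d) - filt_indices (int d - 1). diag g (fst i)) = tau_char n (Suc d) g"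
proof -
  have "filt_indices (int d) - filt_indices (int d - 1) = (\<lambda>w. (w, \<lambda>_. 0)) ` descent_class d"
    by (auto simp: filt_indices_def descent_class_def image_iff)
  then show ?thesis
    by (simp add: sum.reindex inj_on_def sum_diag_descent_class[OF g])
qed

lemma sum_diag_filt:
  assumes g: "g permutes {1..n}"
  shows "(\<Sum>i\<in>filt_indices (int k - 1). diag g (fst i)) = (\<Sum>j=1..k. tau_char n j g)"
proof (induction k)
  case 0
  have "filt_indices (- 1) = {}"
    by (auto simp: filt_indices_def)
  then show ?case by simp
next
  case (Suc k)
  have "filt_indices (int k - 1) \<subseteq> filt_indices (int k)"
    by (rule filt_indices_mono) simp
  then have "(\<Sum>i\<in>filt_indices (int k). diag g (fst i))
      = (\<Sum>i\<in>filt_indices (int k) - filt_indices (int k - 1). diag g (fst i)) + (\<Sum>i\<in>filt_indices (int k - 1). diag g (fst i))"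
    by (rule sum.subset_diff[OF _ finite_filt_indices])
  then show ?case
    by (simp add: sum_diag_graded[OF g] Suc)
qed

end

theorem theorem4p4:
  fixes n :: nat
    and V :: "nat \<Rightarrow> (complex, 'v) module"
    and \<pi> :: "nat \<Rightarrow> (nat \<Rightarrow> nat) \<Rightarrow> 'v \<Rightarrow> 'v"
  assumes "n \<ge> 1"
    and "\<And>k. k \<in> {1..n} \<Longrightarrow> fin_dim_representation (sym_group n) (V k) (\<pi> k)"
    and "\<And>k g. \<lbrakk>k \<in> {1..n}; g \<in> carrier (sym_group n)\<rbrakk>
           \<Longrightarrow> character (V k) (\<pi> k) g = tau_char n k g"
  shows "\<forall>k \<in> {1..n}.
     group_module_iso (sym_group n)
       (coinv_filt_module n (int k - 1)) coinv_action
       (module_sum {1..k} V) (action_sum {1..k} \<pi>) \<and>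
     group_module_iso (sym_group n)
       (V k) (\<pi> k)
       (quotient_module (coinv_filt_module n (int k - 1)) (coinv_filt n (int k - 2)))
       (quotient_action coinv_action)"
proof
  fix k assume k: "k \<in> {1..n}"
  interpret coinvariants n by unfold_locales (rule assms(1))
  have "\<forall>k\<in>{1..n}. \<exists>I :: 'v set. \<exists>\<Phi>. finite I \<and> lin_coord (V k) I \<Phi> \<and>
     (\<forall>T\<in>module_hom complex_field (V k) (V k). linear_trace (V k) T = (\<Sum>i\<in>I. lin_coord.diag_coeff I \<Phi> T i))"
    using fin_dim_coord[OF assms(2)] by blast
  then obtain I :: "nat \<Rightarrow> 'v set" and \<Phi> where I: "\<And>k. k \<in> {1..n} \<Longrightarrow> finite (I k)"
    and \<Phi>: "\<And>k. k \<in> {1..n} \<Longrightarrow> lin_coord (V k) (I k) (\<Phi> k)"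
    and trace: "\<And>k T. \<lbrakk>k \<in> {1..n}; T \<in> module_hom complex_field (V k) (V k)\<rbrakk> \<Longrightarrow>
      linear_trace (V k) T = (\<Sum>i\<in>I k. lin_coord.diag_coeff (I k) (\<Phi> k) T i)"
    by metis
  have rep: "group_module (sym_group n) (V k) (\<pi> k)" if "k \<in> {1..n}" for k
    using assms(2)[OF that] by (rule fin_dim_representation.axioms(1))
  have linear: "\<pi> k g \<in> module_hom complex_field (V k) (V k)" if "k \<in> {1..n}" "g permutes {1..n}" for k g
    using group_module.act_linear[OF rep[OF that(1)]] that(2) by simp
  have tau: "(\<Sum>i\<in>I k. lin_coord.diag_coeff (I k) (\<Phi> k) (\<pi> k g) i) = tau_char n k g"
    if "k \<in> {1..n}" "g permutes {1..n}" for k g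
    using assms(3)[OF that(1), of g] trace[OF that(1) linear[OF that]] that(2) by (simp add: character_def)
  have fin: "finite (carrier (sym_group n))"
    by (simp add: finite_permutations)
  have sub: "i \<in> {1..n}" if "i \<in> {1..k}" for i
    using that k by simp
  define \<Psi> where "\<Psi> = (\<lambda>c. \<lambda>i\<in>{1..k}. \<Phi> i (\<lambda>j. c (i, j)))"
  have sum_coord: "lin_coord (module_sum {1..k} V) (Sigma {1..k} I) \<Psi>"
    unfolding \<Psi>_def using sub I \<Phi> by (intro module_sum_coord) auto
  have sum_diag: "lin_coord.diag_coeff (Sigma {1..k} I) \<Psi> (action_sum {1..k} \<pi> g) (i, j)
      = lin_coord.diag_coeff (I i) (\<Phi> i) (\<pi> i g) j"
    if "g permutes {1..n}" "i \<in> {1..k}" "j \<in> I i" for g i j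
    unfolding \<Psi>_def action_sum_def using that sub I \<Phi> linear by (intro module_sum_coord(2)) auto
  interpret S: lin_coord "module_sum {1..k} V" "Sigma {1..k} I" \<Psi>
    by (rule sum_coord)
  have sum_rep: "group_module (sym_group n) (module_sum {1..k} V) (action_sum {1..k} \<pi>)"
  proof (rule S.group_moduleI[OF sym_group_is_group])
    fix g assume g: "g \<in> carrier (sym_group n)"
    then have lin: "\<pi> i g \<in> module_hom complex_field (V i) (V i)" if "i \<in> {1..k}" for i
      using linear sub[OF that] by simp
    show "action_sum {1..k} \<pi> g \<in> module_hom complex_field (module_sum {1..k} V) (module_sum {1..k} V)"
      using lin unfolding LinearCombinations.module_hom_def
      by (auto simp: action_sum_def module_sum_def fun_eq_iff PiE_iff Pi_iff)
  next
    fix x assume "x \<in> carrier (module_sum {1..k} V)"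
    then show "action_sum {1..k} \<pi> \<one>\<^bsub>sym_group n\<^esub> x = x"
      using group_module.act_one[OF rep[OF sub]]
      by (auto simp: action_sum_def module_sum_def fun_eq_iff PiE_iff extensional_def)
  next
    fix g h x assume "g \<in> carrier (sym_group n)" "h \<in> carrier (sym_group n)" "x \<in> carrier (module_sum {1..k} V)"
    then show "action_sum {1..k} \<pi> (g \<otimes>\<^bsub>sym_group n\<^esub> h) x = action_sum {1..k} \<pi> g (action_sum {1..k} \<pi> h x)"
      using group_module.act_mult[OF rep[OF sub]]
      by (auto simp: action_sum_def module_sum_def fun_eq_iff PiE_iff)
  qed
  have "group_module_iso (sym_group n) (coinv_filt_module n (int k - 1)) coinv_action
      (module_sum {1..k} V) (action_sum {1..k} \<pi>)"
  proof (rule group_module_iso_if_same_traces[OF coinv_filt_group_module coinv_filt_module_coord finite_filt_indices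
        sum_rep sum_coord _ fin])
    show "finite (Sigma {1..k} I)"
      using I sub by auto
    fix g assume "g \<in> carrier (sym_group n)"
    then have g: "g permutes {1..n}" by simp
    have "(\<Sum>x\<in>Sigma {1..k} I. lin_coord.diag_coeff (Sigma {1..k} I) \<Psi> (action_sum {1..k} \<pi> g) x)
        = (\<Sum>i=1..k. \<Sum>j\<in>I i. lin_coord.diag_coeff (I i) (\<Phi> i) (\<pi> i g) j)"
      using I sub sum_diag[OF g] by (subst sum.Sigma) (auto intro!: sum.cong)
    also have "\<dots> = (\<Sum>i=1..k. tau_char n i g)"
      using tau sub g by (intro sum.cong) auto
    also have "\<dots> = (\<Sum>i\<in>filt_indices (int k - 1). diag g (fst i))"
      by (rule sum_diag_filt[OF g, symmetric])
    also have "\<dots> = (\<Sum>i\<in>filt_indices (int k - 1).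
        lin_coord.diag_coeff (filt_indices (int k - 1)) coinv_coord (coinv_action g) i)"
      by (rule sum.cong[OF refl], rule coinv_filt_diag_coeff[OF g, symmetric])
    finally show "(\<Sum>i\<in>filt_indices (int k - 1).
        lin_coord.diag_coeff (filt_indices (int k - 1)) coinv_coord (coinv_action g) i)
        = (\<Sum>x\<in>Sigma {1..k} I. lin_coord.diag_coeff (Sigma {1..k} I) \<Psi> (action_sum {1..k} \<pi> g) x)" ..
  qed
  moreover have "group_module_iso (sym_group n) (V k) (\<pi> k)
      (quotient_module (coinv_filt_module n (int k - 1)) (coinv_filt n (int k - 1 - 1))) (quotient_action coinv_action)"
  proof (rule group_module_iso_if_same_traces[OF rep[OF k] \<Phi>[OF k] I[OF k] graded_piece(2) graded_piece(1) _ fin])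
    show "finite (filt_indices (int k - 1) - filt_indices (int k - 1 - 1))"
      using finite_filt_indices by blast
    fix g assume "g \<in> carrier (sym_group n)"
    then have g: "g permutes {1..n}" by simp
    \<comment> \<open>The representation with character \<open>tau_char n k\<close> matches the
      permutations with \<open>k - 1\<close> descents.\<close>
    have "int k - 1 = int (k - 1)" "Suc (k - 1) = k"
      using k by auto
    then have "(\<Sum>i\<in>filt_indices (int k - 1) - filt_indices (int k - 1 - 1). diag g (fst i)) = tau_char n k g"
      using sum_diag_graded[OF g, of "k - 1"] by simp
    moreover have "(\<Sum>i\<in>filt_indices (int k - 1) - filt_indices (int k - 1 - 1).
            lin_coord.diag_coeff (filt_indices (int k - 1) - filt_indices (int k - 1 - 1))
              (\<lambda>c. coinv_filt n (int k - 1 - 1) +>\<^bsub>coinv_filt_module n (int k - 1)\<^esub> coinv_coord c)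
              (quotient_action coinv_action g) i)
        = (\<Sum>i\<in>filt_indices (int k - 1) - filt_indices (int k - 1 - 1). diag g (fst i))"
      by (rule sum.cong[OF refl], rule graded_piece(3)[OF g])
    ultimately show "(\<Sum>i\<in>I k. lin_coord.diag_coeff (I k) (\<Phi> k) (\<pi> k g) i)
        = (\<Sum>i\<in>filt_indices (int k - 1) - filt_indices (int k - 1 - 1).
            lin_coord.diag_coeff (filt_indices (int k - 1) - filt_indices (int k - 1 - 1))
              (\<lambda>c. coinv_filt n (int k - 1 - 1) +>\<^bsub>coinv_filt_module n (int k - 1)\<^esub> coinv_coord c)
              (quotient_action coinv_action g) i)"
      using tau[OF k g] by (simp only:)
  qed
  ultimately show "group_module_iso (sym_group n) (coinv_filt_module n (int k - 1)) coinv_action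
       (module_sum {1..k} V) (action_sum {1..k} \<pi>) \<and>
     group_module_iso (sym_group n) (V k) (\<pi> k)
       (quotient_module (coinv_filt_module n (int k - 1)) (coinv_filt n (int k - 2)))
       (quotient_action coinv_action)"
    by simp
qed

end
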